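(* Let $E$ be a Banach space, $V\subset E$ an open set, $s\in\mathbb N$, and let $\xi=\{X_\alpha\}_{\alpha\in A}$ be a family of local vector fields, indexed by a finite, countable or uncountable ordered set $A$, such that $V\subset \mathrm{Dom}(X_\alpha)$ for all $\alpha\in A$. Let $x_0\in V$ and $r>0$ be such that the closed ball $B_f(x_0,2r)$ is contained in $V$, and assume that there is a constant $k>0$ with $$\sup\{\|J^{s+2}[X_\alpha](y)\|:\ \alpha\in A,\ y\in V\}\le k .$$ Then there exists an open connected neighborhood $U_0$ of $x_0$ such that: 1. Fix any $\tau=(\tau_\alpha)_{\alpha\in A}\in\mathbb R^A$ with $\|\tau\|_1\le \frac rk$. Let $B$ be any countable subset of $A$ which contains all the indexes $\alpha$ such that $\tau_\alpha\neq 0$. Identifying $B$ with $\mathbb N$ (as ordered sets), denote by $\{\tau_m, m\in B\}$ the associated subsequence of $\{\tau_\alpha,\alpha\in A\}$ (and by $X_m$ the corresponding vector fields). Then for any $x\in U_0$: (a) $\phi^\xi_\tau(x)=\lim_{m\to\infty}\phi^{X_m}_{\tau_m}\circ\cdots\circ\phi^{X_1}_{\tau_1}(x)$ exists; (b) $\hat\phi^\xi_\tau(x)=\lim_{m\to\infty}\phi^{X_1}_{-\tau_1}\circ\cdots\circ\phi^{X_m}_{-\tau_m}(x)$ exists; (c) the map $\phi^\xi_\tau:x\mapsto\phi^\xi_\tau(x)$ is a local $C^s$-diffeomorphism whose inverse mapping is $\hat\phi^\xi_\tau:x\mapsto\hat\phi^\xi_\tau(x)$. 2. For $x\in U_0$,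 the map $\Psi^x:B(0,\frac rk)\to V$, $\tau\mapsto\Psi^x(\tau)=\phi^\xi_\tau(x)$, where $B(0,\frac rk)$ is the open ball of $\mathbb R^A$, is of class $C^s$.
   Context: A local vector field is a smooth vector field $X$ defined on an open set $\mathrm{Dom}(X)$; $\phi^X_t$ is its flow. $V$ is the domain of a chart of a Banach manifold modelled on $E$, identified with an open subset of $E$. For a vector field $X$ on an open set of $E$, $\|J^{m}[X](y)\|$ is the sum of $\|X(y)\|$ and of the norms of the derivatives of $X$ of orders $1,\dots,m$ at $y$ (usual norms on the spaces of continuous symmetric multilinear maps). $\mathbb R^A$ (also written $\ell^1(A)$) is the Banach space of absolutely summable families $(u_\alpha)_{\alpha\in A}$ of real numbers with norm $\|u\|_1=\sum_{\alpha\in A}|u_\alpha|$. Convention: countable ordered index sets are identified with $\mathbb N$ as ordered sets; when the index set is finite, $A=\{1,\dots,n\}$, the limits above are the finite compositions $\phi^{X_n}_{\tau_n}\circ\cdots\circ\phi^{X_1}_{\tau_1}$ and $\phi^{X_1}_{-\tau_1}\circ\cdots\circ\phi^{X_n}_{-\tau_n}$. *)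

theory Defs
  imports "HOL-Analysis.Analysis"
begin

section \<open>Bounded multilinear maps\<close>

text \<open>
  One type houses the bounded \<open>m\<close>-linear maps from \<open>'a\<close> to \<open>'b\<close> for all \<open>m\<close> simultaneously: the
  arguments are passed as a list, and an \<open>m\<close>-linear map is an element that vanishes on all lists
  whose length is not \<open>m\<close>. On such elements the norm below is the usual norm, that is the
  supremum of \<open>norm (T [v\<^sub>1, \<dots>, v\<^sub>m])\<close> over vectors \<open>v\<^sub>i\<close> in the closed unit ball.
\<close>

typedef (overloaded) ('a, 'b) multilin =
  "{T :: 'a::real_normed_vector list \<Rightarrow> 'b::real_normed_vector.
     (\<forall>us ws. linear (\<lambda>v. T (us @ v # ws))) \<and>
     (\<exists>K. \<forall>vs. norm (T vs) \<le> K * prod_list (map norm vs))}"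
  morphisms multilin_apply Multilin
  by (rule exI[of _ "\<lambda>_. 0"])
     (auto intro!: exI[of _ 0] simp: linear_iff)

setup_lifting type_definition_multilin

lemma multilin_eqI: "(\<And>vs. multilin_apply S vs = multilin_apply T vs) \<Longrightarrow> S = T"
  by transfer auto

instantiation multilin :: (real_normed_vector, real_normed_vector) real_vector
begin

lift_definition zero_multilin :: "('a, 'b) multilin" is "\<lambda>_. 0"
  by (auto intro!: exI[of _ 0] simp: linear_iff)

lift_definition plus_multilin :: "('a, 'b) multilin \<Rightarrow> ('a, 'b) multilin \<Rightarrow> ('a, 'b) multilin"
  is "\<lambda>S T vs. S vs + T vs"
proof (intro conjI allI)
  fix S T :: "'a list \<Rightarrow> 'b"
  assume S: "(\<forall>us ws. linear (\<lambda>v. S (us @ v # ws))) \<and>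
      (\<exists>K. \<forall>vs. norm (S vs) \<le> K * prod_list (map norm vs))"
    and T: "(\<forall>us ws. linear (\<lambda>v. T (us @ v # ws))) \<and>
      (\<exists>K. \<forall>vs. norm (T vs) \<le> K * prod_list (map norm vs))"
  show "linear (\<lambda>v. S (us @ v # ws) + T (us @ v # ws))" for us ws
    using S T by (intro linear_compose_add) auto
  from S T obtain K L where
    "\<And>vs. norm (S vs) \<le> K * prod_list (map norm vs)"
    "\<And>vs. norm (T vs) \<le> L * prod_list (map norm vs)" by blast
  then have "norm (S vs + T vs) \<le> (K + L) * prod_list (map norm vs)" for vs
    unfolding distrib_right by (intro norm_triangle_le add_mono)
  then show "\<exists>K. \<forall>vs. norm (S vs + T vs) \<le> K * prod_list (map norm vs)" by blast
qed

lift_definition scaleR_multilin :: "real \<Rightarrow> ('a, 'b) multilin \<Rightarrow> ('a, 'b) multilin"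
  is "\<lambda>c T vs. c *\<^sub>R T vs"
proof (intro conjI allI)
  fix c and T :: "'a list \<Rightarrow> 'b"
  assume T: "(\<forall>us ws. linear (\<lambda>v. T (us @ v # ws))) \<and>
      (\<exists>K. \<forall>vs. norm (T vs) \<le> K * prod_list (map norm vs))"
  show "linear (\<lambda>v. c *\<^sub>R T (us @ v # ws))" for us ws
    using T by (intro linear_compose_scale_right) auto
  from T obtain K where "\<And>vs. norm (T vs) \<le> K * prod_list (map norm vs)" by blast
  then have "norm (c *\<^sub>R T vs) \<le> (\<bar>c\<bar> * K) * prod_list (map norm vs)" for vs
    by (simp add: mult.assoc mult_left_mono)
  then show "\<exists>K. \<forall>vs. norm (c *\<^sub>R T vs) \<le> K * prod_list (map norm vs)" by blast
qed

definition uminus_multilin :: "('a, 'b) multilin \<Rightarrow> ('a, 'b) multilin"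
  where "uminus_multilin T = (-1) *\<^sub>R T"

definition minus_multilin :: "('a, 'b) multilin \<Rightarrow> ('a, 'b) multilin \<Rightarrow> ('a, 'b) multilin"
  where "minus_multilin S T = S + (-1) *\<^sub>R T"

instance
proof
  fix S T W :: "('a, 'b) multilin" and a b :: real
  show "S + T + W = S + (T + W)" "S + T = T + S" "0 + S = S"
    "a *\<^sub>R (S + T) = a *\<^sub>R S + a *\<^sub>R T" "(a + b) *\<^sub>R S = a *\<^sub>R S + b *\<^sub>R S"
    "a *\<^sub>R b *\<^sub>R S = (a * b) *\<^sub>R S" "1 *\<^sub>R S = S"
    by (transfer, simp add: algebra_simps)+
  show "- S + S = 0"
    unfolding uminus_multilin_def by transfer simp
  show "S - T = S + - T"
    by (simp add: uminus_multilin_def minus_multilin_def)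
qed

end

instantiation multilin :: (real_normed_vector, real_normed_vector) real_normed_vector
begin

lift_definition norm_multilin :: "('a, 'b) multilin \<Rightarrow> real"
  is "\<lambda>T. SUP vs\<in>{vs. \<forall>v\<in>set vs. norm v \<le> 1}. norm (T vs)" .

definition dist_multilin :: "('a, 'b) multilin \<Rightarrow> ('a, 'b) multilin \<Rightarrow> real"
  where "dist_multilin S T = norm (S - T)"

definition sgn_multilin :: "('a, 'b) multilin \<Rightarrow> ('a, 'b) multilin"
  where "sgn_multilin T = inverse (norm T) *\<^sub>R T"

definition uniformity_multilin :: "(('a, 'b) multilin \<times> ('a, 'b) multilin) filter"
  where "uniformity_multilin = (INF e\<in>{0<..}. principal {(S, T). dist S T < e})"

definition open_multilin :: "('a, 'b) multilin set \<Rightarrow> bool"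
  where "open_multilin U \<longleftrightarrow> (\<forall>S\<in>U. \<forall>\<^sub>F (S', T) in uniformity. S' = S \<longrightarrow> T \<in> U)"

lemma multilin_linear: "linear (\<lambda>v. multilin_apply T (us @ v # ws))"
  using multilin_apply[of T] by auto

lemma multilin_bounded:
  "\<exists>K\<ge>0. \<forall>vs. norm (multilin_apply T vs) \<le> K * prod_list (map norm vs)"
proof -
  obtain K where K: "\<And>vs. norm (multilin_apply T vs) \<le> K * prod_list (map norm vs)"
    using multilin_apply[of T] by auto
  have "norm (multilin_apply T vs) \<le> \<bar>K\<bar> * prod_list (map norm vs)" for vs
    by (intro order_trans[OF K] mult_right_mono prod_list_nonneg) auto
  then show ?thesis by (intro exI[of _ "\<bar>K\<bar>"]) auto
qed

lemma prod_list_norm_le_1: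
  "\<forall>v\<in>set vs. norm v \<le> 1 \<Longrightarrow> prod_list (map norm (vs :: 'a list)) \<le> 1"
proof (induction vs)
  case (Cons v vs)
  have "0 \<le> prod_list (map norm vs)" by (rule prod_list_nonneg) auto
  then show ?case using Cons by (simp add: mult_le_one)
qed simp

lemma norm_multilin_unit:
  assumes "\<forall>v\<in>set vs. norm v \<le> 1"
  shows "norm (multilin_apply T vs) \<le> norm (T :: ('a, 'b) multilin)"
proof -
  obtain K where K: "K \<ge> 0" "\<And>vs. norm (multilin_apply T vs) \<le> K * prod_list (map norm vs)"
    using multilin_bounded[of T] by auto
  have "norm (multilin_apply T vs) \<le> K" if "\<forall>v\<in>set vs. norm v \<le> 1" for vs
    using K(2)[of vs] mult_left_mono[OF prod_list_norm_le_1[OF that] K(1)] by simp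
  then have "bdd_above ((\<lambda>vs. norm (multilin_apply T vs)) ` {vs. \<forall>v\<in>set vs. norm v \<le> 1})"
    by (intro bdd_aboveI[of _ K]) auto
  with assms show ?thesis
    unfolding norm_multilin.rep_eq
    using cSUP_upper[of vs "{vs. \<forall>v\<in>set vs. norm v \<le> 1}" "\<lambda>vs. norm (multilin_apply T vs)"]
    by simp
qed

lemma norm_multilin_le:
  assumes "\<And>vs. \<forall>v\<in>set vs. norm v \<le> 1 \<Longrightarrow> norm (multilin_apply T vs) \<le> K"
  shows "norm (T :: ('a, 'b) multilin) \<le> K"
  unfolding norm_multilin.rep_eq
proof (rule cSUP_least)
  have "[] \<in> {vs :: 'a list. \<forall>v\<in>set vs. norm v \<le> 1}" by simp
  then show "{vs :: 'a list. \<forall>v\<in>set vs. norm v \<le> 1} \<noteq> {}" by blast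
qed (use assms in simp)

lemma multilin_scale_args:
  "multilin_apply T (us @ map (\<lambda>v. g v *\<^sub>R v) ws) =
     prod_list (map g ws) *\<^sub>R multilin_apply (T :: ('a, 'b) multilin) (us @ ws)"
proof (induction ws arbitrary: us)
  case (Cons w ws)
  have "multilin_apply T (us @ map (\<lambda>v. g v *\<^sub>R v) (w # ws)) =
      g w *\<^sub>R multilin_apply T ((us @ [w]) @ map (\<lambda>v. g v *\<^sub>R v) ws)"
    using linear_scale[OF multilin_linear[of T us "map (\<lambda>v. g v *\<^sub>R v) ws"]] by simp
  also have "\<dots> = prod_list (map g (w # ws)) *\<^sub>R multilin_apply T (us @ w # ws)"
    by (subst Cons.IH) simp
  finally show ?case .
qed simp

lemma multilin_apply_le:
  "norm (multilin_apply T vs) \<le> norm (T :: ('a, 'b) multilin) * prod_list (map norm vs)"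
proof -
  define us where "us = map (\<lambda>v. inverse (norm v) *\<^sub>R v) vs"
  have nonneg: "0 \<le> prod_list (map norm vs)" by (rule prod_list_nonneg) auto
  have "inverse (norm v) * norm v \<le> 1" for v :: 'a by (cases "v = 0") auto
  then have unit: "\<forall>u\<in>set us. norm u \<le> 1"
    by (simp add: us_def)
  have "(norm v * inverse (norm v)) *\<^sub>R v = v" for v :: 'a by (cases "v = 0") auto
  then have vs: "map (\<lambda>v. (norm v * inverse (norm v)) *\<^sub>R v) vs = vs"
    by (intro map_idI)
  have *: "prod_list (map (\<lambda>v. norm v * inverse (norm v)) vs) =
      prod_list (map norm vs) * prod_list (map (\<lambda>v. inverse (norm v)) vs)"
    by (induction vs) auto
  have "multilin_apply T vs =
      prod_list (map (\<lambda>v. norm v * inverse (norm v)) vs) *\<^sub>R multilin_apply T vs"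
    using multilin_scale_args[of T "[]" "\<lambda>v. norm v * inverse (norm v)" vs]
    unfolding append_Nil vs .
  also have "\<dots> = prod_list (map norm vs) *\<^sub>R multilin_apply T us"
    unfolding us_def
    using multilin_scale_args[of T "[]" "\<lambda>v. inverse (norm v)" vs] by (simp add: *)
  finally have "norm (multilin_apply T vs) =
      prod_list (map norm vs) * norm (multilin_apply T us)"
    using nonneg by simp
  also have "\<dots> \<le> prod_list (map norm vs) * norm T"
    by (intro mult_left_mono norm_multilin_unit unit nonneg)
  finally show ?thesis by (simp add: mult.commute)
qed

instance
proof
  fix S T :: "('a, 'b) multilin" and a :: real
  show "dist S T = norm (S - T)" "sgn S = S /\<^sub>R norm S"
    "uniformity = (INF e\<in>{0<..}. principal {(S, T :: ('a, 'b) multilin). dist S T < e})"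
    by (fact dist_multilin_def sgn_multilin_def uniformity_multilin_def)+
  show "open U \<longleftrightarrow> (\<forall>S\<in>U. \<forall>\<^sub>F (S', T) in uniformity. S' = S \<longrightarrow> T \<in> U)"
    for U :: "('a, 'b) multilin set"
    by (fact open_multilin_def)
  have nonneg: "0 \<le> norm R" for R :: "('a, 'b) multilin"
    using norm_multilin_unit[of "[]" R]
    by (intro order_trans[OF norm_ge_zero[of "multilin_apply R []"]]) simp
  show "norm S = 0 \<longleftrightarrow> S = 0"
  proof
    assume "norm S = 0"
    then have "multilin_apply S vs = 0" for vs
      using multilin_apply_le[of S vs] by simp
    then show "S = 0" by (intro multilin_eqI) (simp add: zero_multilin.rep_eq)
  next
    assume "S = 0"
    then have "norm S \<le> 0"
      by (intro norm_multilin_le) (simp add: zero_multilin.rep_eq)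
    with nonneg[of S] show "norm S = 0" by simp
  qed
  show "norm (S + T) \<le> norm S + norm T"
    by (intro norm_multilin_le)
       (simp add: plus_multilin.rep_eq norm_triangle_le add_mono norm_multilin_unit)
  have le: "norm (c *\<^sub>R R) \<le> \<bar>c\<bar> * norm R" for c and R :: "('a, 'b) multilin"
    by (intro norm_multilin_le)
       (simp add: scaleR_multilin.rep_eq mult_left_mono norm_multilin_unit)
  show "norm (a *\<^sub>R S) = \<bar>a\<bar> * norm S"
  proof (cases "a = 0")
    case True
    then show ?thesis using le[of a S] nonneg[of "a *\<^sub>R S"] by simp
  next
    case False
    have "inverse a *\<^sub>R a *\<^sub>R S = S" using False by transfer simp
    then have "norm S \<le> \<bar>inverse a\<bar> * norm (a *\<^sub>R S)"
      using le[of "inverse a" "a *\<^sub>R S"] by simp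
    then have "\<bar>a\<bar> * norm S \<le> \<bar>a\<bar> * (\<bar>inverse a\<bar> * norm (a *\<^sub>R S))"
      by (rule mult_left_mono) simp
    also have "\<dots> = norm (a *\<^sub>R S)" using False by (simp flip: mult.assoc abs_mult)
    finally show ?thesis using le[of a S] by simp
  qed
qed

end


section \<open>Higher derivatives and maps of class \<open>C\<^sup>k\<close>\<close>

text \<open>
  \<open>nth_deriv m f x\<close> is the \<open>m\<close>-th Frechet derivative of \<open>f\<close> at \<open>x\<close>: the derivative of the map
  \<open>nth_deriv (m - 1) f\<close>, taken with respect to the norm of multilinear maps. It is meaningful
  only where the derivatives exist.
\<close>

primrec nth_deriv ::
  "nat \<Rightarrow> ('a::real_normed_vector \<Rightarrow> 'b::real_normed_vector) \<Rightarrow> 'a \<Rightarrow> ('a, 'b) multilin"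
where
  "nth_deriv 0 f x = Multilin (\<lambda>vs. if vs = [] then f x else 0)"
| "nth_deriv (Suc m) f x = Multilin (\<lambda>vs. case vs of [] \<Rightarrow> 0
     | v # ws \<Rightarrow> multilin_apply (frechet_derivative (nth_deriv m f) (at x) v) ws)"

lemma nth_deriv_0_apply:
  fixes f :: "'a::real_normed_vector \<Rightarrow> 'b::real_normed_vector"
  shows "multilin_apply (nth_deriv 0 f x) vs = (if vs = [] then f x else 0)"
proof -
  let ?T = "\<lambda>vs :: 'a list. if vs = [] then f x else 0"
  have "norm (?T ws) \<le> norm (f x) * prod_list (map norm ws)" for ws
    by (auto intro!: mult_nonneg_nonneg prod_list_nonneg)
  then have "\<exists>K. \<forall>ws. norm (?T ws) \<le> K * prod_list (map norm ws)"
    by blast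
  moreover have "linear (\<lambda>v. ?T (us @ v # ws))" for us ws
    by (simp add: linear_iff)
  ultimately have "multilin_apply (Multilin ?T) = ?T"
    by (intro Multilin_inverse) blast
  then show ?thesis by (simp only: nth_deriv.simps)
qed

lemma nth_deriv_Suc_apply:
  assumes "nth_deriv m f differentiable (at x)"
  shows "multilin_apply (nth_deriv (Suc m) f x) vs = (case vs of [] \<Rightarrow> 0
     | v # ws \<Rightarrow> multilin_apply (frechet_derivative (nth_deriv m f) (at x) v) ws)"
proof -
  let ?D = "frechet_derivative (nth_deriv m f) (at x)"
  let ?T = "\<lambda>vs. case vs of [] \<Rightarrow> 0 | v # ws \<Rightarrow> multilin_apply (?D v) ws"
  interpret D: bounded_linear ?D
    using assms frechet_derivative_works has_derivative_bounded_linear by blast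
  obtain K where K: "\<And>v. norm (?D v) \<le> norm v * K" "0 \<le> K"
    using D.nonneg_bounded by auto
  have "linear (\<lambda>v. ?T (us @ v # ws))" for us ws
  proof (cases us)
    case Nil
    then show ?thesis
      by (auto simp: linear_iff D.add D.scaleR plus_multilin.rep_eq scaleR_multilin.rep_eq)
  next
    case (Cons u us')
    then show ?thesis using multilin_linear[of "?D u" us' ws] by simp
  qed
  moreover have "norm (?T vs) \<le> K * prod_list (map norm vs)" for vs
  proof (cases vs)
    case (Cons v ws)
    have "norm (multilin_apply (?D v) ws) \<le> norm (?D v) * prod_list (map norm ws)"
      by (rule multilin_apply_le)
    also have "\<dots> \<le> (norm v * K) * prod_list (map norm ws)"
      by (intro mult_right_mono K prod_list_nonneg) auto
    finally show ?thesis by (simp add: Cons mult_ac)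
  qed (use K in simp)
  ultimately have "multilin_apply (Multilin ?T) = ?T"
    by (intro Multilin_inverse) blast
  then show ?thesis by (simp only: nth_deriv.simps)
qed

definition Ck_on ::
  "nat \<Rightarrow> ('a::real_normed_vector \<Rightarrow> 'b::real_normed_vector) \<Rightarrow> 'a set \<Rightarrow> bool"
where
  "Ck_on k f U \<longleftrightarrow> open U \<and>
     (\<forall>m<k. \<forall>x\<in>U. nth_deriv m f differentiable (at x)) \<and> continuous_on U (nth_deriv k f)"

definition jet_norm ::
  "nat \<Rightarrow> ('a::real_normed_vector \<Rightarrow> 'b::real_normed_vector) \<Rightarrow> 'a \<Rightarrow> real"
where
  "jet_norm m f y = norm (f y) + (\<Sum>j=1..m. norm (nth_deriv j f y))"

text \<open>Local maps are partial functions; \<open>g\<close> may be defined on more than the image of \<open>U\<close>.\<close>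

definition Ck_diffeo_on ::
  "nat \<Rightarrow> ('a::real_normed_vector \<rightharpoonup> 'a) \<Rightarrow> ('a \<rightharpoonup> 'a) \<Rightarrow> 'a set \<Rightarrow> bool"
where
  "Ck_diffeo_on k f g U \<longleftrightarrow>
     (\<forall>x\<in>U. \<exists>y. f x = Some y \<and> g y = Some x) \<and>
     Ck_on k (\<lambda>x. the (f x)) U \<and>
     Ck_on k (\<lambda>y. the (g y)) ((\<lambda>x. the (f x)) ` U)"


section \<open>The space \<open>\<ell>\<^sup>1\<close> of absolutely summable families\<close>

typedef 'i ell1 = "{u :: 'i \<Rightarrow> real. (\<lambda>i. \<bar>u i\<bar>) summable_on UNIV}"
  morphisms ell1_apply Ell1
  by (rule exI[of _ "\<lambda>_. 0"]) auto

setup_lifting type_definition_ell1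

declare [[coercion ell1_apply]]

instantiation ell1 :: (type) real_vector
begin

lift_definition zero_ell1 :: "'i ell1" is "\<lambda>_. 0"
  by simp

lift_definition plus_ell1 :: "'i ell1 \<Rightarrow> 'i ell1 \<Rightarrow> 'i ell1" is "\<lambda>u v i. u i + v i"
proof -
  fix u v :: "'i \<Rightarrow> real"
  assume "(\<lambda>i. \<bar>u i\<bar>) summable_on UNIV" "(\<lambda>i. \<bar>v i\<bar>) summable_on UNIV"
  then have "(\<lambda>i. \<bar>u i\<bar> + \<bar>v i\<bar>) summable_on UNIV" by (rule summable_on_add)
  then show "(\<lambda>i. \<bar>u i + v i\<bar>) summable_on UNIV"
    by (rule summable_on_comparison_test) auto
qed

lift_definition scaleR_ell1 :: "real \<Rightarrow> 'i ell1 \<Rightarrow> 'i ell1" is "\<lambda>c u i. c * u i"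
  by (auto simp: abs_mult intro: summable_on_cmult_right)

definition uminus_ell1 :: "'i ell1 \<Rightarrow> 'i ell1"
  where "uminus_ell1 u = (-1) *\<^sub>R u"

definition minus_ell1 :: "'i ell1 \<Rightarrow> 'i ell1 \<Rightarrow> 'i ell1"
  where "minus_ell1 u v = u + (-1) *\<^sub>R v"

instance
proof
  fix u v w :: "'i ell1" and a b :: real
  show "u + v + w = u + (v + w)" "u + v = v + u" "0 + u = u"
    "a *\<^sub>R (u + v) = a *\<^sub>R u + a *\<^sub>R v" "(a + b) *\<^sub>R u = a *\<^sub>R u + b *\<^sub>R u"
    "a *\<^sub>R b *\<^sub>R u = (a * b) *\<^sub>R u" "1 *\<^sub>R u = u"
    by (transfer, simp add: algebra_simps)+
  show "- u + u = 0"
    unfolding uminus_ell1_def by transfer simp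
  show "u - v = u + - v"
    by (simp add: uminus_ell1_def minus_ell1_def)
qed

end

instantiation ell1 :: (type) real_normed_vector
begin

lift_definition norm_ell1 :: "'i ell1 \<Rightarrow> real" is "\<lambda>u. \<Sum>\<^sub>\<infinity>i. \<bar>u i\<bar>" .

definition dist_ell1 :: "'i ell1 \<Rightarrow> 'i ell1 \<Rightarrow> real"
  where "dist_ell1 u v = norm (u - v)"

definition sgn_ell1 :: "'i ell1 \<Rightarrow> 'i ell1"
  where "sgn_ell1 u = inverse (norm u) *\<^sub>R u"

definition uniformity_ell1 :: "('i ell1 \<times> 'i ell1) filter"
  where "uniformity_ell1 = (INF e\<in>{0<..}. principal {(u, v). dist u v < e})"

definition open_ell1 :: "'i ell1 set \<Rightarrow> bool"
  where "open_ell1 U \<longleftrightarrow> (\<forall>u\<in>U. \<forall>\<^sub>F (u', v) in uniformity. u' = u \<longrightarrow> v \<in> U)"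

lemma ell1_summable: "(\<lambda>i. \<bar>ell1_apply u i\<bar>) summable_on UNIV"
  using ell1_apply[of u] by simp

instance
proof
  fix u v :: "'i ell1" and a :: real
  show "dist u v = norm (u - v)" "sgn u = u /\<^sub>R norm u"
    "uniformity = (INF e\<in>{0<..}. principal {(u, v :: 'i ell1). dist u v < e})"
    by (fact dist_ell1_def sgn_ell1_def uniformity_ell1_def)+
  show "open U \<longleftrightarrow> (\<forall>u\<in>U. \<forall>\<^sub>F (u', v) in uniformity. u' = u \<longrightarrow> v \<in> U)" for U :: "'i ell1 set"
    by (fact open_ell1_def)
  show "norm u = 0 \<longleftrightarrow> u = 0"
  proof
    assume "norm u = 0"
    then have "ell1_apply u i = 0" for i
      using nonneg_infsum_le_0D[of "\<lambda>i. \<bar>ell1_apply u i\<bar>" UNIV i] ell1_summable[of u]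
      by (simp add: norm_ell1.rep_eq)
    then show "u = 0" by transfer auto
  qed (transfer, simp)
  show "norm (u + v) \<le> norm u + norm v"
  proof -
    have "norm (u + v) \<le> (\<Sum>\<^sub>\<infinity>i. \<bar>ell1_apply u i\<bar> + \<bar>ell1_apply v i\<bar>)"
      unfolding norm_ell1.rep_eq
    proof (rule infsum_mono)
      show "(\<lambda>i. \<bar>ell1_apply u i\<bar> + \<bar>ell1_apply v i\<bar>) summable_on UNIV"
        by (rule summable_on_add) (rule ell1_summable)+
    qed (rule ell1_summable, simp add: plus_ell1.rep_eq)
    also have "\<dots> = norm u + norm v"
      unfolding norm_ell1.rep_eq by (intro infsum_add ell1_summable)
    finally show ?thesis .
  qed
  show "norm (a *\<^sub>R u) = \<bar>a\<bar> * norm u"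
    by transfer (simp add: abs_mult infsum_cmult_right')
qed

end

definition support :: "'i ell1 \<Rightarrow> 'i set"
  where "support \<tau> = {\<alpha>. \<tau> \<alpha> \<noteq> 0}"


section \<open>Local vector fields and their flows\<close>

text \<open>A local vector field is represented by its domain \<open>D\<close> and a function \<open>X\<close>; the values of
  \<open>X\<close> outside of \<open>D\<close> are irrelevant. Openness of \<open>D\<close> is part of \<open>Ck_on\<close>.\<close>

definition local_vector_field :: "'e::real_normed_vector set \<Rightarrow> ('e \<Rightarrow> 'e) \<Rightarrow> bool"
  where "local_vector_field D X \<longleftrightarrow> (\<forall>k. Ck_on k X D)"

definition integral_curve ::
  "'e::real_normed_vector set \<Rightarrow> ('e \<Rightarrow> 'e) \<Rightarrow> real set \<Rightarrow> (real \<Rightarrow> 'e) \<Rightarrow> bool"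
where
  "integral_curve D X I c \<longleftrightarrow>
     (\<forall>u\<in>I. c u \<in> D \<and> (c has_vector_derivative X (c u)) (at u within I))"

definition flow :: "'e::real_normed_vector set \<Rightarrow> ('e \<Rightarrow> 'e) \<Rightarrow> real \<Rightarrow> 'e \<rightharpoonup> 'e"
where
  "flow D X t x =
     (if \<exists>c. integral_curve D X (closed_segment 0 t) c \<and> c 0 = x
      then Some (THE y. \<exists>c. integral_curve D X (closed_segment 0 t) c \<and> c 0 = x \<and> c t = y)
      else None)"


section \<open>Ordered compositions of flows\<close>

text \<open>
  For \<open>is = [\<alpha>\<^sub>1, \<dots>, \<alpha>\<^sub>n]\<close>, \<open>forward_comp\<close> applies the flow with index \<open>\<alpha>\<^sub>1\<close> first, whereas
  \<open>backward_comp\<close> applies the reversed flow with index \<open>\<alpha>\<^sub>n\<close> first.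
\<close>

definition forward_comp ::
  "('i \<Rightarrow> 'e::real_normed_vector set) \<Rightarrow> ('i \<Rightarrow> 'e \<Rightarrow> 'e) \<Rightarrow> 'i ell1 \<Rightarrow> 'i list \<Rightarrow> 'e \<rightharpoonup> 'e"
  where "forward_comp D X \<tau> is = fold (\<lambda>\<alpha> f. flow (D \<alpha>) (X \<alpha>) (\<tau> \<alpha>) \<circ>\<^sub>m f) is Some"

definition backward_comp ::
  "('i \<Rightarrow> 'e::real_normed_vector set) \<Rightarrow> ('i \<Rightarrow> 'e \<Rightarrow> 'e) \<Rightarrow> 'i ell1 \<Rightarrow> 'i list \<Rightarrow> 'e \<rightharpoonup> 'e"
  where "backward_comp D X \<tau> is = foldr (\<lambda>\<alpha> f. flow (D \<alpha>) (X \<alpha>) (- \<tau> \<alpha>) \<circ>\<^sub>m f) is Some"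

lemma forward_comp_3:
  "forward_comp D X \<tau> [a, b, c] =
     flow (D c) (X c) (\<tau> c) \<circ>\<^sub>m (flow (D b) (X b) (\<tau> b) \<circ>\<^sub>m flow (D a) (X a) (\<tau> a))"
  by (simp add: forward_comp_def map_comp_def fun_eq_iff)

lemma backward_comp_3:
  "backward_comp D X \<tau> [a, b, c] =
     flow (D a) (X a) (- \<tau> a) \<circ>\<^sub>m (flow (D b) (X b) (- \<tau> b) \<circ>\<^sub>m flow (D c) (X c) (- \<tau> c))"
  by (simp add: backward_comp_def map_comp_def fun_eq_iff)

text \<open>
  How the index lists of the partial compositions over a countable set \<open>B\<close> tend to \<open>B\<close>. If \<open>B\<close> is
  order isomorphic to the natural numbers, these are the lists of the first \<open>m\<close> elements of \<open>B\<close>,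
  with \<open>m \<longlongrightarrow> \<infinity>\<close>. If \<open>B\<close> is finite, only the increasing list of all its elements matters. A
  countable subset of a general ordered set can have any other countable order type, and then the
  increasing lists of the finite subsets of \<open>B\<close> are used, directed by inclusion.
\<close>

definition index_lists :: "'i::linorder set \<Rightarrow> 'i list filter"
where
  "index_lists B =
     (if \<exists>e::nat \<Rightarrow> 'i. strict_mono e \<and> range e = B
      then filtermap (\<lambda>m. map (THE e. strict_mono e \<and> range e = B) [0..<m]) sequentially
      else filtermap sorted_list_of_set (finite_subsets_at_top B))"

lemma strict_mono_range_unique:
  fixes e e' :: "nat \<Rightarrow> 'i::linorder"
  assumes "strict_mono e" "strict_mono e'" "range e = range e'"
  shows "e = e'"
proof -
  have "e' n = e n" for n
  proof (induction n rule: less_induct)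
    case (less n)
    have le: "g n \<le> h n"
      if g: "strict_mono g" and h: "strict_mono h" and range: "range g = range h"
        and eq: "\<And>m. m < n \<Longrightarrow> g m = h m"
      for g h :: "nat \<Rightarrow> 'i"
    proof -
      obtain m where m: "h n = g m" using range by (metis rangeE rangeI)
      have "\<not> m < n"
        using m eq strict_monoD[OF h] by (metis less_irrefl)
      then show ?thesis using g m by (simp add: strict_mono_less_eq)
    qed
    show ?case
      using le[of e e'] le[of e' e] assms less by (simp add: order_antisym)
  qed
  then show ?thesis by auto
qed

lemma index_lists_nat:
  assumes "strict_mono (e :: nat \<Rightarrow> 'i::linorder)"
  shows "index_lists (range e) = filtermap (\<lambda>m. map e [0..<m]) sequentially"
proof -
  have "(THE e'. strict_mono e' \<and> range e' = range e) = e"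
  proof (rule the_equality)
    show "strict_mono e \<and> range e = range e" using assms by simp
    show "e' = e" if "strict_mono e' \<and> range e' = range e" for e'
      by (rule strict_mono_range_unique) (use that assms in simp_all)
  qed
  moreover have "\<exists>e'::nat \<Rightarrow> 'i. strict_mono e' \<and> range e' = range e" using assms by blast
  ultimately show ?thesis by (simp only: index_lists_def if_True)
qed

lemma index_lists_finite:
  assumes "finite (B :: 'i::linorder set)"
  shows "index_lists B = principal {sorted_list_of_set B}"
proof -
  have "\<not> (\<exists>e::nat \<Rightarrow> 'i. strict_mono e \<and> range e = B)"
    using assms by (metis finite_imageD infinite_UNIV_nat strict_mono_imp_inj_on)
  then show ?thesis
    using assms
    by (simp only: index_lists_def if_False finite_subsets_at_top_finite filtermap_principal) simp
qed

text \<open>The limit of a family of possibly undefined points exists only if they are eventually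
  defined.\<close>

definition partial_tendsto ::
  "('l \<Rightarrow> 'e::topological_space option) \<Rightarrow> 'e \<Rightarrow> 'l filter \<Rightarrow> bool"
where
  "partial_tendsto f y F \<longleftrightarrow> (\<forall>\<^sub>F l in F. f l \<noteq> None) \<and> ((\<lambda>l. the (f l)) \<longlongrightarrow> y) F"

definition partial_lim :: "'l filter \<Rightarrow> ('l \<Rightarrow> 'e::topological_space option) \<Rightarrow> 'e option"
where
  "partial_lim F f =
     (if \<exists>y. partial_tendsto f y F then Some (THE y. partial_tendsto f y F) else None)"

definition phi ::
  "('i::linorder \<Rightarrow> 'e::real_normed_vector set) \<Rightarrow> ('i \<Rightarrow> 'e \<Rightarrow> 'e) \<Rightarrow> 'i set \<Rightarrow> 'i ell1 \<Rightarrow> 'e \<rightharpoonup> 'e"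
where
  "phi D X B \<tau> x = partial_lim (index_lists B) (\<lambda>is. forward_comp D X \<tau> is x)"

definition phi_hat ::
  "('i::linorder \<Rightarrow> 'e::real_normed_vector set) \<Rightarrow> ('i \<Rightarrow> 'e \<Rightarrow> 'e) \<Rightarrow> 'i set \<Rightarrow> 'i ell1 \<Rightarrow> 'e \<rightharpoonup> 'e"
where
  "phi_hat D X B \<tau> x = partial_lim (index_lists B) (\<lambda>is. backward_comp D X \<tau> is x)"

end

theory Submission
  imports Defs "HOL-Probability.Discrete_Topology"
begin

text \<open>
  Instead of composing the flows one after the other, the whole ordered composition is encoded in
  one integral equation. Let \<open>u (\<beta>, \<sigma>)\<close> be the point which is reached after the fraction \<open>\<sigma>\<close> of
  the step with index \<open>\<beta>\<close>. Then
  \[ u (\beta, \sigma) = x + \sum_{\gamma < \beta} \tau_\gamma \int_0^1 X_\gamma (u (\gamma, \rho)) d\rho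
     + \tau_\beta \int_0^\sigma X_\beta (u (\beta, \rho)) d\rho , \]
  an equation \<open>u = x + L (\<tau>, N u)\<close> in the Banach space of bounded continuous paths. Here \<open>L\<close> is a
  bounded bilinear map, and \<open>N\<close> is of class \<open>C\<^sup>s\<^sup>+\<^sup>1\<close> because the jets of order \<open>s + 2\<close> are uniformly
  bounded. With respect to an exponentially weighted norm \<open>u \<mapsto> L (\<tau>, N u)\<close> is a contraction,
  which yields existence of solutions, and the inverse function theorem shows that they depend on
  \<open>(\<tau>, x)\<close> in a \<open>C\<^sup>s\<^sup>+\<^sup>1\<close> manner.

  For finitely supported \<open>\<tau>\<close> the endpoint of the solution is the composition of the flows. Hence
  the limits exist by continuity in \<open>\<tau>\<close>, as every \<open>\<tau>\<close> is the limit of its restrictions to finite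
  sets. Reading a solution backwards in time gives a solution for the reversed order and \<open>- \<tau>\<close>, so
  the backward compositions converge to the inverse map and are of class \<open>C\<^sup>s\<close> as well.
\<close>


subsection \<open>Multilinear maps\<close>

text \<open>Three obstacles shape the construction. The set \<open>V\<close> need not be convex, so
  \<open>k\<close> is a Lipschitz constant only on convex pieces, and uniqueness is not derived from
  the integral equation globally. Endpoints of solutions are therefore handled as a relation; they
  turn out to be unique because they are limits of compositions of flows. Secondly, the index set
  may be infinite and balls of a Banach space need not be compact, so uniformity cannot come from
  compactness: the composition operator is differentiable in the sup norm because the Taylor
  remainder of each order is controlled by a bound two orders higher, and this is what the order
  \<open>s + 2\<close> of the jets pays for. Finally, \<open>k * norm \<tau>\<close> is at most
  \<open>r\<close>, but not small compared with 1, hence the weighted norm. Running every step over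
  the unit interval puts all paths into one space that does not depend on \<open>\<tau>\<close>, so
  that smoothness in \<open>\<tau>\<close> and in the starting point results from a single
  argument.\<close>

lemma multilin_apply_Multilin:
  assumes "\<And>us ws. linear (\<lambda>v. T (us @ v # ws))"
    and "\<And>vs. norm (T vs) \<le> K * prod_list (map norm vs)"
  shows "multilin_apply (Multilin T) = T"
  by (rule Multilin_inverse) (use assms in blast)

lemma multilin_apply_simps [simp]:
  fixes S T :: "('a::real_normed_vector, 'b::real_normed_vector) multilin"
  shows
  "multilin_apply (0 :: ('a, 'b) multilin) vs = 0"
  "multilin_apply (S + T) vs = multilin_apply S vs + multilin_apply T vs"
  "multilin_apply (c *\<^sub>R T) vs = c *\<^sub>R multilin_apply T vs"
  "multilin_apply (- T) vs = - multilin_apply T vs"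
  "multilin_apply (S - T) vs = multilin_apply S vs - multilin_apply T vs"
proof -
  show scaleR: "multilin_apply (c *\<^sub>R T) vs = c *\<^sub>R multilin_apply T vs" for c and T :: "('a, 'b) multilin"
    by (rule fun_cong[OF scaleR_multilin.rep_eq])
  show plus: "multilin_apply (S + T) vs = multilin_apply S vs + multilin_apply T vs"
    for S T :: "('a, 'b) multilin"
    by (rule fun_cong[OF plus_multilin.rep_eq])
  show "multilin_apply (- T) vs = - multilin_apply T vs"
    unfolding uminus_multilin_def scaleR by simp
  show "multilin_apply (S - T) vs = multilin_apply S vs - multilin_apply T vs"
    unfolding minus_multilin_def plus scaleR by simp
qed (simp add: zero_multilin.rep_eq)

lemma norm_multilin_bound:
  assumes "0 \<le> K" "\<And>vs. norm (multilin_apply T vs) \<le> K * prod_list (map norm vs)"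
  shows "norm T \<le> K"
proof (rule norm_multilin_le)
  fix vs :: "'a list"
  assume vs: "\<forall>v\<in>set vs. norm v \<le> 1"
  show "norm (multilin_apply T vs) \<le> K"
    using assms(2)[of vs] mult_left_mono[OF prod_list_norm_le_1[OF vs] assms(1)] by simp
qed

lemma prod_list_norm_nonneg [simp]: "0 \<le> prod_list (map norm vs)"
  by (rule prod_list_nonneg) auto

lemma bounded_linear_multilin_apply: "bounded_linear (\<lambda>T. multilin_apply T vs)"
  by (rule bounded_linear_intro[of _ "prod_list (map norm vs)"]) (auto simp: multilin_apply_le)

text \<open>The embedding of arbitrary values as multilinear maps of degree zero, with evaluation at
  \<open>[]\<close> as left inverse. Through this pair, statements about an arbitrary target space
  are reduced to targets of type \<open>multilin\<close>.\<close>

definition mconst :: "'b \<Rightarrow> ('a::real_normed_vector, 'b::real_normed_vector) multilin" where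
  "mconst c = Multilin (\<lambda>vs. if vs = [] then c else 0)"

lemma mconst_apply:
  fixes c :: "'b::real_normed_vector" and vs :: "'a::real_normed_vector list"
  shows "multilin_apply (mconst c) vs = (if vs = [] then c else 0)"
proof -
  have "multilin_apply (Multilin (\<lambda>vs :: 'a list. if vs = [] then c else 0)) =
      (\<lambda>vs. if vs = [] then c else 0)"
    by (rule multilin_apply_Multilin[of _ "norm c"]) (auto simp: linear_iff)
  then show ?thesis by (simp add: mconst_def)
qed

lemma bounded_linear_mconst:
  "bounded_linear (mconst :: 'b \<Rightarrow> ('a::real_normed_vector, 'b::real_normed_vector) multilin)"
  by (rule bounded_linear_intro[of _ 1])
    (auto intro!: multilin_eqI norm_multilin_bound simp: mconst_apply)

text \<open>The Frechet derivative of \<open>nth_deriv m f\<close> at \<open>x\<close> is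
  \<open>mcurry (nth_deriv (Suc m) f x)\<close>. Currying forgets the value at \<open>[]\<close>, so
  the way back needs a condition on that value.\<close>

definition mcurry :: "('a::real_normed_vector, 'b::real_normed_vector) multilin
    \<Rightarrow> 'a \<Rightarrow>\<^sub>L ('a, 'b) multilin" where
  "mcurry T = Blinfun (\<lambda>v. Multilin (\<lambda>ws. multilin_apply T (v # ws)))"

lemma mcurry_apply: "multilin_apply (mcurry T v) ws = multilin_apply T (v # ws)"
  and norm_mcurry: "norm (mcurry T) \<le> norm T"
proof -
  have le: "norm (multilin_apply T (v # ws)) \<le> (norm T * norm v) * prod_list (map norm ws)" for v ws
    using multilin_apply_le[of T "v # ws"] by (simp add: mult.assoc)
  have *: "multilin_apply (Multilin (\<lambda>ws. multilin_apply T (v # ws))) =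
      (\<lambda>ws. multilin_apply T (v # ws))" for v
    by (rule multilin_apply_Multilin[OF _ le]) (use multilin_linear[of T "v # us" for us] in simp)
  have lin: "linear (\<lambda>v. multilin_apply T (v # ws))" for ws
    using multilin_linear[of T "[]" ws] by simp
  have bl: "bounded_linear (\<lambda>v. Multilin (\<lambda>ws. multilin_apply T (v # ws)))"
  proof (rule bounded_linear_intro[of _ "norm T"])
    fix x y and r
    show "Multilin (\<lambda>ws. multilin_apply T ((x + y) # ws)) =
        Multilin (\<lambda>ws. multilin_apply T (x # ws)) + Multilin (\<lambda>ws. multilin_apply T (y # ws))"
      by (rule multilin_eqI) (unfold multilin_apply_simps *, rule linear_add[OF lin])
    show "Multilin (\<lambda>ws. multilin_apply T (r *\<^sub>R x # ws)) = r *\<^sub>R Multilin (\<lambda>ws. multilin_apply T (x # ws))"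
      by (rule multilin_eqI) (unfold multilin_apply_simps *, rule linear_scale[OF lin])
    show "norm (Multilin (\<lambda>ws. multilin_apply T (x # ws))) \<le> norm x * norm T"
      by (rule norm_multilin_bound) (use le[of x] in \<open>auto simp: * mult_ac\<close>)
  qed
  have **: "mcurry T v = Multilin (\<lambda>ws. multilin_apply T (v # ws))" for v
    unfolding mcurry_def by (simp add: bounded_linear_Blinfun_apply[OF bl])
  show "multilin_apply (mcurry T v) ws = multilin_apply T (v # ws)" for v ws
    unfolding ** * ..
  show "norm (mcurry T) \<le> norm T"
    by (rule norm_blinfun_bound) (auto intro!: norm_multilin_bound simp: ** * le)
qed

lemma bounded_linear_mcurry: "bounded_linear mcurry"
  by (rule bounded_linear_intro[of _ 1])
    (auto intro!: multilin_eqI blinfun_eqI norm_mcurry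
      simp: mcurry_apply blinfun.bilinear_simps)

definition muncurry :: "('a::real_normed_vector \<Rightarrow>\<^sub>L ('a, 'b::real_normed_vector) multilin)
    \<Rightarrow> ('a, 'b) multilin" where
  "muncurry A = Multilin (\<lambda>vs. case vs of [] \<Rightarrow> 0 | v # ws \<Rightarrow> multilin_apply (A v) ws)"

lemma muncurry_apply:
  "multilin_apply (muncurry A) vs = (case vs of [] \<Rightarrow> 0 | v # ws \<Rightarrow> multilin_apply (A v) ws)"
  and norm_muncurry: "norm (muncurry A) \<le> norm A"
proof -
  let ?T = "\<lambda>vs. case vs of [] \<Rightarrow> 0 | v # ws \<Rightarrow> multilin_apply (A v) ws"
  have le: "norm (?T vs) \<le> norm A * prod_list (map norm vs)" for vs
  proof (cases vs)
    case (Cons v ws)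
    have "norm (multilin_apply (A v) ws) \<le> norm (A v) * prod_list (map norm ws)"
      by (rule multilin_apply_le)
    also have "\<dots> \<le> (norm A * norm v) * prod_list (map norm ws)"
      by (intro mult_right_mono norm_blinfun) auto
    finally show ?thesis by (simp add: Cons mult_ac)
  qed simp
  have lin: "linear (\<lambda>v. ?T (us @ v # ws))" for us ws
  proof (cases us)
    case Nil
    then show ?thesis by (auto simp: linear_iff blinfun.bilinear_simps)
  next
    case (Cons u us')
    then show ?thesis using multilin_linear[of "A u" us' ws] by simp
  qed
  have *: "multilin_apply (muncurry A) = ?T"
    unfolding muncurry_def by (rule multilin_apply_Multilin[OF lin le])
  then show "multilin_apply (muncurry A) vs =
      (case vs of [] \<Rightarrow> 0 | v # ws \<Rightarrow> multilin_apply (A v) ws)" for vs by simp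
  show "norm (muncurry A) \<le> norm A"
    by (rule norm_multilin_bound) (auto simp only: * le norm_ge_zero)
qed

lemma bounded_linear_muncurry: "bounded_linear muncurry"
  by (rule bounded_linear_intro[of _ 1])
    (auto intro!: multilin_eqI norm_muncurry
      simp: muncurry_apply blinfun.bilinear_simps split: list.split)

lemma mcurry_muncurry [simp]: "mcurry (muncurry A) = A"
  by (rule blinfun_eqI, rule multilin_eqI) (simp add: mcurry_apply muncurry_apply)

lemma muncurry_mcurry: "multilin_apply T [] = 0 \<Longrightarrow> muncurry (mcurry T) = T"
  by (rule multilin_eqI) (simp add: mcurry_apply muncurry_apply split: list.split)

definition mmap :: "('b::real_normed_vector \<Rightarrow>\<^sub>L 'c::real_normed_vector)
    \<Rightarrow> ('a::real_normed_vector, 'b) multilin \<Rightarrow> ('a, 'c) multilin" where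
  "mmap A T = Multilin (\<lambda>vs. A (multilin_apply T vs))"

lemma mmap_apply: "multilin_apply (mmap A T) vs = A (multilin_apply T vs)"
proof -
  have "norm (A (multilin_apply T vs)) \<le> (norm A * norm T) * prod_list (map norm vs)" for vs
    by (rule order_trans[OF norm_blinfun])
      (simp add: mult.assoc multilin_apply_le mult_left_mono)
  moreover have "linear (\<lambda>v. A (multilin_apply T (us @ v # ws)))" for us ws
    using multilin_linear[of T us ws] by (simp add: linear_iff blinfun.bilinear_simps)
  ultimately show ?thesis
    unfolding mmap_def by (subst multilin_apply_Multilin) auto
qed

lemma norm_mmap: "norm (mmap A T) \<le> norm A * norm T"
  by (rule norm_multilin_bound)
    (auto simp: mmap_apply mult.assoc intro!: order_trans[OF norm_blinfun] mult_left_mono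
      multilin_apply_le)

lemma bounded_linear_mmap: "bounded_linear (mmap A)"
  by (rule bounded_linear_intro[of _ "norm A"])
    (auto intro!: multilin_eqI order_trans[OF norm_mmap]
      simp: mmap_apply blinfun.bilinear_simps mult.commute)

text \<open>The last argument of a multilinear map is split off, respectively appended. The derivatives
  of the derivative of \<open>f\<close> and those of \<open>f\<close> correspond to each other in this way, because
  \<open>nth_deriv\<close> puts the argument of the outermost derivative first.\<close>

definition munsnoc :: "('a::real_normed_vector, 'b::real_normed_vector) multilin
    \<Rightarrow> ('a, 'a \<Rightarrow>\<^sub>L 'b) multilin" where
  "munsnoc T = Multilin (\<lambda>ws. Blinfun (\<lambda>v. multilin_apply T (ws @ [v])))"

lemma prod_list_map_norm_snoc:
  "prod_list (map norm (ws @ [v])) = prod_list (map norm ws) * norm v"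
  by (induction ws) (simp_all add: mult.assoc)

lemma munsnoc_apply: "multilin_apply (munsnoc T) ws v = multilin_apply T (ws @ [v])"
  and norm_munsnoc: "norm (munsnoc T) \<le> norm T"
proof -
  have le: "norm (multilin_apply T (ws @ [v])) \<le> (norm T * prod_list (map norm ws)) * norm v" for v ws
    using multilin_apply_le[of T "ws @ [v]"] unfolding prod_list_map_norm_snoc by (simp add: mult.assoc)
  have "bounded_linear (\<lambda>v. multilin_apply T (ws @ [v]))" for ws
    by (rule bounded_linear_intro[of _ "norm T * prod_list (map norm ws)"])
      (use multilin_linear[of T ws "[]"] le in
        \<open>auto simp: linear_iff mult_ac\<close>)
  then have *: "Blinfun (\<lambda>v. multilin_apply T (ws @ [v])) v = multilin_apply T (ws @ [v])" for ws v
    by (simp add: bounded_linear_Blinfun_apply)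
  have le': "norm (Blinfun (\<lambda>v. multilin_apply T (ws @ [v]))) \<le> norm T * prod_list (map norm ws)" for ws
    by (rule norm_blinfun_bound) (auto simp only: * le intro!: mult_nonneg_nonneg prod_list_norm_nonneg norm_ge_zero)
  have lin: "linear (\<lambda>v. Blinfun (\<lambda>v'. multilin_apply T ((us @ v # ws) @ [v'])))" for us ws
  proof -
    have "linear (\<lambda>v. multilin_apply T ((us @ v # ws) @ [v']))" for v'
      using multilin_linear[of T us "ws @ [v']"] by simp
    note lin = this
    show ?thesis
    proof (rule linearI; rule blinfun_eqI)
    qed (unfold blinfun.bilinear_simps *, rule linear_add[OF lin], rule linear_scale[OF lin])
  qed
  have **: "multilin_apply (munsnoc T) = (\<lambda>ws. Blinfun (\<lambda>v. multilin_apply T (ws @ [v])))"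
    unfolding munsnoc_def by (rule multilin_apply_Multilin[OF lin le'])
  show "multilin_apply (munsnoc T) ws v = multilin_apply T (ws @ [v])" for ws v
    unfolding ** * ..
  show "norm (munsnoc T) \<le> norm T"
    by (rule norm_multilin_bound) (auto simp only: ** le' norm_ge_zero)
qed

lemma bounded_linear_munsnoc: "bounded_linear munsnoc"
  by (rule bounded_linear_intro[of _ 1])
    (auto intro!: multilin_eqI blinfun_eqI norm_munsnoc
      simp: munsnoc_apply blinfun.bilinear_simps)

definition msnoc :: "('a::real_normed_vector, 'a \<Rightarrow>\<^sub>L 'b::real_normed_vector) multilin
    \<Rightarrow> ('a, 'b) multilin" where
  "msnoc S = Multilin (\<lambda>vs. if vs = [] then 0 else multilin_apply S (butlast vs) (last vs))"

lemma msnoc_apply: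
  "multilin_apply (msnoc S) vs = (if vs = [] then 0 else multilin_apply S (butlast vs) (last vs))"
  and norm_msnoc: "norm (msnoc S) \<le> norm S"
proof -
  let ?T = "\<lambda>vs. if vs = [] then 0 else multilin_apply S (butlast vs) (last vs)"
  have le: "norm (?T vs) \<le> norm S * prod_list (map norm vs)" for vs
  proof (cases vs rule: rev_cases)
    case (snoc ws v)
    have "norm (multilin_apply S ws v) \<le> norm (multilin_apply S ws) * norm v"
      by (rule norm_blinfun)
    also have "\<dots> \<le> (norm S * prod_list (map norm ws)) * norm v"
      by (intro mult_right_mono multilin_apply_le) auto
    finally show ?thesis by (simp only: snoc prod_list_map_norm_snoc) (simp add: mult.assoc)
  qed simp
  have lin: "linear (\<lambda>v. ?T (us @ v # ws))" for us ws
  proof (cases ws rule: rev_cases)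
    case Nil
    then show ?thesis by (auto simp: linear_iff blinfun.bilinear_simps)
  next
    case (snoc ws' w)
    then show ?thesis using multilin_linear[of S us ws']
      by (auto simp: linear_iff blinfun.bilinear_simps butlast_append)
  qed
  have *: "multilin_apply (msnoc S) = ?T"
    unfolding msnoc_def by (rule multilin_apply_Multilin[OF lin le])
  then show "multilin_apply (msnoc S) vs =
      (if vs = [] then 0 else multilin_apply S (butlast vs) (last vs))" for vs by simp
  show "norm (msnoc S) \<le> norm S"
    by (rule norm_multilin_bound) (auto simp only: * le norm_ge_zero)
qed

lemma bounded_linear_msnoc: "bounded_linear msnoc"
  by (rule bounded_linear_intro[of _ 1])
    (auto intro!: multilin_eqI norm_msnoc simp: msnoc_apply blinfun.bilinear_simps)


lemma bounded_linear_bounded_bilinear_compose: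
  assumes "bounded_linear f" "bounded_bilinear B"
  shows "bounded_bilinear (\<lambda>x y. f (B x y))"
proof -
  interpret f: bounded_linear f by fact
  interpret B: bounded_bilinear B by fact
  obtain K where K: "\<And>x y. norm (B x y) \<le> norm x * norm y * K" "0 \<le> K"
    using B.nonneg_bounded by blast
  obtain L where L: "\<And>x. norm (f x) \<le> norm x * L" "0 \<le> L"
    using f.nonneg_bounded by blast
  have "norm (f (B x y)) \<le> norm x * norm y * (K * L)" for x y
    using order_trans[OF L(1) mult_right_mono[OF K(1) L(2)]] by (simp add: mult.assoc)
  then show ?thesis
    by unfold_locales
      (auto simp: B.add_left B.add_right B.scaleR_left B.scaleR_right f.add f.scaleR)
qed

subsection \<open>Calculus of maps of class \<open>C\<^sup>k\<close>\<close>

declare nth_deriv.simps [simp del]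

lemma nth_deriv_0: "nth_deriv 0 f x = mconst (f x)"
  by (rule multilin_eqI) (simp add: nth_deriv_0_apply mconst_apply)

lemma nth_deriv_Suc:
  assumes "(nth_deriv m f has_derivative blinfun_apply A) (at x)"
  shows "nth_deriv (Suc m) f x = muncurry A"
proof -
  have "frechet_derivative (nth_deriv m f) (at x) = blinfun_apply A"
    using frechet_derivative_at[OF assms] by simp
  moreover have "nth_deriv m f differentiable (at x)"
    using assms by (auto simp: differentiable_def)
  ultimately show ?thesis
    by (intro multilin_eqI) (simp only: nth_deriv_Suc_apply muncurry_apply)
qed

lemma has_derivative_nth_deriv:
  assumes "nth_deriv m f differentiable (at x)"
  shows "(nth_deriv m f has_derivative blinfun_apply (mcurry (nth_deriv (Suc m) f x))) (at x)"
proof -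
  obtain A where A: "(nth_deriv m f has_derivative A) (at x)"
    using assms by (auto simp: differentiable_def)
  then have "A = blinfun_apply (Blinfun A)"
    by (simp add: bounded_linear_Blinfun_apply has_derivative_bounded_linear)
  with A have "(nth_deriv m f has_derivative blinfun_apply (Blinfun A)) (at x)" by simp
  from this nth_deriv_Suc[OF this] show ?thesis by (simp)
qed

text \<open>The derivatives are identified by a tower \<open>g 0, g 1, ...\<close> in which each
  member differentiates to the next one. The condition at \<open>[]\<close> fixes the part of
  \<open>g (Suc m)\<close> that \<open>mcurry\<close> cannot see.\<close>

lemma nth_deriv_unique:
  assumes "open U" and "\<And>x. x \<in> U \<Longrightarrow> g 0 x = mconst (f x)"
    and deriv: "\<And>m x. m < k \<Longrightarrow> x \<in> U \<Longrightarrow> (g m has_derivative blinfun_apply (mcurry (g (Suc m) x))) (at x)"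
    and nil: "\<And>m x. m < k \<Longrightarrow> x \<in> U \<Longrightarrow> multilin_apply (g (Suc m) x) [] = 0"
    and "m \<le> k" "x \<in> U"
  shows "nth_deriv m f x = g m x"
  using assms(5,6)
proof (induction m arbitrary: x)
  case 0
  then show ?case using assms(2) by (simp add: nth_deriv_0)
next
  case (Suc m)
  have "(nth_deriv m f has_derivative blinfun_apply (mcurry (g (Suc m) x))) (at x)"
    using deriv[of m x] Suc
    by (auto intro: has_derivative_transform_within_open[OF _ \<open>open U\<close>])
  then show ?case
    using nil[of m x] Suc.prems by (simp add: nth_deriv_Suc muncurry_mcurry)
qed

lemma Ck_onI:
  assumes "open U" and "\<And>x. x \<in> U \<Longrightarrow> g 0 x = mconst (f x)"
    and deriv: "\<And>m x. m < k \<Longrightarrow> x \<in> U \<Longrightarrow> (g m has_derivative blinfun_apply (mcurry (g (Suc m) x))) (at x)"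
    and nil: "\<And>m x. m < k \<Longrightarrow> x \<in> U \<Longrightarrow> multilin_apply (g (Suc m) x) [] = 0"
    and "continuous_on U (g k)"
  shows "Ck_on k f U"
proof -
  note eq = nth_deriv_unique[OF assms(1-4)]
  have "nth_deriv m f differentiable (at x)" if "m < k" "x \<in> U" for m x
  proof -
    have "(nth_deriv m f has_derivative blinfun_apply (mcurry (g (Suc m) x))) (at x)"
      by (rule has_derivative_transform_within_open[OF deriv[OF that] \<open>open U\<close> that(2)])
        (use that(1) in \<open>simp add: eq\<close>)
    then show ?thesis by (auto simp: differentiable_def)
  qed
  moreover have "continuous_on U (nth_deriv k f)"
    using \<open>continuous_on U (g k)\<close> by (rule continuous_on_eq) (simp add: eq)
  ultimately show ?thesis using \<open>open U\<close> by (auto simp: Ck_on_def)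
qed

lemma Ck_onD:
  assumes "Ck_on k f U"
  shows "open U"
    and "m < k \<Longrightarrow> x \<in> U \<Longrightarrow> (nth_deriv m f has_derivative blinfun_apply (mcurry (nth_deriv (Suc m) f x))) (at x)"
    and "continuous_on U (nth_deriv k f)"
proof -
  show "open U" "continuous_on U (nth_deriv k f)"
    using assms by (auto simp: Ck_on_def)
  show "(nth_deriv m f has_derivative blinfun_apply (mcurry (nth_deriv (Suc m) f x))) (at x)"
    if "m < k" "x \<in> U"
    by (rule has_derivative_nth_deriv) (use assms that in \<open>auto simp: Ck_on_def\<close>)
qed

text \<open>A general element of \<open>multilin\<close> may be nonzero on lists of several lengths.
  Here the value on \<open>v # ws\<close> is the derivative in direction \<open>v\<close> of the
  value on \<open>ws\<close>, which vanishes near \<open>x\<close> by induction.\<close>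

lemma nth_deriv_apply_length:
  assumes "Ck_on k f U" "m \<le> k" "x \<in> U" "length vs \<noteq> m"
  shows "multilin_apply (nth_deriv m f x) vs = 0"
  using assms(2-4)
proof (induction m arbitrary: x vs)
  case (Suc m)
  have D: "(nth_deriv m f has_derivative blinfun_apply (mcurry (nth_deriv (Suc m) f x))) (at x)"
    using assms(1) Suc by (intro Ck_onD(2)) auto
  show ?case
  proof (cases vs)
    case Nil
    show ?thesis unfolding Nil by (subst nth_deriv_Suc[OF D]) (simp add: muncurry_apply)
  next
    case (Cons v ws)
    have "((\<lambda>y. multilin_apply (nth_deriv m f y) ws) has_derivative
        (\<lambda>v. multilin_apply (mcurry (nth_deriv (Suc m) f x) v) ws)) (at x)"
      by (rule bounded_linear.has_derivative[OF bounded_linear_multilin_apply D])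
    moreover have "((\<lambda>y. multilin_apply (nth_deriv m f y) ws) has_derivative (\<lambda>v. 0)) (at x)"
      by (rule has_derivative_transform_within_open[OF has_derivative_const[of 0]
            Ck_onD(1)[OF assms(1)]]) (use Suc Cons in auto)
    ultimately show ?thesis
      by (metis (no_types, lifting) Cons has_derivative_unique mcurry_apply)
  qed
qed (simp add: nth_deriv_0 mconst_apply)

lemma Ck_on_cong:
  assumes "\<And>x. x \<in> U \<Longrightarrow> f x = g x" and "Ck_on k f U"
  shows "Ck_on k g U"
proof (rule Ck_onI[where g = "\<lambda>m. nth_deriv m f"])
  show "nth_deriv 0 f x = mconst (g x)" if "x \<in> U" for x
    unfolding nth_deriv_0 assms(1)[OF that] ..
  show "multilin_apply (nth_deriv (Suc m) f x) [] = 0" if "m < k" "x \<in> U" for m x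
    using that by (intro nth_deriv_apply_length[OF assms(2)]) auto
qed (rule Ck_onD[OF assms(2)]; assumption?)+

lemma Ck_on_mono:
  assumes "Ck_on k f U" "j \<le> k"
  shows "Ck_on j f U"
proof (cases "j = k")
  case False
  then have "continuous_on U (nth_deriv j f)"
    using assms by (intro continuous_at_imp_continuous_on ballI differentiable_imp_continuous_within)
      (auto simp: Ck_on_def)
  then show ?thesis using assms by (auto simp: Ck_on_def)
qed (use assms in simp)

lemma Ck_on_subset:
  assumes "Ck_on k f U" "open U'" "U' \<subseteq> U"
  shows "Ck_on k f U'"
  using assms by (auto simp: Ck_on_def intro: continuous_on_subset)

lemma Ck_on_local:
  assumes "\<And>x. x \<in> U \<Longrightarrow> \<exists>Q. x \<in> Q \<and> Q \<subseteq> U \<and> Ck_on k f Q"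
  shows "Ck_on k f U"
proof -
  obtain Q where Q: "\<And>x. x \<in> U \<Longrightarrow> x \<in> Q x \<and> Q x \<subseteq> U \<and> Ck_on k f (Q x)"
    using assms by metis
  then have U: "U = (\<Union>x\<in>U. Q x)" by blast
  have opn: "open (Q x)" if "x \<in> U" for x
    using Q[OF that] Ck_onD(1) by blast
  have "open U" by (subst U) (use opn in blast)
  moreover have "nth_deriv m f differentiable (at x)" if "m < k" "x \<in> U" for m x
    using Q[OF that(2)] that(1) by (auto simp: Ck_on_def)
  moreover have "continuous_on (\<Union>x\<in>U. Q x) (nth_deriv k f)"
    by (rule continuous_on_open_UN) (use Q opn Ck_onD(3) in blast)+
  ultimately show ?thesis using U by (auto simp: Ck_on_def)
qed

lemma Ck_on_0: "Ck_on 0 f U \<longleftrightarrow> open U \<and> continuous_on U f"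
proof -
  have "continuous_on U (nth_deriv 0 f) \<longleftrightarrow> continuous_on U f"
  proof
    assume "continuous_on U (nth_deriv 0 f)"
    then have "continuous_on U (\<lambda>x. multilin_apply (nth_deriv 0 f x) [])"
      by (rule bounded_linear.continuous_on[OF bounded_linear_multilin_apply])
    then show "continuous_on U f" by (simp add: nth_deriv_0 mconst_apply)
  next
    assume "continuous_on U f"
    then show "continuous_on U (nth_deriv 0 f)"
      unfolding nth_deriv_0[abs_def] by (rule bounded_linear.continuous_on[OF bounded_linear_mconst])
  qed
  then show ?thesis by (simp add: Ck_on_def)
qed

lemma Ck_on_continuous:
  assumes "Ck_on k f U"
  shows "continuous_on U f"
  using Ck_on_mono[OF assms, of 0] by (simp add: Ck_on_0)

section \<open>Linear images, sums, and the recursion of the class over its order\<close>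

lemma Ck_on_linear:
  fixes f :: "'a::real_normed_vector \<Rightarrow> 'b::real_normed_vector" and A :: "'b \<Rightarrow> 'c::real_normed_vector"
  assumes "bounded_linear A" "Ck_on k f U"
  shows "Ck_on k (\<lambda>x. A (f x)) U"
proof (rule Ck_onI[where g = "\<lambda>m x. mmap (Blinfun A) (nth_deriv m f x)"])
  note A = bounded_linear_Blinfun_apply[OF assms(1)]
  show "open U" using Ck_onD(1)[OF assms(2)] .
  show "mmap (Blinfun A) (nth_deriv 0 f x) = mconst (A (f x))" for x
    by (rule multilin_eqI)
      (simp add: nth_deriv_0 mmap_apply mconst_apply A linear_simps(3)[OF assms(1)])
  show "((\<lambda>x. mmap (Blinfun A) (nth_deriv m f x)) has_derivative
      blinfun_apply (mcurry (mmap (Blinfun A) (nth_deriv (Suc m) f x)))) (at x)"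
    if "m < k" "x \<in> U" for m x
  proof -
    have "blinfun_apply (mcurry (mmap (Blinfun A) T)) = (\<lambda>v. mmap (Blinfun A) (mcurry T v))"
      for T :: "('a, 'b) multilin"
      by (rule ext, rule multilin_eqI) (simp add: mcurry_apply mmap_apply)
    then show ?thesis
      using bounded_linear.has_derivative[OF bounded_linear_mmap Ck_onD(2)[OF assms(2) that]] by simp
  qed
  show "continuous_on U (\<lambda>x. mmap (Blinfun A) (nth_deriv k f x))"
    by (rule bounded_linear.continuous_on[OF bounded_linear_mmap Ck_onD(3)[OF assms(2)]])
  show "multilin_apply (mmap (Blinfun A) (nth_deriv (Suc m) f x)) [] = 0" if "m < k" "x \<in> U" for m x
    using that by (simp add: mmap_apply nth_deriv_apply_length[OF assms(2)] blinfun.bilinear_simps)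
qed

lemma Ck_on_add:
  assumes f: "Ck_on k f U" and g: "Ck_on k g U"
  shows "Ck_on k (\<lambda>x. f x + g x) U"
proof (rule Ck_onI[where g = "\<lambda>m x. nth_deriv m f x + nth_deriv m g x"])
  show "open U" using Ck_onD(1)[OF f] .
  show "nth_deriv 0 f x + nth_deriv 0 g x = mconst (f x + g x)" for x
    by (simp add: nth_deriv_0 linear_simps[OF bounded_linear_mconst])
  show "((\<lambda>x. nth_deriv m f x + nth_deriv m g x) has_derivative
      blinfun_apply (mcurry (nth_deriv (Suc m) f x + nth_deriv (Suc m) g x))) (at x)"
    if "m < k" "x \<in> U" for m x
    using has_derivative_add[OF Ck_onD(2)[OF f that] Ck_onD(2)[OF g that]]
    by (simp add: linear_simps[OF bounded_linear_mcurry] plus_blinfun.rep_eq)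
  show "continuous_on U (\<lambda>x. nth_deriv k f x + nth_deriv k g x)"
    by (intro continuous_on_add Ck_onD(3) f g)
  show "multilin_apply (nth_deriv (Suc m) f x + nth_deriv (Suc m) g x) [] = 0" if "m < k" "x \<in> U" for m x
    using that by (simp add: nth_deriv_apply_length[OF f] nth_deriv_apply_length[OF g])
qed

lemma Ck_on_const: "open U \<Longrightarrow> Ck_on k (\<lambda>x. c) U"
  by (rule Ck_onI[where g = "\<lambda>m x. if m = 0 then mconst c else 0"])
    (auto simp: linear_simps[OF bounded_linear_mcurry] zero_blinfun.rep_eq)

text \<open>Together with \<open>Ck_on_SucE\<close> this turns \<open>Ck_on\<close> into a
  recursion: one order more means a derivative of the given order. Products, compositions and
  inverses are then treated by induction on \<open>k\<close> without touching
  \<open>nth_deriv\<close>.\<close>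

lemma Ck_on_derivative:
  assumes "open U" and deriv: "\<And>x. x \<in> U \<Longrightarrow> (h has_derivative blinfun_apply (h' x)) (at x)"
    and h': "Ck_on k h' U"
  shows "Ck_on (Suc k) h U"
proof (rule Ck_onI[where g = "\<lambda>m x. case m of 0 \<Rightarrow> mconst (h x) | Suc m \<Rightarrow> msnoc (nth_deriv m h' x)"])
  show "open U" by fact
  fix m x assume m: "m < Suc k" and x: "x \<in> U"
  show "((\<lambda>x. case m of 0 \<Rightarrow> mconst (h x) | Suc m \<Rightarrow> msnoc (nth_deriv m h' x)) has_derivative
      blinfun_apply (mcurry (case Suc m of 0 \<Rightarrow> mconst (h x) | Suc m \<Rightarrow> msnoc (nth_deriv m h' x)))) (at x)"
  proof (cases m)
    case 0
    have "blinfun_apply (mcurry (msnoc (mconst A))) = (\<lambda>v. mconst (A v))" for A :: "'a \<Rightarrow>\<^sub>L 'b"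
      by (rule ext, rule multilin_eqI)
        (auto simp: mcurry_apply mconst_apply msnoc_apply blinfun.bilinear_simps)
    then show ?thesis
      using bounded_linear.has_derivative[OF bounded_linear_mconst deriv[OF x]]
      by (simp add: 0 nth_deriv_0)
  next
    case (Suc l)
    have "blinfun_apply (mcurry (msnoc (nth_deriv (Suc l) h' x))) =
        (\<lambda>v. msnoc (mcurry (nth_deriv (Suc l) h' x) v))"
      by (rule ext, rule multilin_eqI) (use Suc m x in \<open>auto simp: mcurry_apply msnoc_apply blinfun.bilinear_simps
          nth_deriv_apply_length[OF h']\<close>)
    then show ?thesis
      using bounded_linear.has_derivative[OF bounded_linear_msnoc Ck_onD(2)[OF h', of l x]] Suc m x
      by simp
  qed
qed (auto simp: msnoc_apply intro!: bounded_linear.continuous_on[OF bounded_linear_msnoc] Ck_onD(3) h')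

lemma Ck_on_SucE:
  assumes h: "Ck_on (Suc k) h U"
  obtains h' where "\<And>x. x \<in> U \<Longrightarrow> (h has_derivative blinfun_apply (h' x)) (at x)" "Ck_on k h' U"
proof
  define h' where "h' x = Blinfun (frechet_derivative h (at x))" for x
  show deriv: "(h has_derivative blinfun_apply (h' x)) (at x)" if "x \<in> U" for x
  proof -
    have "((\<lambda>y. multilin_apply (nth_deriv 0 h y) []) has_derivative
        (\<lambda>v. multilin_apply (mcurry (nth_deriv (Suc 0) h x) v) [])) (at x)"
      by (rule bounded_linear.has_derivative[OF bounded_linear_multilin_apply Ck_onD(2)[OF h]])
        (use that in auto)
    then have "h differentiable (at x)"
      by (auto simp: nth_deriv_0 mconst_apply differentiable_def)
    then show ?thesis
      unfolding h'_def frechet_derivative_works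
      by (simp add: bounded_linear_Blinfun_apply has_derivative_bounded_linear)
  qed
  show "Ck_on k h' U"
  proof (rule Ck_onI[where g = "\<lambda>m x. munsnoc (nth_deriv (Suc m) h x)"])
    show "open U" using Ck_onD(1)[OF h] .
    show "munsnoc (nth_deriv (Suc 0) h x) = mconst (h' x)" if "x \<in> U" for x
    proof -
      have "nth_deriv (Suc 0) h x = muncurry (Blinfun (\<lambda>v. mconst (h' x v)))"
        and bl: "bounded_linear (\<lambda>v. mconst (h' x v) :: ('a, 'b) multilin)"
      proof -
        show bl: "bounded_linear (\<lambda>v. mconst (h' x v) :: ('a, 'b) multilin)"
          by (rule bounded_linear_compose[OF bounded_linear_mconst]) (rule bounded_linear_blinfun_apply, simp)
        show "nth_deriv (Suc 0) h x = muncurry (Blinfun (\<lambda>v. mconst (h' x v)))"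
          by (rule nth_deriv_Suc) (use bounded_linear.has_derivative[OF bounded_linear_mconst deriv[OF that]]
              in \<open>simp add: nth_deriv_0[abs_def] bounded_linear_Blinfun_apply[OF bl]\<close>)
      qed
      then show ?thesis
        by (intro multilin_eqI blinfun_eqI)
          (auto simp: munsnoc_apply muncurry_apply mconst_apply bounded_linear_Blinfun_apply
            blinfun.bilinear_simps split: list.split)
    qed
    fix m x assume m: "m < k" and x: "x \<in> U"
    have "blinfun_apply (mcurry (munsnoc T)) = (\<lambda>v. munsnoc (mcurry T v))" for T :: "('a, 'b) multilin"
      by (intro ext multilin_eqI blinfun_eqI) (simp add: mcurry_apply munsnoc_apply)
    then show "((\<lambda>x. munsnoc (nth_deriv (Suc m) h x)) has_derivative
        blinfun_apply (mcurry (munsnoc (nth_deriv (Suc (Suc m)) h x)))) (at x)"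
      using bounded_linear.has_derivative[OF bounded_linear_munsnoc Ck_onD(2)[OF h, of "Suc m" x]] m x
      by simp
    show "multilin_apply (munsnoc (nth_deriv (Suc (Suc m)) h x)) [] = 0"
      by (rule blinfun_eqI) (use m x in \<open>simp add: munsnoc_apply nth_deriv_apply_length[OF h]\<close>)
  next
    show "continuous_on U (\<lambda>x. munsnoc (nth_deriv (Suc k) h x))"
      by (intro bounded_linear.continuous_on[OF bounded_linear_munsnoc] Ck_onD(3) h)
  qed
qed

lemma Ck_on_bounded_linear:
  assumes "bounded_linear A" "open U"
  shows "Ck_on k A U"
  by (rule Ck_on_mono[of "Suc k"], rule Ck_on_derivative[where h' = "\<lambda>_. Blinfun A"])
    (use assms in \<open>auto simp: bounded_linear_Blinfun_apply bounded_linear_imp_has_derivative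
      intro: Ck_on_const\<close>)

text \<open>The induction needs fixed types, whereas the bilinear maps which arise by differentiation act
  on spaces of linear maps. These are absorbed by the spaces of multilinear maps.\<close>

lemma Ck_on_bilinear_multilin:
  fixes B :: "('a::real_normed_vector, 'b::real_normed_vector) multilin \<Rightarrow>
    ('a, 'c::real_normed_vector) multilin \<Rightarrow> ('a, 'd::real_normed_vector) multilin"
    and f :: "'a \<Rightarrow> ('a, 'b) multilin" and g :: "'a \<Rightarrow> ('a, 'c) multilin"
  assumes "bounded_bilinear B" "Ck_on k f U" "Ck_on k g U"
  shows "Ck_on k (\<lambda>x. B (f x) (g x)) U"
  using assms
proof (induction k arbitrary: B f g)
  case 0
  then show ?case by (auto simp: Ck_on_0 intro: bounded_bilinear.continuous_on)
next
  case (Suc k)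
  interpret bounded_bilinear B by fact
  obtain f' where f': "\<And>x. x \<in> U \<Longrightarrow> (f has_derivative blinfun_apply (f' x)) (at x)" "Ck_on k f' U"
    using Ck_on_SucE[OF Suc.prems(2)] by blast
  obtain g' where g': "\<And>x. x \<in> U \<Longrightarrow> (g has_derivative blinfun_apply (g' x)) (at x)" "Ck_on k g' U"
    using Ck_on_SucE[OF Suc.prems(3)] by blast
  \<comment> \<open>The two terms of the product rule, uncurried. Both are again bilinear maps
    between spaces of multilinear maps on the same \<open>'a\<close>, so the induction hypothesis
    applies to them.\<close>
  define B1 where "B1 S T = muncurry (prod_left T o\<^sub>L mcurry S)" for S T
  define B2 where "B2 S T = muncurry (prod_right S o\<^sub>L mcurry T)" for S T
  have "bounded_bilinear (\<lambda>S T. prod_left T o\<^sub>L mcurry S)"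
    by (rule bounded_bilinear.flip, rule bounded_bilinear.comp[OF bounded_bilinear_blinfun_compose
          bounded_linear_prod_left bounded_linear_mcurry])
  then have B1: "bounded_bilinear B1"
    unfolding B1_def by (rule bounded_linear_bounded_bilinear_compose[OF bounded_linear_muncurry])
  have "bounded_bilinear (\<lambda>S T. prod_right S o\<^sub>L mcurry T)"
    by (rule bounded_bilinear.comp[OF bounded_bilinear_blinfun_compose
          bounded_linear_prod_right bounded_linear_mcurry])
  then have B2: "bounded_bilinear B2"
    unfolding B2_def by (rule bounded_linear_bounded_bilinear_compose[OF bounded_linear_muncurry])
  define h' where "h' x = mcurry (B1 (muncurry (f' x)) (g x) + B2 (f x) (muncurry (g' x)))" for x
  show ?case
  proof (rule Ck_on_derivative[where h' = h'])
    show "open U" using Ck_onD(1)[OF Suc.prems(2)] .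
    show "((\<lambda>x. B (f x) (g x)) has_derivative blinfun_apply (h' x)) (at x)" if "x \<in> U" for x
    proof -
      have "blinfun_apply (h' x) = (\<lambda>v. B (f x) (g' x v) + B (f' x v) (g x))"
        by (simp add: h'_def B1_def B2_def linear_simps[OF bounded_linear_mcurry] fun_eq_iff
            prod_left.rep_eq prod_right.rep_eq blinfun.bilinear_simps)
      then show ?thesis using FDERIV[OF f'(1)[OF that] g'(1)[OF that]] by simp
    qed
    show "Ck_on k h' U"
      unfolding h'_def
      by (intro Ck_on_linear[OF bounded_linear_mcurry] Ck_on_add Suc.IH B1 B2
          Ck_on_linear[OF bounded_linear_muncurry] f'(2) g'(2)
          Ck_on_mono[OF Suc.prems(2)] Ck_on_mono[OF Suc.prems(3)]) auto
  qed
qed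

lemma Ck_on_bilinear:
  fixes f :: "'a::real_normed_vector \<Rightarrow> 'b::real_normed_vector"
    and g :: "'a \<Rightarrow> 'c::real_normed_vector" and B :: "'b \<Rightarrow> 'c \<Rightarrow> 'd::real_normed_vector"
  assumes "bounded_bilinear B" "Ck_on k f U" "Ck_on k g U"
  shows "Ck_on k (\<lambda>x. B (f x) (g x)) U"
proof -
  \<comment> \<open>\<open>B\<close> is placed between evaluation at \<open>[]\<close> and
    \<open>mconst\<close>, so that it fits the types of the preceding lemma.\<close>
  let ?B = "\<lambda>(S :: ('a, 'b) multilin) (T :: ('a, 'c) multilin).
    (mconst (B (multilin_apply S []) (multilin_apply T [])) :: ('a, 'd) multilin)"
  have "bounded_bilinear ?B"
    by (rule bounded_linear_bounded_bilinear_compose[OF bounded_linear_mconst],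
        rule bounded_bilinear.comp[OF assms(1)]; rule bounded_linear_multilin_apply)
  from Ck_on_bilinear_multilin[OF this Ck_on_linear[OF bounded_linear_mconst assms(2)]
      Ck_on_linear[OF bounded_linear_mconst assms(3)]]
  have "Ck_on k (\<lambda>x. multilin_apply (mconst (B (f x) (g x)) :: ('a, 'd) multilin) []) U"
    by (intro Ck_on_linear[OF bounded_linear_multilin_apply]) (simp add: mconst_apply)
  then show ?thesis by (simp add: mconst_apply)
qed

text \<open>The derivative of \<open>a\<close> takes values in linear maps. Stored as
  \<open>muncurry (a' y)\<close> it has the type of \<open>a\<close> again, which lets the induction
  hypothesis handle the outer factor of the chain rule.\<close>

lemma Ck_on_compose_multilin:
  fixes f :: "'a::real_normed_vector \<Rightarrow> 'b::real_normed_vector"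
    and a :: "'b \<Rightarrow> ('b, 'c::real_normed_vector) multilin"
  assumes "Ck_on k f U" "Ck_on k a U'" "f ` U \<subseteq> U'"
  shows "Ck_on k (\<lambda>x. a (f x)) U"
  using assms
proof (induction k arbitrary: a)
  case 0
  then show ?case by (auto simp: Ck_on_0 intro: continuous_on_compose2)
next
  case (Suc k)
  obtain f' where f': "\<And>x. x \<in> U \<Longrightarrow> (f has_derivative blinfun_apply (f' x)) (at x)" "Ck_on k f' U"
    using Ck_on_SucE[OF Suc.prems(1)] by blast
  obtain a' where a': "\<And>x. x \<in> U' \<Longrightarrow> (a has_derivative blinfun_apply (a' x)) (at x)" "Ck_on k a' U'"
    using Ck_on_SucE[OF Suc.prems(2)] by blast
  show ?case
  proof (rule Ck_on_derivative[where h' = "\<lambda>x. mcurry (muncurry (a' (f x))) o\<^sub>L f' x"])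
    show "open U" using Ck_onD(1)[OF Suc.prems(1)] .
    show "((\<lambda>x. a (f x)) has_derivative blinfun_apply (mcurry (muncurry (a' (f x))) o\<^sub>L f' x)) (at x)"
      if "x \<in> U" for x
      using has_derivative_compose[OF f'(1)[OF that] a'(1)[of "f x"]] Suc.prems(3) that
      by (auto simp: o_def blinfun_compose.rep_eq)
    show "Ck_on k (\<lambda>x. mcurry (muncurry (a' (f x))) o\<^sub>L f' x) U"
      by (intro Ck_on_bilinear[OF bounded_bilinear_blinfun_compose] f'(2)
          Ck_on_linear[OF bounded_linear_mcurry] Suc.IH Ck_on_linear[OF bounded_linear_muncurry] a'(2)
          Ck_on_mono[OF Suc.prems(1)] Suc.prems(3)) simp
  qed
qed

lemma Ck_on_compose:
  fixes f :: "'a::real_normed_vector \<Rightarrow> 'b::real_normed_vector"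
    and g :: "'b \<Rightarrow> 'c::real_normed_vector"
  assumes "Ck_on k f U" "Ck_on k g U'" "f ` U \<subseteq> U'"
  shows "Ck_on k (\<lambda>x. g (f x)) U"
proof -
  have "Ck_on k (\<lambda>x. multilin_apply (mconst (g (f x)) :: ('b, 'c) multilin) []) U"
    by (intro Ck_on_linear[OF bounded_linear_multilin_apply] Ck_on_compose_multilin[OF assms(1) _ assms(3)]
        Ck_on_linear[OF bounded_linear_mconst] assms(2))
  then show ?thesis by (simp add: mconst_apply)
qed

lemma Ck_on_Pair:
  assumes "Ck_on k f U" "Ck_on k g U"
  shows "Ck_on k (\<lambda>x. (f x, g x)) U"
proof -
  have "bounded_linear (\<lambda>y. (y, 0))" "bounded_linear (\<lambda>y. (0, y))"
    by (intro bounded_linear_Pair bounded_linear_ident bounded_linear_zero)+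
  from Ck_on_add[OF Ck_on_linear[OF this(1) assms(1)] Ck_on_linear[OF this(2) assms(2)]]
  show ?thesis by simp
qed

lemma Ck_on_minus:
  assumes "Ck_on k f U" "Ck_on k g U"
  shows "Ck_on k (\<lambda>x. f x - g x) U"
  using Ck_on_add[OF assms(1) Ck_on_linear[OF bounded_linear_minus[OF bounded_linear_ident] assms(2)]]
  by simp


subsection \<open>Inverse functions\<close>

text \<open>The identity \<open>B p - B p0 = B p (A p0 - A p) B p0\<close> gives continuity as soon
  as \<open>norm (B p)\<close> is bounded near \<open>p0\<close>. The same identity gives the bound:
  where \<open>norm (A p - A p0) * norm (B p0) < 1/2\<close>, the term containing
  \<open>norm (B p)\<close> is absorbed into the left-hand side.\<close>

lemma continuous_on_blinfun_inverse:
  fixes A :: "'p::topological_space \<Rightarrow> 'a::real_normed_vector \<Rightarrow>\<^sub>L 'b::real_normed_vector"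
    and B :: "'p \<Rightarrow> 'b \<Rightarrow>\<^sub>L 'a"
  assumes cont: "continuous_on U A"
    and BA: "\<And>p. p \<in> U \<Longrightarrow> B p o\<^sub>L A p = id_blinfun"
    and AB: "\<And>p. p \<in> U \<Longrightarrow> A p o\<^sub>L B p = id_blinfun"
  shows "continuous_on U B"
  unfolding continuous_on_def
proof
  fix p0 assume p0: "p0 \<in> U"
  let ?F = "at p0 within U"
  have A: "((\<lambda>p. norm (A p - A p0)) \<longlongrightarrow> 0) ?F"
    using cont p0 by (simp add: continuous_on_def LIM_zero tendsto_norm_zero)
  have ev: "eventually (\<lambda>p. p \<in> U) ?F" by (simp add: eventually_at_filter)
  have eq: "B p - B p0 = (B p o\<^sub>L (A p0 - A p)) o\<^sub>L B p0" if "p \<in> U" for p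
  proof -
    have 1: "B p (A p v) = v" for v using BA[OF that] by (metis blinfun_apply_blinfun_compose blinfun_apply_id_blinfun)
    have 2: "A p0 (B p0 v) = v" for v using AB[OF p0] by (metis blinfun_apply_blinfun_compose blinfun_apply_id_blinfun)
    show ?thesis by (rule blinfun_eqI) (simp add: blinfun.bilinear_simps 1 2)
  qed
  have le: "norm (B p - B p0) \<le> norm (B p) * norm (A p - A p0) * norm (B p0)" if "p \<in> U" for p
    unfolding eq[OF that]
    by (rule order_trans[OF norm_blinfun_compose])
      (auto intro!: mult_right_mono order_trans[OF norm_blinfun_compose] simp: norm_minus_commute)
  have "((\<lambda>p. norm (A p - A p0) * norm (B p0)) \<longlongrightarrow> 0 * norm (B p0)) ?F"
    by (intro tendsto_intros A)
  then have "\<forall>\<^sub>F p in ?F. norm (A p - A p0) * norm (B p0) < 1/2"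
    by (intro order_tendstoD(2)) auto
  with ev have bd: "\<forall>\<^sub>F p in ?F. norm (B p) \<le> 2 * norm (B p0)"
  proof eventually_elim
    case (elim p)
    have "norm (B p) \<le> norm (B p - B p0) + norm (B p0)" by norm
    also have "\<dots> \<le> norm (B p) * (norm (A p - A p0) * norm (B p0)) + norm (B p0)"
      using le[OF elim(1)] by (simp add: mult.assoc)
    also have "\<dots> \<le> norm (B p) * (1/2) + norm (B p0)"
      using elim(2) by (intro add_right_mono mult_left_mono) auto
    finally show ?case by simp
  qed
  have "((\<lambda>p. norm (B p - B p0)) \<longlongrightarrow> 0) ?F"
  proof (rule tendsto_sandwich[OF _ _ tendsto_const])
    have "((\<lambda>p. (2 * norm (B p0)) * norm (A p - A p0) * norm (B p0)) \<longlongrightarrow> (2 * norm (B p0)) * 0 * norm (B p0)) ?F"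
      by (intro tendsto_intros A)
    then show "((\<lambda>p. (2 * norm (B p0)) * norm (A p - A p0) * norm (B p0)) \<longlongrightarrow> 0) ?F" by simp
    show "\<forall>\<^sub>F p in ?F. norm (B p - B p0) \<le> (2 * norm (B p0)) * norm (A p - A p0) * norm (B p0)"
      using ev bd
    proof eventually_elim
      case (elim p)
      show ?case
        by (rule order_trans[OF le[OF elim(1)]]) (intro mult_right_mono elim, auto)
    qed
  qed auto
  then show "(B \<longlongrightarrow> B p0) ?F" by (simp add: tendsto_norm_zero_iff LIM_zero_iff)
qed

lemma Ck_on_blinfun_inverse:
  fixes A :: "'p::real_normed_vector \<Rightarrow> 'a::real_normed_vector \<Rightarrow>\<^sub>L 'b::real_normed_vector"
    and B :: "'p \<Rightarrow> 'b \<Rightarrow>\<^sub>L 'a"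
  assumes "Ck_on k A U"
    and BA: "\<And>p. p \<in> U \<Longrightarrow> B p o\<^sub>L A p = id_blinfun"
    and AB: "\<And>p. p \<in> U \<Longrightarrow> A p o\<^sub>L B p = id_blinfun"
  shows "Ck_on k B U"
  using assms(1)
proof (induction k)
  case 0
  then show ?case using continuous_on_blinfun_inverse[of U A B, OF _ BA AB] by (simp add: Ck_on_0)
next
  case (Suc k)
  obtain A' where A': "\<And>x. x \<in> U \<Longrightarrow> (A has_derivative blinfun_apply (A' x)) (at x)" "Ck_on k A' U"
    using Ck_on_SucE[OF Suc.prems] by blast
  have opn: "open U" using Ck_onD(1)[OF Suc.prems] .
  have Bk: "Ck_on k B U" using Suc.IH Ck_on_mono[OF Suc.prems] by simp
  have contB: "continuous_on U B" using Ck_on_continuous[OF Bk] .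
  interpret C: bounded_bilinear "blinfun_compose :: ('a \<Rightarrow>\<^sub>L 'b) \<Rightarrow> ('b \<Rightarrow>\<^sub>L 'a) \<Rightarrow> 'b \<Rightarrow>\<^sub>L 'b"
    by (rule bounded_bilinear_blinfun_compose)
  interpret C': bounded_bilinear "blinfun_compose :: ('b \<Rightarrow>\<^sub>L 'a) \<Rightarrow> ('b \<Rightarrow>\<^sub>L 'b) \<Rightarrow> 'b \<Rightarrow>\<^sub>L 'a"
    by (rule bounded_bilinear_blinfun_compose)
  \<comment> \<open>The derivative of inversion, \<open>v \<mapsto> - B p (A' p v) B p\<close>.
    Written with \<open>prod_left\<close> and \<open>prod_right\<close>, it is built from
    \<open>B\<close> and \<open>A'\<close> by linear and bilinear maps and thus is as smooth as both
    of them.\<close>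
  define B' where "B' p = - (C'.prod_right (B p) o\<^sub>L (C.prod_left (B p) o\<^sub>L A' p))" for p
  have BAv: "B p (A p v) = v" if "p \<in> U" for p v
    using BA[OF that] by (metis blinfun_apply_blinfun_compose blinfun_apply_id_blinfun)
  have ABv: "A p (B p v) = v" if "p \<in> U" for p v
    using AB[OF that] by (metis blinfun_apply_blinfun_compose blinfun_apply_id_blinfun)
  show ?case
  proof (rule Ck_on_derivative[where h' = B'])
    show "Ck_on k B' U"
      unfolding B'_def
      by (intro Ck_on_linear[OF bounded_linear_minus[OF bounded_linear_ident]]
          Ck_on_bilinear[OF bounded_bilinear_blinfun_compose] A'(2)
          Ck_on_linear[OF C.bounded_linear_prod_left] Ck_on_linear[OF C'.bounded_linear_prod_right] Bk)
    show "(B has_derivative blinfun_apply (B' p)) (at p)" if p: "p \<in> U" for p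
    proof -
      \<comment> \<open>\<open>B q = B p - B p (A q - A p) B q\<close>, whose right-hand side is differentiable at \<open>p\<close>, since
        \<open>A q - A p\<close> vanishes there and \<open>B\<close> is continuous.\<close>
      have eq: "B p - ((B p o\<^sub>L (A q - A p)) o\<^sub>L B q) = B q" if "q \<in> U" for q
        by (rule blinfun_eqI) (simp add: blinfun.bilinear_simps BAv ABv p that)
      have contB': "B \<midarrow>p\<rightarrow> B p" using contB p opn by (simp add: continuous_on_eq_continuous_at isCont_def)
      have D: "((\<lambda>q. (B p o\<^sub>L (A q - A p)) o\<^sub>L B q) has_derivative
          (\<lambda>v. (B p o\<^sub>L A' p v) o\<^sub>L B p)) (at p)"
        unfolding has_derivative_at
      proof (intro conjI)
        let ?d = "\<lambda>v. (B p o\<^sub>L A' p v) o\<^sub>L B p"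
        have bl: "bounded_linear (\<lambda>v. (B p o\<^sub>L A' p v) o\<^sub>L C)" for C :: "'b \<Rightarrow>\<^sub>L 'a"
          by (intro bounded_linear_compose[OF bounded_bilinear.bounded_linear_left[OF bounded_bilinear_blinfun_compose]]
              bounded_linear_compose[OF bounded_bilinear.bounded_linear_right[OF bounded_bilinear_blinfun_compose]]
              bounded_linear_blinfun_apply bounded_linear_ident)
        then show "bounded_linear ?d" .
        have A0: "((\<lambda>h. norm (A (p + h) - A p - A' p h) / norm h) \<longlongrightarrow> 0) (at 0)"
          using A'(1)[OF p] by (simp add: has_derivative_at)
        have B0: "((\<lambda>h. norm (B (p + h) - B p)) \<longlongrightarrow> 0) (at 0)"
          using contB' by (simp add: LIM_offset_zero_iff LIM_zero tendsto_norm_zero)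
        have "((\<lambda>h. norm (B p) * (norm (A (p + h) - A p - A' p h) / norm h) * (norm (B (p + h) - B p) + norm (B p))
           + norm (B p) * norm (A' p) * norm (B (p + h) - B p))
            \<longlongrightarrow> norm (B p) * 0 * (0 + norm (B p)) + norm (B p) * norm (A' p) * 0) (at 0)"
          by (intro tendsto_intros A0 B0)
        then have lim: "((\<lambda>h. norm (B p) * (norm (A (p + h) - A p - A' p h) / norm h) * (norm (B (p + h) - B p) + norm (B p))
           + norm (B p) * norm (A' p) * norm (B (p + h) - B p)) \<longlongrightarrow> 0) (at 0)" by simp
        show "(\<lambda>h. norm (((B p o\<^sub>L (A (p + h) - A p)) o\<^sub>L B (p + h)) -
            ((B p o\<^sub>L (A p - A p)) o\<^sub>L B p) - ?d h) / norm h) \<midarrow>0\<rightarrow> 0"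
        proof (rule tendsto_sandwich[OF _ _ tendsto_const lim])
          show "\<forall>\<^sub>F h in at 0. norm (((B p o\<^sub>L (A (p + h) - A p)) o\<^sub>L B (p + h)) -
            ((B p o\<^sub>L (A p - A p)) o\<^sub>L B p) - ?d h) / norm h
            \<le> norm (B p) * (norm (A (p + h) - A p - A' p h) / norm h) * (norm (B (p + h) - B p) + norm (B p))
           + norm (B p) * norm (A' p) * norm (B (p + h) - B p)"
            unfolding eventually_at_filter
          proof (intro always_eventually allI impI)
            fix h :: 'p assume h: "h \<noteq> 0"
            let ?r = "A (p + h) - A p - A' p h"
            have "((B p o\<^sub>L (A (p + h) - A p)) o\<^sub>L B (p + h)) - ((B p o\<^sub>L (A p - A p)) o\<^sub>L B p) - ?d h
              = ((B p o\<^sub>L ?r) o\<^sub>L B (p + h)) + ((B p o\<^sub>L A' p h) o\<^sub>L (B (p + h) - B p))"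
              by (rule blinfun_eqI) (simp add: blinfun.bilinear_simps)
            also have "norm \<dots> \<le> norm (B p) * norm ?r * norm (B (p + h)) +
              norm (B p) * (norm (A' p) * norm h) * norm (B (p + h) - B p)"
              by (intro norm_triangle_le add_mono order_trans[OF norm_blinfun_compose] mult_mono norm_blinfun) auto
            also have "\<dots> \<le> norm (B p) * norm ?r * (norm (B (p + h) - B p) + norm (B p)) +
              norm (B p) * (norm (A' p) * norm h) * norm (B (p + h) - B p)"
              by (intro add_right_mono mult_left_mono) (norm, simp)
            finally show "norm (((B p o\<^sub>L (A (p + h) - A p)) o\<^sub>L B (p + h)) -
            ((B p o\<^sub>L (A p - A p)) o\<^sub>L B p) - ?d h) / norm h
            \<le> norm (B p) * (norm ?r / norm h) * (norm (B (p + h) - B p) + norm (B p))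
           + norm (B p) * norm (A' p) * norm (B (p + h) - B p)"
              using h by (simp add: field_simps)
          qed
        qed (auto intro!: always_eventually)
      qed
      have "((\<lambda>q. B p - ((B p o\<^sub>L (A q - A p)) o\<^sub>L B q)) has_derivative
          (\<lambda>v. 0 - ((B p o\<^sub>L A' p v) o\<^sub>L B p))) (at p)"
        by (intro has_derivative_diff has_derivative_const D)
      then have "(B has_derivative (\<lambda>v. 0 - ((B p o\<^sub>L A' p v) o\<^sub>L B p))) (at p)"
        by (rule has_derivative_transform_within_open[OF _ opn p]) (rule eq)
      moreover have "blinfun_apply (B' p) = (\<lambda>v. 0 - ((B p o\<^sub>L A' p v) o\<^sub>L B p))"
        by (rule ext, rule blinfun_eqI)
          (simp add: B'_def C.prod_left.rep_eq C'.prod_right.rep_eq blinfun.bilinear_simps)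
      ultimately show ?thesis by simp
    qed
  qed (rule opn)
qed

text \<open>The continuous right inverse \<open>g\<close> is given. Its derivative at
  \<open>z\<close> is the inverse of the derivative of \<open>f\<close> at \<open>g z\<close>, hence
  as smooth as \<open>g\<close> itself as long as the order does not exceed \<open>k\<close>. This
  raises the class of \<open>g\<close> one order at a time, up to \<open>Suc k\<close>.\<close>

lemma Ck_on_inverse_function:
  fixes f :: "'a::real_normed_vector \<Rightarrow> 'b::real_normed_vector" and g :: "'b \<Rightarrow> 'a"
  assumes f: "Ck_on (Suc k) f S" and "open T" and contg: "continuous_on T g" and "g ` T \<subseteq> S"
    and fg: "\<And>z. z \<in> T \<Longrightarrow> f (g z) = z"
    and inv: "\<And>z f'. z \<in> T \<Longrightarrow> (f has_derivative blinfun_apply f') (at (g z)) \<Longrightarrow>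
      \<exists>B. B o\<^sub>L f' = id_blinfun \<and> f' o\<^sub>L B = id_blinfun"
  shows "Ck_on (Suc k) g T"
proof -
  obtain f' where f': "\<And>x. x \<in> S \<Longrightarrow> (f has_derivative blinfun_apply (f' x)) (at x)" "Ck_on k f' S"
    using Ck_on_SucE[OF f] by blast
  have gS: "g z \<in> S" if "z \<in> T" for z using that assms(4) by blast
  then have "\<exists>B. B o\<^sub>L f' (g z) = id_blinfun \<and> f' (g z) o\<^sub>L B = id_blinfun" if "z \<in> T" for z
    using inv[OF that f'(1)] that by blast
  then obtain B where B: "\<And>z. z \<in> T \<Longrightarrow> B z o\<^sub>L f' (g z) = id_blinfun"
      "\<And>z. z \<in> T \<Longrightarrow> f' (g z) o\<^sub>L B z = id_blinfun"
    by metis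
  have deriv: "(g has_derivative blinfun_apply (B z)) (at z)" if z: "z \<in> T" for z
  proof (rule has_derivative_inverse_basic[OF f'(1)[OF gS[OF z]] _ _ _ \<open>open T\<close> z fg])
    show "bounded_linear (blinfun_apply (B z))" by (simp add: bounded_linear_blinfun_apply)
    show "blinfun_apply (B z) \<circ> blinfun_apply (f' (g z)) = id"
      using B(1)[OF z] by (metis blinfun_compose.rep_eq eq_id_iff id_blinfun.rep_eq)
    show "continuous (at z) g" using contg \<open>open T\<close> z by (simp add: continuous_on_eq_continuous_at)
  qed
  have step: "Ck_on (Suc j) g T" if "Ck_on j g T" "j \<le> k" for j
  proof (rule Ck_on_derivative[OF \<open>open T\<close> deriv])
    show "Ck_on j B T"
      by (rule Ck_on_blinfun_inverse[OF Ck_on_compose[OF that(1) Ck_on_mono[OF f'(2) that(2)]] B])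
        (use gS in auto)
  qed
  have "Ck_on j g T" if "j \<le> Suc k" for j
    using that
  proof (induction j)
    case 0
    then show ?case using contg \<open>open T\<close> by (simp add: Ck_on_0)
  next
    case (Suc j)
    then show ?case by (intro step) auto
  qed
  then show ?thesis by simp
qed


subsection \<open>A Volterra operator on paths indexed by an ordered set\<close>

lemma ell1_apply_simps [simp]:
  "ell1_apply 0 i = 0"
  "ell1_apply (u + v) i = ell1_apply u i + ell1_apply v i"
  "ell1_apply (c *\<^sub>R u) i = c * ell1_apply u i"
  "ell1_apply (- u) i = - ell1_apply u i"
  "ell1_apply (u - v) i = ell1_apply u i - ell1_apply v i"
proof -
  show scaleR: "ell1_apply (c *\<^sub>R u) i = c * ell1_apply u i" for c and u :: "'a ell1"
    by (rule fun_cong[OF scaleR_ell1.rep_eq])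
  show plus: "ell1_apply (u + v) i = ell1_apply u i + ell1_apply v i" for u v :: "'a ell1"
    by (rule fun_cong[OF plus_ell1.rep_eq])
  show "ell1_apply (- u) i = - ell1_apply u i"
    unfolding uminus_ell1_def scaleR by simp
  show "ell1_apply (u - v) i = ell1_apply u i - ell1_apply v i"
    unfolding minus_ell1_def plus scaleR by simp
qed (simp add: zero_ell1.rep_eq)

lemma ell1_bounded_sum:
  fixes a :: "'i \<Rightarrow> 'e::banach"
  assumes "\<And>i. norm (a i) \<le> C"
  shows ell1_bounded_summable: "(\<lambda>i. ell1_apply \<tau> i *\<^sub>R a i) summable_on UNIV"
    and norm_ell1_bounded_infsum: "norm (\<Sum>\<^sub>\<infinity>i. ell1_apply \<tau> i *\<^sub>R a i) \<le> norm \<tau> * C"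
proof -
  have S: "(\<lambda>i. \<bar>ell1_apply \<tau> i\<bar> * C) summable_on UNIV"
    by (rule summable_on_cmult_left) (rule ell1_summable)
  have le: "norm (ell1_apply \<tau> i *\<^sub>R a i) \<le> \<bar>ell1_apply \<tau> i\<bar> * C" for i
    using assms[of i] by (simp add: mult_left_mono)
  have abs: "(\<lambda>i. norm (ell1_apply \<tau> i *\<^sub>R a i)) summable_on UNIV"
    by (rule summable_on_comparison_test[OF S]) (use le in auto)
  then show "(\<lambda>i. ell1_apply \<tau> i *\<^sub>R a i) summable_on UNIV"
    by (rule abs_summable_summable)
  have "norm (\<Sum>\<^sub>\<infinity>i. ell1_apply \<tau> i *\<^sub>R a i) \<le> (\<Sum>\<^sub>\<infinity>i. norm (ell1_apply \<tau> i *\<^sub>R a i))"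
    by (rule norm_infsum_bound[OF abs])
  also have "\<dots> \<le> (\<Sum>\<^sub>\<infinity>i. \<bar>ell1_apply \<tau> i\<bar> * C)"
    by (rule infsum_mono[OF abs S le])
  also have "\<dots> = norm \<tau> * C"
    unfolding norm_ell1.rep_eq by (rule infsum_cmult_left) (simp add: ell1_summable)
  finally show "norm (\<Sum>\<^sub>\<infinity>i. ell1_apply \<tau> i *\<^sub>R a i) \<le> norm \<tau> * C" .
qed

text \<open>The discrete topology on the indices asks for continuity in time only, separately for
  each step, while the sup norm is uniform over all steps. Completeness is inherited from the
  bounded continuous functions.\<close>

type_synonym ('i, 'e) path = "('i discrete \<times> real) \<Rightarrow>\<^sub>C 'e"

abbreviation pval :: "('i, 'e::metric_space) path \<Rightarrow> 'i \<Rightarrow> real \<Rightarrow> 'e" where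
  "pval w \<beta> \<sigma> \<equiv> apply_bcontfun w (discrete \<beta>, \<sigma>)"

lemma path_eqI: "(\<And>\<beta> \<sigma>. pval u \<beta> \<sigma> = pval v \<beta> \<sigma>) \<Longrightarrow> u = v"
  by (rule bcontfun_eqI) (metis discrete_cases surj_pair)

lemma continuous_on_discrete_times:
  assumes "\<And>\<beta>. continuous_on UNIV (\<lambda>\<sigma>. f (discrete \<beta>, \<sigma>))"
  shows "continuous_on (UNIV :: ('i discrete \<times> 'b::topological_space) set) f"
proof -
  have "continuous_on (\<Union>b\<in>UNIV. {b} \<times> UNIV) f"
  proof (rule continuous_on_open_UN)
    fix b :: "'i discrete"
    obtain \<beta> where b: "b = discrete \<beta>" by (cases b) auto
    have "continuous_on ({b} \<times> UNIV) (\<lambda>p. f (discrete \<beta>, snd p))"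
      by (rule continuous_on_compose2[OF assms]) (auto intro: continuous_intros)
    then show "continuous_on ({b} \<times> UNIV) f"
      by (rule continuous_on_eq) (auto simp: b)
    show "open ({b} \<times> (UNIV :: 'b set))" by (intro open_Times open_discrete open_UNIV)
  qed
  moreover have "(\<Union>b\<in>UNIV. {b} \<times> (UNIV :: 'b set)) = (UNIV :: ('i discrete \<times> 'b) set)" by auto
  ultimately show ?thesis by simp
qed

lemma bcontfun_discrete_timesI:
  fixes f :: "'i discrete \<times> 'b::topological_space \<Rightarrow> 'e::real_normed_vector"
  assumes "\<And>\<beta>. continuous_on UNIV (\<lambda>\<sigma>. f (discrete \<beta>, \<sigma>))" and "\<And>p. norm (f p) \<le> C"
  shows "apply_bcontfun (Bcontfun f) = f"
  by (rule Bcontfun_inverse, rule bcontfun_normI[OF continuous_on_discrete_times[OF assms(1)] assms(2)])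

text \<open>Paths are functions on the whole real line, as \<open>bcontfun\<close> demands. Clamping
  confines the integrals to the unit interval, and it commutes with
  \<open>\<sigma> \<mapsto> 1 - \<sigma>\<close>, on which the time reversal relies.\<close>

abbreviation clamp01 :: "real \<Rightarrow> real" where
  "clamp01 \<sigma> \<equiv> max 0 (min 1 \<sigma>)"

definition segment_integral :: "('i, 'e::banach) path \<Rightarrow> 'i \<Rightarrow> real \<Rightarrow> 'e" where
  "segment_integral w \<beta> \<sigma> = integral {0..clamp01 \<sigma>} (\<lambda>\<rho>. pval w \<beta> \<rho>)"

lemma continuous_on_pval [continuous_intros]: "continuous_on S (\<lambda>\<rho>. pval w \<beta> \<rho>)"
  by (rule continuous_on_compose2[OF continuous_on_apply_bcontfun[of UNIV w]])
    (auto intro: continuous_intros)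

lemma pval_integrable: "(\<lambda>\<rho>. pval (w :: ('i, 'e::banach) path) \<beta> \<rho>) integrable_on {a..b}"
  by (intro integrable_continuous_real continuous_intros)

lemma segment_integral_0 [simp]: "segment_integral w \<beta> 0 = 0"
  by (simp add: segment_integral_def)

lemma segment_integral_clamp [simp]:
  "segment_integral w \<beta> (clamp01 \<sigma>) = segment_integral w \<beta> \<sigma>"
  by (simp add: segment_integral_def)

lemma norm_segment_integral: "norm (segment_integral w \<beta> \<sigma>) \<le> norm w"
proof -
  have "norm (segment_integral w \<beta> \<sigma>) \<le> norm w * (clamp01 \<sigma> - 0)"
    unfolding segment_integral_def
    by (rule integral_bound) (auto intro: continuous_intros norm_bounded)
  also have "\<dots> \<le> norm w * 1" by (rule mult_left_mono) auto
  finally show ?thesis by simp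
qed

lemma segment_integral_add:
  "segment_integral (v + w) \<beta> \<sigma> = segment_integral v \<beta> \<sigma> + segment_integral w \<beta> \<sigma>"
  unfolding segment_integral_def by (simp add: integral_add pval_integrable)

lemma segment_integral_scaleR: "segment_integral (c *\<^sub>R w) \<beta> \<sigma> = c *\<^sub>R segment_integral w \<beta> \<sigma>"
  unfolding segment_integral_def by (simp add: integral_cmul)

lemma continuous_on_segment_integral: "continuous_on UNIV (segment_integral w \<beta>)"
proof -
  have "continuous_on {0..1} (\<lambda>x. integral {0..x} (\<lambda>\<rho>. pval w \<beta> \<rho>))"
    by (rule indefinite_integral_continuous_1[OF pval_integrable])
  then show ?thesis
    unfolding segment_integral_def[abs_def]
    by (rule continuous_on_compose2) (auto intro!: continuous_intros)
qed

text \<open>\<open>weighted_sum \<theta> \<tau> w\<close> adds up the contributions of all indices \<open>\<gamma>\<close>, of which only the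
  fraction \<open>\<theta> \<gamma>\<close> of the \<open>\<gamma>\<close>-th step has been performed.\<close>

definition weighted_sum :: "('i \<Rightarrow> real) \<Rightarrow> 'i ell1 \<Rightarrow> ('i, 'e::banach) path \<Rightarrow> 'e" where
  "weighted_sum \<theta> \<tau> w = (\<Sum>\<^sub>\<infinity>\<gamma>. ell1_apply \<tau> \<gamma> *\<^sub>R segment_integral w \<gamma> (\<theta> \<gamma>))"

lemma weighted_sum_summable:
  "(\<lambda>\<gamma>. ell1_apply \<tau> \<gamma> *\<^sub>R segment_integral w \<gamma> (\<theta> \<gamma>)) summable_on UNIV"
  by (rule ell1_bounded_summable[OF norm_segment_integral])

lemma norm_weighted_sum: "norm (weighted_sum \<theta> \<tau> w) \<le> norm \<tau> * norm w"
  unfolding weighted_sum_def by (rule norm_ell1_bounded_infsum[OF norm_segment_integral])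

lemma bounded_bilinear_weighted_sum: "bounded_bilinear (weighted_sum \<theta>)"
proof
  fix \<tau> \<tau>' :: "'a ell1" and w w' :: "('a, 'b) path" and r :: real
  show "weighted_sum \<theta> (\<tau> + \<tau>') w = weighted_sum \<theta> \<tau> w + weighted_sum \<theta> \<tau>' w"
    unfolding weighted_sum_def
    by (simp add: scaleR_add_left flip: infsum_add[OF weighted_sum_summable weighted_sum_summable])
  show "weighted_sum \<theta> \<tau> (w + w') = weighted_sum \<theta> \<tau> w + weighted_sum \<theta> \<tau> w'"
    unfolding weighted_sum_def
    by (simp add: segment_integral_add scaleR_add_right
        flip: infsum_add[OF weighted_sum_summable weighted_sum_summable])
  show "weighted_sum \<theta> (r *\<^sub>R \<tau>) w = r *\<^sub>R weighted_sum \<theta> \<tau> w"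
    unfolding weighted_sum_def by (simp flip: infsum_scaleR_right)
  show "weighted_sum \<theta> \<tau> (r *\<^sub>R w) = r *\<^sub>R weighted_sum \<theta> \<tau> w"
    unfolding weighted_sum_def
    by (simp add: segment_integral_scaleR mult.commute flip: infsum_scaleR_right)
  show "\<exists>K. \<forall>a b. norm (weighted_sum \<theta> a b :: 'b) \<le> norm a * norm b * K"
    by (intro exI[of _ 1]) (simp add: norm_weighted_sum)
qed

lemma infsum_single_index: "(\<Sum>\<^sub>\<infinity>\<gamma>. if \<gamma> = \<beta> then c else 0) = (c :: 'e::banach)"
  and summable_single_index: "(\<lambda>\<gamma>. if \<gamma> = \<beta> then c else 0) summable_on UNIV"
proof -
  have "((\<lambda>\<gamma>. if \<gamma> = \<beta> then c else 0) has_sum (\<Sum>\<gamma>\<in>{\<beta>}. if \<gamma> = \<beta> then c else 0)) UNIV"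
    by (rule has_sum_finite_neutralI[of "{\<beta>}"]) auto
  then show "(\<Sum>\<^sub>\<infinity>\<gamma>. if \<gamma> = \<beta> then c else 0) = c" "(\<lambda>\<gamma>. if \<gamma> = \<beta> then c else 0) summable_on UNIV"
    by (auto simp: infsumI summable_on_def)
qed

text \<open>The order is a parameter rather than the class order, because everything is instantiated
  a second time with the reversed order to obtain the inverse maps.\<close>

locale strict_total_order =
  fixes lt :: "'i \<Rightarrow> 'i \<Rightarrow> bool"
  assumes lt_irrefl: "\<not> lt a a"
    and lt_trans: "lt a b \<Longrightarrow> lt b c \<Longrightarrow> lt a c"
    and lt_total: "lt a b \<or> a = b \<or> lt b a"
begin

lemma finite_has_lt_max:
  assumes "finite F" "F \<noteq> {}"
  shows "\<exists>m\<in>F. \<forall>x\<in>F. x = m \<or> lt x m"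
  using assms
proof (induction F rule: finite_ne_induct)
  case (insert a F)
  then obtain m where m: "m \<in> F" "\<forall>x\<in>F. x = m \<or> lt x m" by blast
  show ?case
  proof (cases "lt m a")
    case True
    then show ?thesis using m(2) lt_trans[of _ m a] by (intro bexI[of _ a]) auto
  next
    case False
    then show ?thesis using m lt_total[of a m] by (intro bexI[of _ m]) auto
  qed
qed simp

definition reach :: "'i \<Rightarrow> real \<Rightarrow> 'i \<Rightarrow> real" where
  "reach \<beta> \<sigma> \<gamma> = (if lt \<gamma> \<beta> then 1 else if \<gamma> = \<beta> then clamp01 \<sigma> else 0)"

lemma weighted_sum_reach:
  "weighted_sum (reach \<beta> \<sigma>) \<tau> w = weighted_sum (reach \<beta> 0) \<tau> w + \<tau> \<beta> *\<^sub>R segment_integral w \<beta> \<sigma>"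
proof -
  have "weighted_sum (reach \<beta> \<sigma>) \<tau> w = (\<Sum>\<^sub>\<infinity>\<gamma>. \<tau> \<gamma> *\<^sub>R segment_integral w \<gamma> (reach \<beta> 0 \<gamma>) +
      (if \<gamma> = \<beta> then \<tau> \<beta> *\<^sub>R segment_integral w \<beta> \<sigma> else 0))"
    unfolding weighted_sum_def by (rule infsum_cong) (auto simp: reach_def lt_irrefl)
  also have "\<dots> = weighted_sum (reach \<beta> 0) \<tau> w + \<tau> \<beta> *\<^sub>R segment_integral w \<beta> \<sigma>"
    unfolding weighted_sum_def
    by (subst infsum_add[OF weighted_sum_summable summable_single_index])
      (simp only: infsum_single_index)
  finally show ?thesis .
qed

definition volterra :: "'i ell1 \<Rightarrow> ('i, 'e::banach) path \<Rightarrow> ('i, 'e) path" where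
  "volterra \<tau> w = Bcontfun (\<lambda>p. weighted_sum (reach (of_discrete (fst p)) (snd p)) \<tau> w)"

lemma volterra_apply: "pval (volterra \<tau> w) \<beta> \<sigma> = weighted_sum (reach \<beta> \<sigma>) \<tau> w"
proof -
  have "apply_bcontfun (volterra \<tau> w) = (\<lambda>p. weighted_sum (reach (of_discrete (fst p)) (snd p)) \<tau> w)"
    unfolding volterra_def
  proof (rule bcontfun_discrete_timesI)
    fix \<beta>
    have "continuous_on UNIV (\<lambda>\<sigma>. weighted_sum (reach \<beta> 0) \<tau> w + \<tau> \<beta> *\<^sub>R segment_integral w \<beta> \<sigma>)"
      by (intro continuous_intros continuous_on_segment_integral)
    then show "continuous_on UNIV (\<lambda>\<sigma>. weighted_sum (reach (of_discrete (fst (discrete \<beta>, \<sigma>)))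
        (snd (discrete \<beta>, \<sigma>))) \<tau> w)"
      by (simp add: discrete_inverse flip: weighted_sum_reach)
  qed (rule norm_weighted_sum)
  then show ?thesis by (simp add: discrete_inverse)
qed

lemma norm_volterra: "norm (volterra \<tau> w) \<le> norm \<tau> * norm w"
proof (rule norm_bound)
  fix p :: "'i discrete \<times> real"
  obtain \<beta> \<sigma> where "p = (discrete \<beta>, \<sigma>)" by (metis discrete_cases surj_pair)
  then show "norm (apply_bcontfun (volterra \<tau> w) p) \<le> norm \<tau> * norm w"
    by (simp add: volterra_apply norm_weighted_sum)
qed

lemma bounded_bilinear_volterra:
  "bounded_bilinear (volterra :: 'i ell1 \<Rightarrow> ('i, 'e::banach) path \<Rightarrow> ('i, 'e) path)"
proof
  interpret bounded_bilinear "weighted_sum \<theta> :: 'i ell1 \<Rightarrow> ('i, 'e) path \<Rightarrow> 'e" for \<theta>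
    by (rule bounded_bilinear_weighted_sum)
  fix \<tau> \<tau>' :: "'i ell1" and w w' :: "('i, 'e) path" and r :: real
  show "volterra (\<tau> + \<tau>') w = volterra \<tau> w + volterra \<tau>' w"
    by (rule path_eqI) (simp add: volterra_apply add_left)
  show "volterra \<tau> (w + w') = volterra \<tau> w + volterra \<tau> w'"
    by (rule path_eqI) (simp add: volterra_apply add_right)
  show "volterra (r *\<^sub>R \<tau>) w = r *\<^sub>R volterra \<tau> w"
    by (rule path_eqI) (simp add: volterra_apply scaleR_left)
  show "volterra \<tau> (r *\<^sub>R w) = r *\<^sub>R volterra \<tau> w"
    by (rule path_eqI) (simp add: volterra_apply scaleR_right)
  show "\<exists>K. \<forall>a b. norm (volterra a b :: ('i, 'e) path) \<le> norm a * norm b * K"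
    by (intro exI[of _ 1]) (simp add: norm_volterra)
qed

text \<open>With respect to the weight \<open>exp (l * elapsed \<tau> \<beta> \<sigma>)\<close> the Volterra operator has norm at most
  \<open>1 / l\<close>.\<close>

definition elapsed :: "'i ell1 \<Rightarrow> 'i \<Rightarrow> real \<Rightarrow> real" where
  "elapsed \<tau> \<beta> \<sigma> = (\<Sum>\<^sub>\<infinity>\<gamma>. \<bar>ell1_apply \<tau> \<gamma>\<bar> * reach \<beta> \<sigma> \<gamma>)"

lemma reach_bounds: "0 \<le> reach \<beta> \<sigma> \<gamma>" "reach \<beta> \<sigma> \<gamma> \<le> 1"
  by (auto simp: reach_def)

lemma elapsed_summable: "(\<lambda>\<gamma>. \<bar>ell1_apply \<tau> \<gamma>\<bar> * reach \<beta> \<sigma> \<gamma>) summable_on UNIV"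
  by (rule summable_on_comparison_test[OF ell1_summable[of \<tau>]])
    (auto simp: reach_bounds intro!: mult_left_le)

lemma elapsed_nonneg: "0 \<le> elapsed \<tau> \<beta> \<sigma>"
  unfolding elapsed_def by (rule infsum_nonneg) (simp add: reach_bounds)

lemma elapsed_le_norm: "elapsed \<tau> \<beta> \<sigma> \<le> norm \<tau>"
  unfolding elapsed_def norm_ell1.rep_eq
  by (rule infsum_mono[OF elapsed_summable ell1_summable]) (auto simp: reach_bounds intro!: mult_left_le)

lemma elapsed_eq: "elapsed \<tau> \<beta> \<sigma> = elapsed \<tau> \<beta> 0 + \<bar>\<tau> \<beta>\<bar> * clamp01 \<sigma>"
proof -
  have "elapsed \<tau> \<beta> \<sigma> = (\<Sum>\<^sub>\<infinity>\<gamma>. \<bar>\<tau> \<gamma>\<bar> * reach \<beta> 0 \<gamma> + (if \<gamma> = \<beta> then \<bar>\<tau> \<beta>\<bar> * clamp01 \<sigma> else 0))"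
    unfolding elapsed_def by (rule infsum_cong) (auto simp: reach_def lt_irrefl)
  also have "\<dots> = elapsed \<tau> \<beta> 0 + \<bar>\<tau> \<beta>\<bar> * clamp01 \<sigma>"
    unfolding elapsed_def
    by (subst infsum_add[OF elapsed_summable summable_single_index])
      (simp only: infsum_single_index)
  finally show ?thesis .
qed

lemma elapsed_mono:
  assumes "lt \<gamma> \<beta>"
  shows "elapsed \<tau> \<gamma> 1 \<le> elapsed \<tau> \<beta> 0"
  unfolding elapsed_def
proof (rule infsum_mono[OF elapsed_summable elapsed_summable])
  fix \<delta>
  have "reach \<gamma> 1 \<delta> \<le> reach \<beta> 0 \<delta>"
    using assms lt_trans[of \<delta> \<gamma> \<beta>] lt_irrefl by (auto simp: reach_def)
  then show "\<bar>\<tau> \<delta>\<bar> * reach \<gamma> 1 \<delta> \<le> \<bar>\<tau> \<delta>\<bar> * reach \<beta> 0 \<delta>"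
    by (simp add: mult_left_mono)
qed

text \<open>Along one step the weight grows at the rate
  \<open>l * \<bar>\<tau> \<gamma>\<bar>\<close>, so \<open>\<bar>\<tau> \<gamma>\<bar>\<close>
  times the weight has the weight divided by \<open>l\<close> as a primitive. The gain
  \<open>1 / l\<close> of the Volterra operator originates here.\<close>

lemma segment_integral_weighted:
  assumes bound: "\<And>\<rho>. norm (pval w \<gamma> \<rho>) \<le> c * exp (l * elapsed \<tau> \<gamma> \<rho>)" and "0 < l"
  shows "\<bar>\<tau> \<gamma>\<bar> * norm (segment_integral w \<gamma> \<sigma>) \<le>
    c / l * (exp (l * elapsed \<tau> \<gamma> \<sigma>) - exp (l * elapsed \<tau> \<gamma> 0))"
proof -
  let ?E = "\<lambda>\<rho>. exp (l * (elapsed \<tau> \<gamma> 0 + \<bar>\<tau> \<gamma>\<bar> * \<rho>))"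
  have "((\<lambda>\<rho>. \<bar>\<tau> \<gamma>\<bar> * c * ?E \<rho>) has_integral (c / l * ?E (clamp01 \<sigma>) - c / l * ?E 0)) {0..clamp01 \<sigma>}"
    by (rule fundamental_theorem_of_calculus)
      (use \<open>0 < l\<close> in \<open>auto intro!: derivative_eq_intros simp flip: has_real_derivative_iff_has_vector_derivative\<close>)
  then have I: "(\<lambda>\<rho>. \<bar>\<tau> \<gamma>\<bar> * c * ?E \<rho>) integrable_on {0..clamp01 \<sigma>}"
    "integral {0..clamp01 \<sigma>} (\<lambda>\<rho>. \<bar>\<tau> \<gamma>\<bar> * c * ?E \<rho>) = c / l * ?E (clamp01 \<sigma>) - c / l * ?E 0"
    by (rule has_integral_integrable, rule integral_unique)
  have "\<bar>\<tau> \<gamma>\<bar> * norm (segment_integral w \<gamma> \<sigma>) =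
      norm (integral {0..clamp01 \<sigma>} (\<lambda>\<rho>. \<bar>\<tau> \<gamma>\<bar> *\<^sub>R pval w \<gamma> \<rho>))"
    by (simp add: segment_integral_def)
  also have "\<dots> \<le> integral {0..clamp01 \<sigma>} (\<lambda>\<rho>. \<bar>\<tau> \<gamma>\<bar> * c * ?E \<rho>)"
  proof (rule integral_norm_bound_integral[OF _ I(1)])
    show "(\<lambda>\<rho>. \<bar>\<tau> \<gamma>\<bar> *\<^sub>R pval w \<gamma> \<rho>) integrable_on {0..clamp01 \<sigma>}"
      by (intro integrable_cmul pval_integrable)
    show "norm (\<bar>\<tau> \<gamma>\<bar> *\<^sub>R pval w \<gamma> \<rho>) \<le> \<bar>\<tau> \<gamma>\<bar> * c * ?E \<rho>" if "\<rho> \<in> {0..clamp01 \<sigma>}" for \<rho>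
    proof -
      have "clamp01 \<rho> = \<rho>" using that by auto
      then show ?thesis
        using mult_left_mono[OF bound[of \<rho>] abs_ge_zero[of "\<tau> \<gamma>"]]
        by (simp add: elapsed_eq[of \<tau> \<gamma> \<rho>] mult.assoc)
    qed
  qed
  also have "\<dots> = c / l * (exp (l * elapsed \<tau> \<gamma> \<sigma>) - exp (l * elapsed \<tau> \<gamma> 0))"
    unfolding I(2) elapsed_eq[of \<tau> \<gamma> \<sigma>] by (simp add: algebra_simps)
  finally show ?thesis .
qed

text \<open>The intervals from \<open>elapsed \<tau> \<gamma> 0\<close> to
  \<open>elapsed \<tau> \<gamma> 1\<close> do not overlap and lie between 0 and
  \<open>elapsed \<tau> \<beta> 0\<close>, so the increments of the increasing function
  \<open>exp\<close> over them add up to at most the total increment. The induction splits off the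
  largest index.\<close>

lemma sum_increments_le:
  assumes "finite F" "\<And>\<gamma>. \<gamma> \<in> F \<Longrightarrow> lt \<gamma> \<beta>" "0 \<le> l"
  shows "(\<Sum>\<gamma>\<in>F. exp (l * elapsed \<tau> \<gamma> 1) - exp (l * elapsed \<tau> \<gamma> 0)) \<le> exp (l * elapsed \<tau> \<beta> 0) - 1"
  using assms(1,2)
proof (induction "card F" arbitrary: F \<beta>)
  case 0
  then show ?case using \<open>0 \<le> l\<close> by (simp add: elapsed_nonneg)
next
  case (Suc n)
  then have "F \<noteq> {}" by auto
  then obtain m where m: "m \<in> F" "\<forall>x\<in>F. x = m \<or> lt x m"
    using finite_has_lt_max Suc.prems(1) by blast
  have "(\<Sum>\<gamma>\<in>F - {m}. exp (l * elapsed \<tau> \<gamma> 1) - exp (l * elapsed \<tau> \<gamma> 0)) \<le> exp (l * elapsed \<tau> m 0) - 1"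
    by (rule Suc.hyps(1)) (use Suc.hyps(2) Suc.prems(1) m in auto)
  moreover have "exp (l * elapsed \<tau> m 1) \<le> exp (l * elapsed \<tau> \<beta> 0)"
    using elapsed_mono[OF Suc.prems(2)[OF m(1)]] \<open>0 \<le> l\<close> by (simp add: mult_left_mono)
  ultimately show ?case
    unfolding sum.remove[OF Suc.prems(1) m(1)] by linarith
qed

text \<open>Each summand is at most \<open>c / l\<close> times an increment of the weight. Below
  \<open>\<beta>\<close> the increments telescope to a bound at the start of the step, and the one
  at \<open>\<beta>\<close> leads on to \<open>\<sigma>\<close>. Only finite partial sums are
  compared, so that an infinite order is never traversed.\<close>

lemma volterra_weighted:
  assumes bound: "\<And>\<beta> \<sigma>. norm (pval w \<beta> \<sigma>) \<le> c * exp (l * elapsed \<tau> \<beta> \<sigma>)" and "0 < l" "0 \<le> c"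
  shows "norm (pval (volterra \<tau> w) \<beta> \<sigma>) \<le> c / l * exp (l * elapsed \<tau> \<beta> \<sigma>)"
proof -
  let ?a = "\<lambda>\<gamma>. norm (\<tau> \<gamma> *\<^sub>R segment_integral w \<gamma> (reach \<beta> \<sigma> \<gamma>))"
  have le: "?a \<gamma> \<le> c / l * (exp (l * elapsed \<tau> \<gamma> (reach \<beta> \<sigma> \<gamma>)) - exp (l * elapsed \<tau> \<gamma> 0))" for \<gamma>
    using segment_integral_weighted[where w = w and \<gamma> = \<gamma>, OF bound \<open>0 < l\<close>] by simp
  have S: "?a summable_on UNIV"
  proof (rule summable_on_comparison_test)
    show "(\<lambda>i. \<bar>\<tau> i\<bar> * norm w) summable_on UNIV"
      by (rule summable_on_cmult_left) (rule ell1_summable)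
  qed (auto intro: mult_left_mono norm_segment_integral)
  have "norm (pval (volterra \<tau> w) \<beta> \<sigma>) \<le> infsum ?a UNIV"
    unfolding volterra_apply weighted_sum_def by (rule norm_infsum_bound[OF S])
  also have "\<dots> \<le> c / l * exp (l * elapsed \<tau> \<beta> \<sigma>)"
  proof (rule infsum_le_finite_sums[OF S])
    fix F :: "'i set" assume F: "finite F"
    let ?b = "\<lambda>\<gamma>. exp (l * elapsed \<tau> \<gamma> (reach \<beta> \<sigma> \<gamma>)) - exp (l * elapsed \<tau> \<gamma> 0)"
    let ?F = "{\<gamma>\<in>F. lt \<gamma> \<beta>}"
    have b0: "0 \<le> ?b \<beta>"
      unfolding elapsed_eq[of \<tau> \<beta> "reach \<beta> \<sigma> \<beta>"] using \<open>0 < l\<close> by simp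
    \<comment> \<open>Above \<open>\<beta>\<close> the value of \<open>reach\<close> is 0 and the
      increment vanishes. The index \<open>\<beta>\<close> may be missing in \<open>F\<close>; its
      increment is nonnegative and is added in the next estimate.\<close>
    have "sum ?b F = sum ?b (insert \<beta> ?F \<inter> F)"
      by (rule sum.mono_neutral_right) (use F in \<open>auto simp: reach_def\<close>)
    also have "\<dots> \<le> sum ?b (insert \<beta> ?F)"
      by (rule sum_mono2) (use F b0 in auto)
    also have "\<dots> = ?b \<beta> + sum ?b ?F"
      using F lt_irrefl by (subst sum.insert) auto
    finally have "sum ?b F \<le> ?b \<beta> + sum ?b ?F" .
    moreover have "sum ?b ?F = (\<Sum>\<gamma>\<in>?F. exp (l * elapsed \<tau> \<gamma> 1) - exp (l * elapsed \<tau> \<gamma> 0))"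
      by (rule sum.cong) (auto simp: reach_def)
    moreover have "\<dots> \<le> exp (l * elapsed \<tau> \<beta> 0) - 1"
      by (rule sum_increments_le) (use F \<open>0 < l\<close> in auto)
    moreover have "exp (l * elapsed \<tau> \<beta> (reach \<beta> \<sigma> \<beta>)) = exp (l * elapsed \<tau> \<beta> \<sigma>)"
      unfolding elapsed_eq[of \<tau> \<beta> "reach \<beta> \<sigma> \<beta>"] elapsed_eq[of \<tau> \<beta> \<sigma>]
      by (simp add: reach_def lt_irrefl)
    ultimately have "sum ?b F \<le> exp (l * elapsed \<tau> \<beta> \<sigma>)" by linarith
    moreover have "sum ?a F \<le> c / l * sum ?b F"
      unfolding sum_distrib_left by (rule sum_mono) (rule le)
    moreover have "0 \<le> c / l" using \<open>0 < l\<close> \<open>0 \<le> c\<close> by simp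
    ultimately show "sum ?a F \<le> c / l * exp (l * elapsed \<tau> \<beta> \<sigma>)"
      using mult_left_mono order_trans by blast
  qed
  finally show ?thesis .
qed

text \<open>The rate \<open>2 * k\<close> of the weight cancels the Lipschitz constant
  \<open>k\<close> and leaves the factor \<open>1 / 2\<close>. The hypotheses are pointwise because
  the weight varies from point to point.\<close>

lemma volterra_lipschitz_weighted:
  assumes "\<And>\<beta> \<sigma>. norm (pval v \<beta> \<sigma> - pval w \<beta> \<sigma>) \<le> k * norm (pval v' \<beta> \<sigma> - pval w' \<beta> \<sigma>)"
    and "\<And>\<beta> \<sigma>. norm (pval v' \<beta> \<sigma> - pval w' \<beta> \<sigma>) \<le> c * exp (2 * k * elapsed \<tau> \<beta> \<sigma>)"
    and "0 < k" "0 \<le> c"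
  shows "norm (pval (volterra \<tau> v) \<beta> \<sigma> - pval (volterra \<tau> w) \<beta> \<sigma>) \<le> c / 2 * exp (2 * k * elapsed \<tau> \<beta> \<sigma>)"
proof -
  have "norm (pval (volterra \<tau> (v - w)) \<beta> \<sigma>) \<le> (k * c) / (2 * k) * exp (2 * k * elapsed \<tau> \<beta> \<sigma>)"
  proof (rule volterra_weighted)
    show "norm (pval (v - w) \<beta> \<sigma>) \<le> k * c * exp (2 * k * elapsed \<tau> \<beta> \<sigma>)" for \<beta> \<sigma>
      using order_trans[OF assms(1) mult_left_mono[OF assms(2) less_imp_le[OF \<open>0 < k\<close>]]]
      by (simp add: mult.assoc)
  qed (use \<open>0 < k\<close> \<open>0 \<le> c\<close> in simp_all)
  then show ?thesis
    using \<open>0 < k\<close> by (simp add: bounded_bilinear.diff_right[OF bounded_bilinear_volterra])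
qed

section \<open>Solvability and stability of the Volterra equation\<close>

text \<open>One iteration halves the weighted distance but need not shrink the sup norm. Both are
  comparable, so some iterate is a contraction for the sup norm, in which the space is complete, and
  its fixed point is also one of the map itself.\<close>

lemma volterra_fixed_point:
  fixes N :: "('i, 'e::banach) path \<Rightarrow> ('i, 'e) path"
  assumes "closed Z" "Z \<noteq> {}" "0 < k"
    and lip: "\<And>u v \<beta> \<sigma>. u \<in> Z \<Longrightarrow> v \<in> Z \<Longrightarrow>
      norm (pval (N u) \<beta> \<sigma> - pval (N v) \<beta> \<sigma>) \<le> k * norm (pval u \<beta> \<sigma> - pval v \<beta> \<sigma>)"
    and self: "\<And>u. u \<in> Z \<Longrightarrow> f + volterra \<tau> (N u) \<in> Z"
  shows "\<exists>u\<in>Z. u = f + volterra \<tau> (N u)"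
proof -
  define F where "F u = f + volterra \<tau> (N u)" for u
  have Z: "(F ^^ n) u \<in> Z" if "u \<in> Z" for n u
    using that self by (induction n) (auto simp: F_def)
  have le: "norm (pval ((F ^^ n) u) \<beta> \<sigma> - pval ((F ^^ n) v) \<beta> \<sigma>) \<le>
      (1/2) ^ n * norm (u - v) * exp (2 * k * elapsed \<tau> \<beta> \<sigma>)"
    if uv: "u \<in> Z" "v \<in> Z" for n u v \<beta> \<sigma>
  proof (induction n arbitrary: \<beta> \<sigma>)
    case 0
    have "norm (pval u \<beta> \<sigma> - pval v \<beta> \<sigma>) \<le> norm (u - v) * 1"
      using norm_bounded[of "u - v"] by simp
    also have "\<dots> \<le> norm (u - v) * exp (2 * k * elapsed \<tau> \<beta> \<sigma>)"
      by (rule mult_left_mono) (use \<open>0 < k\<close> elapsed_nonneg in auto)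
    finally show ?case by simp
  next
    case (Suc n)
    have "norm (pval (volterra \<tau> (N ((F ^^ n) u))) \<beta> \<sigma> - pval (volterra \<tau> (N ((F ^^ n) v))) \<beta> \<sigma>) \<le>
      ((1/2) ^ n * norm (u - v)) / 2 * exp (2 * k * elapsed \<tau> \<beta> \<sigma>)"
      by (rule volterra_lipschitz_weighted[OF lip[OF Z[OF uv(1)] Z[OF uv(2)]] Suc.IH])
        (use \<open>0 < k\<close> in auto)
    moreover have "(F ^^ Suc n) z = f + volterra \<tau> (N ((F ^^ n) z))" for z
      by (simp add: F_def)
    ultimately show ?case by simp
  qed
  \<comment> \<open>The weight lies between 1 and \<open>exp (2 * k * norm \<tau>)\<close>. Enough
    halvings beat this ratio with a further factor 2 to spare.\<close>
  obtain n where n: "(1/2) ^ n < 1 / (2 * exp (2 * k * norm \<tau>))"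
    using real_arch_pow_inv[of "1 / (2 * exp (2 * k * norm \<tau>))" "1/2"] by auto
  have "\<exists>!u\<in>Z. (F ^^ n) u = u"
  proof (rule Banach_fix)
    show "complete Z" using \<open>closed Z\<close> by (simp add: complete_eq_closed)
    show "(F ^^ n) ` Z \<subseteq> Z" using Z by blast
    show "dist ((F ^^ n) u) ((F ^^ n) v) \<le> 1/2 * dist u v" if uv: "u \<in> Z" "v \<in> Z" for u v
      unfolding dist_norm
    proof (rule norm_bound)
      fix p :: "'i discrete \<times> real"
      obtain \<beta> \<sigma> where p: "p = (discrete \<beta>, \<sigma>)" by (metis discrete_cases surj_pair)
      have "exp (2 * k * elapsed \<tau> \<beta> \<sigma>) \<le> exp (2 * k * norm \<tau>)"
        using \<open>0 < k\<close> elapsed_le_norm by simp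
      then have "(1/2) ^ n * exp (2 * k * elapsed \<tau> \<beta> \<sigma>) \<le> (1/2) ^ n * exp (2 * k * norm \<tau>)"
        by (intro mult_left_mono) auto
      also have "\<dots> \<le> 1/2" using n by (simp add: field_simps)
      finally have "norm (u - v) * ((1/2) ^ n * exp (2 * k * elapsed \<tau> \<beta> \<sigma>)) \<le> norm (u - v) * (1/2)"
        by (rule mult_left_mono) simp
      then show "norm (apply_bcontfun ((F ^^ n) u - (F ^^ n) v) p) \<le> 1/2 * norm (u - v)"
        using le[OF uv, of n \<beta> \<sigma>] by (simp add: p mult_ac)
    qed
  qed (use \<open>Z \<noteq> {}\<close> in auto)
  then obtain u where u: "u \<in> Z" "(F ^^ n) u = u" "\<And>v. v \<in> Z \<Longrightarrow> (F ^^ n) v = v \<Longrightarrow> v = u"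
    by blast
  \<comment> \<open>\<open>F\<close> commutes with its powers, so \<open>F u\<close> is another
    fixed point of the iterate in \<open>Z\<close>.\<close>
  have "F u = u"
    by (rule u(3)) (use u(1,2) Z[OF u(1), of 1] in \<open>simp_all add: funpow_swap1[symmetric]\<close>)
  then show ?thesis using u(1) unfolding F_def by metis
qed

text \<open>An estimate of Gronwall type: a bound \<open>c\<close> on the weighted distance improves
  to \<open>norm (f - g) + c / 2\<close>, and iteration drives it to the fixed value
  \<open>2 * norm (f - g)\<close>. For \<open>f = g\<close> this is uniqueness among solutions
  related by the Lipschitz condition.\<close>

lemma volterra_stability:
  fixes N :: "('i, 'e::banach) path \<Rightarrow> ('i, 'e) path"
  assumes u: "u = f + volterra \<tau> (N u)" and v: "v = g + volterra \<tau> (N v)" and "0 < k"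
    and lip: "\<And>\<beta> \<sigma>. norm (pval (N u) \<beta> \<sigma> - pval (N v) \<beta> \<sigma>) \<le> k * norm (pval u \<beta> \<sigma> - pval v \<beta> \<sigma>)"
  shows "norm (u - v) \<le> 2 * exp (2 * k * norm \<tau>) * norm (f - g)"
proof (rule norm_bound)
  fix p :: "'i discrete \<times> real"
  obtain \<beta> \<sigma> where p: "p = (discrete \<beta>, \<sigma>)" by (metis discrete_cases surj_pair)
  have E: "1 \<le> exp (2 * k * elapsed \<tau> \<beta> \<sigma>)" for \<beta> \<sigma>
    using \<open>0 < k\<close> elapsed_nonneg by simp
  have *: "norm (pval u \<beta> \<sigma> - pval v \<beta> \<sigma>) \<le>
      (2 * norm (f - g) + (1/2) ^ n * norm (u - v)) * exp (2 * k * elapsed \<tau> \<beta> \<sigma>)" for n \<beta> \<sigma>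
  proof (induction n arbitrary: \<beta> \<sigma>)
    case 0
    have "norm (pval u \<beta> \<sigma> - pval v \<beta> \<sigma>) \<le> norm (u - v)"
      using norm_bounded[of "u - v"] by simp
    also have "\<dots> \<le> (2 * norm (f - g) + norm (u - v)) * 1" by simp
    also have "\<dots> \<le> (2 * norm (f - g) + norm (u - v)) * exp (2 * k * elapsed \<tau> \<beta> \<sigma>)"
      using E by (intro mult_left_mono) auto
    finally show ?case by simp
  next
    case (Suc n)
    let ?c = "2 * norm (f - g) + (1/2) ^ n * norm (u - v)"
    have "pval u \<beta> \<sigma> - pval v \<beta> \<sigma> =
        pval (f - g) \<beta> \<sigma> + (pval (volterra \<tau> (N u)) \<beta> \<sigma> - pval (volterra \<tau> (N v)) \<beta> \<sigma>)"
      by (subst (1) u, subst (1) v) simp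
    also have "norm \<dots> \<le> norm (f - g) + ?c / 2 * exp (2 * k * elapsed \<tau> \<beta> \<sigma>)"
      by (intro norm_triangle_le add_mono norm_bounded volterra_lipschitz_weighted[OF lip Suc.IH])
        (use \<open>0 < k\<close> in auto)
    also have "\<dots> \<le> norm (f - g) * exp (2 * k * elapsed \<tau> \<beta> \<sigma>) + ?c / 2 * exp (2 * k * elapsed \<tau> \<beta> \<sigma>)"
      using mult_left_mono[OF E[of \<beta> \<sigma>], of "norm (f - g)"] by simp
    also have "\<dots> = (2 * norm (f - g) + (1/2) ^ Suc n * norm (u - v)) * exp (2 * k * elapsed \<tau> \<beta> \<sigma>)"
      by (simp add: algebra_simps)
    finally show ?case .
  qed
  have "(\<lambda>n. (2 * norm (f - g) + (1/2) ^ n * norm (u - v)) * exp (2 * k * elapsed \<tau> \<beta> \<sigma>))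
      \<longlonglongrightarrow> (2 * norm (f - g) + 0 * norm (u - v)) * exp (2 * k * elapsed \<tau> \<beta> \<sigma>)"
    by (intro tendsto_intros LIMSEQ_power_zero) auto
  then have "norm (pval u \<beta> \<sigma> - pval v \<beta> \<sigma>) \<le>
      (2 * norm (f - g) + 0 * norm (u - v)) * exp (2 * k * elapsed \<tau> \<beta> \<sigma>)"
    by (rule LIMSEQ_le_const) (use * in blast)
  also have "\<dots> \<le> (2 * norm (f - g)) * exp (2 * k * norm \<tau>)"
    using \<open>0 < k\<close> elapsed_le_norm by (simp add: mult_left_mono)
  finally show "norm (apply_bcontfun (u - v) p) \<le> 2 * exp (2 * k * norm \<tau>) * norm (f - g)"
    by (simp add: p mult_ac)
qed

text \<open>The linearized equation is solvable whatever the size of \<open>k * norm \<tau>\<close>: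
  the fixed point theorem provides solutions, and stability makes them unique, linear in
  \<open>f\<close> and bounded.\<close>

lemma volterra_invertible:
  fixes A :: "('i, 'e::banach) path \<Rightarrow>\<^sub>L ('i, 'e) path"
  assumes "0 < k" and A: "\<And>w \<beta> \<sigma>. norm (pval (A w) \<beta> \<sigma>) \<le> k * norm (pval w \<beta> \<sigma>)"
  obtains B :: "('i, 'e) path \<Rightarrow>\<^sub>L ('i, 'e) path"
  where "\<And>f. B f - volterra \<tau> (A (B f)) = f" "\<And>w. B (w - volterra \<tau> (A w)) = w"
proof -
  interpret V: bounded_bilinear "volterra :: 'i ell1 \<Rightarrow> ('i, 'e) path \<Rightarrow> ('i, 'e) path"
    by (rule bounded_bilinear_volterra)
  have lip: "norm (pval (A u) \<beta> \<sigma> - pval (A v) \<beta> \<sigma>) \<le> k * norm (pval u \<beta> \<sigma> - pval v \<beta> \<sigma>)" for u v \<beta> \<sigma>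
    using A[of "u - v" \<beta> \<sigma>] by (simp add: blinfun.diff_right)
  have "\<exists>u\<in>UNIV. u = f + volterra \<tau> (A u)" for f
    by (rule volterra_fixed_point[OF _ _ \<open>0 < k\<close> lip]) auto
  then obtain b where b: "\<And>f. b f = f + volterra \<tau> (A (b f))" by metis
  have uniq: "b f = u" if "u = f + volterra \<tau> (A u)" for f u
    using volterra_stability[where N = "blinfun_apply A", OF b[of f] that \<open>0 < k\<close> lip] by simp
  have bl: "bounded_linear b"
  proof (rule bounded_linear_intro)
    show "b (f + g) = b f + b g" for f g
      by (rule uniq, subst (1) b, subst (1) b) (simp add: blinfun.add_right V.add_right)
    show "b (r *\<^sub>R f) = r *\<^sub>R b f" for r f
      by (rule uniq, subst (1) b) (simp add: blinfun.scaleR_right V.scaleR_right scaleR_add_right)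
    have "(0 :: ('i, 'e) path) = 0 + volterra \<tau> (A 0)" by (simp add: V.zero_right)
    from volterra_stability[where N = "blinfun_apply A", OF b this \<open>0 < k\<close> lip]
    show "norm (b f) \<le> norm f * (2 * exp (2 * k * norm \<tau>))" for f
      by (simp add: mult_ac)
  qed
  show thesis
  proof
    show "blinfun_apply (Blinfun b) f - volterra \<tau> (A (blinfun_apply (Blinfun b) f)) = f" for f
      unfolding bounded_linear_Blinfun_apply[OF bl] by (subst (1) b) simp
    show "blinfun_apply (Blinfun b) (w - volterra \<tau> (A w)) = w" for w
      unfolding bounded_linear_Blinfun_apply[OF bl] by (rule uniq) simp
  qed
qed

end


subsection \<open>Composition operators on spaces of paths\<close>

lemma bounded_linear_apply_path: "bounded_linear (\<lambda>u. apply_bcontfun u p)"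
  by (rule bounded_linear_intro[of _ 1]) (auto simp: norm_bounded)

definition pmap :: "('b::real_normed_vector \<Rightarrow> 'c::real_normed_vector) \<Rightarrow> ('i, 'b) path \<Rightarrow> ('i, 'c) path" where
  "pmap A u = Bcontfun (\<lambda>p. A (apply_bcontfun u p))"

lemma pmap_apply:
  assumes "bounded_linear A"
  shows "apply_bcontfun (pmap A u) p = A (apply_bcontfun u p)"
proof -
  obtain K where K: "\<And>x. norm (A x) \<le> norm x * K" "0 \<le> K"
    using bounded_linear.nonneg_bounded[OF assms] by blast
  have "apply_bcontfun (Bcontfun (\<lambda>p. A (apply_bcontfun u p))) = (\<lambda>p. A (apply_bcontfun u p))"
  proof (rule bcontfun_discrete_timesI)
    show "norm (A (apply_bcontfun u p)) \<le> norm u * K" for p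
      by (rule order_trans[OF K(1)]) (intro mult_right_mono norm_bounded K(2))
  qed (intro bounded_linear.continuous_on[OF assms] continuous_on_pval)
  then show ?thesis by (simp add: pmap_def)
qed

lemma bounded_linear_pmap:
  fixes A :: "'b::real_normed_vector \<Rightarrow> 'c::real_normed_vector"
  assumes "bounded_linear A"
  shows "bounded_linear (pmap A :: ('i, 'b) path \<Rightarrow> ('i, 'c) path)"
proof -
  obtain K where K: "\<And>x. norm (A x) \<le> norm x * K" "0 \<le> K"
    using bounded_linear.nonneg_bounded[OF assms] by blast
  show ?thesis
  proof (rule bounded_linear_intro)
    show "pmap A (u + v) = pmap A u + pmap A v" for u v :: "('i, 'b) path"
      by (rule bcontfun_eqI) (simp add: pmap_apply[OF assms] linear_simps[OF assms])
    show "pmap A (c *\<^sub>R u) = c *\<^sub>R pmap A u" for c and u :: "('i, 'b) path"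
      by (rule bcontfun_eqI) (simp add: pmap_apply[OF assms] linear_simps[OF assms])
    show "norm (pmap A u) \<le> norm u * K" for u :: "('i, 'b) path"
      by (rule norm_bound, unfold pmap_apply[OF assms], rule order_trans[OF K(1)])
        (intro mult_right_mono norm_bounded K(2))
  qed
qed

text \<open>With \<open>T = jet_path (Suc m) u\<close>, defined below, this is the derivative of
  \<open>jet_path m\<close> at \<open>u\<close> in the direction \<open>h\<close>.\<close>

definition pcontract :: "('i, ('a::real_normed_vector, 'b::real_normed_vector) multilin) path \<Rightarrow>
    ('i, 'a) path \<Rightarrow> ('i, ('a, 'b) multilin) path" where
  "pcontract T h = Bcontfun (\<lambda>p. mcurry (apply_bcontfun T p) (apply_bcontfun h p))"

lemma norm_mcurry_apply: "norm (mcurry T v) \<le> norm T * norm v"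
  by (rule order_trans[OF norm_blinfun]) (intro mult_right_mono norm_mcurry norm_ge_zero)

lemma pcontract_apply:
  "apply_bcontfun (pcontract T h) p = mcurry (apply_bcontfun T p) (apply_bcontfun h p)"
proof -
  have "apply_bcontfun (Bcontfun (\<lambda>p. mcurry (apply_bcontfun T p) (apply_bcontfun h p))) =
      (\<lambda>p. mcurry (apply_bcontfun T p) (apply_bcontfun h p))"
  proof (rule bcontfun_discrete_timesI)
    show "norm (mcurry (apply_bcontfun T p) (apply_bcontfun h p)) \<le> norm T * norm h" for p
      by (rule order_trans[OF norm_mcurry_apply]) (intro mult_mono norm_bounded norm_ge_zero)
  qed (intro bounded_bilinear.continuous_on[OF bounded_bilinear_blinfun_apply] bounded_linear.continuous_on[OF bounded_linear_mcurry]
      continuous_on_pval)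
  then show ?thesis by (simp add: pcontract_def)
qed

lemma bounded_bilinear_pcontract:
  "bounded_bilinear (pcontract :: ('i, ('a::real_normed_vector, 'b::real_normed_vector) multilin) path \<Rightarrow> _)"
proof
  show "\<exists>K. \<forall>(a :: ('i, ('a, 'b) multilin) path) b. norm (pcontract a b) \<le> norm a * norm b * K"
  proof (intro exI[of _ 1] allI)
    fix a :: "('i, ('a, 'b) multilin) path" and b :: "('i, 'a) path"
    have "norm (pcontract a b) \<le> norm a * norm b"
      by (rule norm_bound, unfold pcontract_apply, rule order_trans[OF norm_mcurry_apply])
        (intro mult_mono norm_bounded norm_ge_zero)
    then show "norm (pcontract a b) \<le> norm a * norm b * 1" by simp
  qed
qed (auto intro!: bcontfun_eqI simp: pcontract_apply linear_simps[OF bounded_linear_mcurry]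
    blinfun.bilinear_simps)

lemma norm_multilin_apply_Nil: "norm (multilin_apply T []) \<le> norm T"
  using multilin_apply_le[of T "[]"] by simp

lemma ball_subset_ball_triangle: "dist x y + e \<le> d \<Longrightarrow> ball x e \<subseteq> ball y d"
proof
  fix z assume "dist x y + e \<le> d" "z \<in> ball x e"
  then show "z \<in> ball y d" using dist_triangle[of y z x] by (simp add: dist_commute)
qed

text \<open>The bound on the derivative of order \<open>m + 1\<close> serves as a Lipschitz constant
  for order \<open>m\<close> on convex subsets of \<open>V\<close>, uniformly in the index. This
  covers the orders up to \<open>s + 1\<close>.\<close>

locale bounded_family =
  fixes X :: "'i \<Rightarrow> 'e::banach \<Rightarrow> 'e" and V :: "'e set" and k :: real and s :: nat
  assumes open_V: "open V" and k_pos: "0 < k"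
    and smooth: "\<And>\<alpha>. Ck_on (s + 2) (X \<alpha>) V"
    and bound: "\<And>\<alpha> m y. y \<in> V \<Longrightarrow> m \<le> s + 2 \<Longrightarrow> norm (nth_deriv m (X \<alpha>) y) \<le> k"
begin

lemma nth_deriv_lipschitz:
  assumes "convex S" "S \<subseteq> V" "m \<le> s + 1" "a \<in> S" "b \<in> S"
  shows "norm (nth_deriv m (X \<alpha>) a - nth_deriv m (X \<alpha>) b) \<le> k * norm (a - b)"
proof (rule differentiable_bound[OF assms(1) _ _ assms(4,5)])
  fix y assume y: "y \<in> S"
  show "(nth_deriv m (X \<alpha>) has_derivative blinfun_apply (mcurry (nth_deriv (Suc m) (X \<alpha>) y))) (at y within S)"
    by (rule has_derivative_at_withinI, rule Ck_onD(2)[OF smooth]) (use assms y in auto)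
  show "onorm (blinfun_apply (mcurry (nth_deriv (Suc m) (X \<alpha>) y))) \<le> k"
    using order_trans[OF norm_mcurry bound[of y "Suc m" \<alpha>]] assms y
    by (auto simp: norm_blinfun.rep_eq)
qed

text \<open>The derivative of order \<open>m + 1\<close> is Lipschitz by the bound of order
  \<open>m + 2\<close>, which makes the remainder quadratic with the same constant for all indices
  and base points. Hence the restriction to \<open>m \<le> s\<close>.\<close>

lemma nth_deriv_taylor:
  assumes "convex S" "S \<subseteq> V" "m \<le> s" "a \<in> S" "b \<in> S"
  shows "norm (nth_deriv m (X \<alpha>) b - nth_deriv m (X \<alpha>) a - mcurry (nth_deriv (Suc m) (X \<alpha>) a) (b - a))
    \<le> norm (b - a) * (k * norm (b - a))"
proof (rule differentiable_bound_linearization[where S = "closed_segment a b"])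
  have seg: "closed_segment a b \<subseteq> S"
    using assms by (simp add: closed_segment_subset)
  fix y assume y: "y \<in> closed_segment a b"
  show "(nth_deriv m (X \<alpha>) has_derivative blinfun_apply (mcurry (nth_deriv (Suc m) (X \<alpha>) y)))
      (at y within closed_segment a b)"
    by (rule has_derivative_at_withinI, rule Ck_onD(2)[OF smooth]) (use assms seg y in auto)
  let ?D = "mcurry (nth_deriv (Suc m) (X \<alpha>) y) - mcurry (nth_deriv (Suc m) (X \<alpha>) a)"
  have "norm ?D \<le> norm (nth_deriv (Suc m) (X \<alpha>) y - nth_deriv (Suc m) (X \<alpha>) a)"
    using norm_mcurry by (metis linear_simps(2)[OF bounded_linear_mcurry])
  also have "\<dots> \<le> k * norm (y - a)"
    by (rule nth_deriv_lipschitz) (use assms seg y in auto)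
  also have "\<dots> \<le> k * norm (b - a)"
    using segment_bound(1)[OF y] k_pos by simp
  finally have "norm ?D \<le> k * norm (b - a)" .
  moreover have "blinfun_apply (mcurry (nth_deriv (Suc m) (X \<alpha>) y)) -
      blinfun_apply (mcurry (nth_deriv (Suc m) (X \<alpha>) a)) = blinfun_apply ?D"
    by (simp add: fun_eq_iff blinfun.diff_left)
  ultimately show "onorm (blinfun_apply (mcurry (nth_deriv (Suc m) (X \<alpha>) y)) -
      blinfun_apply (mcurry (nth_deriv (Suc m) (X \<alpha>) a))) \<le> k * norm (b - a)"
    by (simp add: norm_blinfun.rep_eq)
next
  show "a + t *\<^sub>R (b - a) \<in> closed_segment a b" if "t \<in> {0..1}" for t
    using that by (auto simp: in_segment algebra_simps intro!: exI[of _ t])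
qed simp

lemma vector_field_lipschitz:
  assumes "convex S" "S \<subseteq> V" "a \<in> S" "b \<in> S"
  shows "norm (X \<alpha> a - X \<alpha> b) \<le> k * norm (a - b)"
  using order_trans[OF norm_multilin_apply_Nil nth_deriv_lipschitz[OF assms(1,2) _ assms(3,4), of 0 \<alpha>]]
  by (simp add: nth_deriv_0 mconst_apply)

lemma vector_field_bound: "y \<in> V \<Longrightarrow> norm (X \<alpha> y) \<le> k"
  using order_trans[OF norm_multilin_apply_Nil bound[of y 0 \<alpha>]]
  by (simp add: nth_deriv_0 mconst_apply)

text \<open>The radius is common to all indices and times. Merely having values in \<open>V\<close>
  would not give an open set of paths, as infinitely many indices could approach the boundary of
  \<open>V\<close>.\<close>

definition inner_paths :: "('i, 'e) path set" where
  "inner_paths = {u. \<exists>\<epsilon>>0. \<forall>\<beta> \<sigma>. ball (pval u \<beta> \<sigma>) \<epsilon> \<subseteq> V}"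

lemma inner_pathsD: "u \<in> inner_paths \<Longrightarrow> pval u \<beta> \<sigma> \<in> V"
  unfolding inner_paths_def using centre_in_ball by blast

lemma norm_pval_diff: "norm (pval u \<beta> \<sigma> - pval v \<beta> \<sigma>) \<le> norm (u - v)"
  using norm_bounded[of "u - v"] by simp

lemma open_inner_paths: "open inner_paths"
  unfolding open_dist
proof
  fix u assume "u \<in> inner_paths"
  then obtain \<epsilon> where \<epsilon>: "0 < \<epsilon>" "\<And>\<beta> \<sigma>. ball (pval u \<beta> \<sigma>) \<epsilon> \<subseteq> V"
    by (auto simp: inner_paths_def)
  have "v \<in> inner_paths" if "dist v u < \<epsilon> / 2" for v
    unfolding inner_paths_def
  proof (intro CollectI exI[of _ "\<epsilon> / 2"] conjI allI)
    fix \<beta> \<sigma>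
    have "dist (pval v \<beta> \<sigma>) (pval u \<beta> \<sigma>) < \<epsilon> / 2"
      using norm_pval_diff[of v \<beta> \<sigma> u] that by (simp add: dist_norm)
    then have "ball (pval v \<beta> \<sigma>) (\<epsilon> / 2) \<subseteq> ball (pval u \<beta> \<sigma>) \<epsilon>"
      by (intro ball_subset_ball_triangle) simp
    then show "ball (pval v \<beta> \<sigma>) (\<epsilon> / 2) \<subseteq> V" using \<epsilon>(2) by blast
  qed (use \<epsilon> in simp)
  then show "\<exists>e>0. \<forall>v. dist v u < e \<longrightarrow> v \<in> inner_paths"
    using \<epsilon>(1) by (intro exI[of _ "\<epsilon> / 2"]) auto
qed

text \<open>Superposition (Nemytskii) operators, one for each order of derivative. They have the
  intended values on \<open>inner_paths\<close>.\<close>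

definition jet_path :: "nat \<Rightarrow> ('i, 'e) path \<Rightarrow> ('i, ('e, 'e) multilin) path" where
  "jet_path m u = Bcontfun (\<lambda>p. nth_deriv m (X (of_discrete (fst p))) (apply_bcontfun u p))"

lemma jet_path_apply:
  assumes "u \<in> inner_paths" "m \<le> s + 2"
  shows "pval (jet_path m u) \<beta> \<sigma> = nth_deriv m (X \<beta>) (pval u \<beta> \<sigma>)"
proof -
  have V: "apply_bcontfun u p \<in> V" for p
    using inner_pathsD[OF assms(1)] by (metis discrete_cases surj_pair)
  have "apply_bcontfun (jet_path m u) = (\<lambda>p. nth_deriv m (X (of_discrete (fst p))) (apply_bcontfun u p))"
    unfolding jet_path_def
  proof (rule bcontfun_discrete_timesI)
    show "norm (nth_deriv m (X (of_discrete (fst p))) (apply_bcontfun u p)) \<le> k" for p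
      by (rule bound[OF V assms(2)])
    show "continuous_on UNIV (\<lambda>\<sigma>. nth_deriv m (X (of_discrete (fst (discrete \<beta>, \<sigma>)))) (pval u \<beta> \<sigma>))" for \<beta>
      unfolding fst_conv discrete_inverse[OF UNIV_I]
      by (rule continuous_on_compose2[OF Ck_onD(3)[OF Ck_on_mono[OF smooth assms(2)]] continuous_on_pval])
        (use V in auto)
  qed
  then show ?thesis by (simp add: discrete_inverse)
qed

text \<open>Balls around the values of \<open>u\<close> are convex subsets of \<open>V\<close>, so
  within them the estimates for convex sets apply pointwise to all nearby paths.\<close>

lemma inner_pathsE:
  assumes "u \<in> inner_paths"
  obtains \<epsilon> where "0 < \<epsilon>" "\<And>\<beta> \<sigma>. ball (pval u \<beta> \<sigma>) \<epsilon> \<subseteq> V"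
    "\<And>v \<beta> \<sigma>. norm (v - u) < \<epsilon> \<Longrightarrow> pval v \<beta> \<sigma> \<in> ball (pval u \<beta> \<sigma>) \<epsilon>"
    "\<And>v. norm (v - u) < \<epsilon> \<Longrightarrow> v \<in> inner_paths"
proof -
  obtain \<epsilon>1 where \<epsilon>1: "0 < \<epsilon>1" "\<And>\<beta> \<sigma>. ball (pval u \<beta> \<sigma>) \<epsilon>1 \<subseteq> V"
    using assms by (auto simp: inner_paths_def)
  obtain \<epsilon>2 where \<epsilon>2: "0 < \<epsilon>2" "ball u \<epsilon>2 \<subseteq> inner_paths"
    using open_inner_paths assms open_contains_ball by blast
  show thesis
  proof
    show "0 < min \<epsilon>1 \<epsilon>2" using \<epsilon>1 \<epsilon>2 by simp
    show "ball (pval u \<beta> \<sigma>) (min \<epsilon>1 \<epsilon>2) \<subseteq> V" for \<beta> \<sigma>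
      using \<epsilon>1(2)[of \<beta> \<sigma>] by auto
    show "pval v \<beta> \<sigma> \<in> ball (pval u \<beta> \<sigma>) (min \<epsilon>1 \<epsilon>2)" if "norm (v - u) < min \<epsilon>1 \<epsilon>2" for v \<beta> \<sigma>
      using norm_pval_diff[of u \<beta> \<sigma> v] that by (simp add: dist_norm norm_minus_commute)
    show "v \<in> inner_paths" if "norm (v - u) < min \<epsilon>1 \<epsilon>2" for v
      using \<epsilon>2(2) that by (auto simp: dist_norm norm_minus_commute)
  qed
qed

lemma norm_path_le:
  fixes w :: "('i, 'b::real_normed_vector) path"
  assumes "\<And>\<beta> \<sigma>. norm (pval w \<beta> \<sigma>) \<le> C"
  shows "norm w \<le> C"
  by (rule norm_bound) (metis assms discrete_cases surj_pair)

lemma jet_path_continuous: "m \<le> s + 1 \<Longrightarrow> continuous_on inner_paths (jet_path m)"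
  unfolding continuous_on_iff
proof (intro ballI allI impI)
  fix u e assume m: "m \<le> s + 1" and u: "u \<in> inner_paths" and e: "0 < (e :: real)"
  obtain \<epsilon> where \<epsilon>: "0 < \<epsilon>" "\<And>\<beta> \<sigma>. ball (pval u \<beta> \<sigma>) \<epsilon> \<subseteq> V"
    "\<And>v \<beta> \<sigma>. norm (v - u) < \<epsilon> \<Longrightarrow> pval v \<beta> \<sigma> \<in> ball (pval u \<beta> \<sigma>) \<epsilon>"
    "\<And>v. norm (v - u) < \<epsilon> \<Longrightarrow> v \<in> inner_paths"
    using inner_pathsE[OF u] by metis
  show "\<exists>d>0. \<forall>v\<in>inner_paths. dist v u < d \<longrightarrow> dist (jet_path m v) (jet_path m u) < e"
  proof (intro exI[of _ "min \<epsilon> (e / (2 * k))"] conjI ballI impI)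
    fix v assume "v \<in> inner_paths" "dist v u < min \<epsilon> (e / (2 * k))"
    then have v: "v \<in> inner_paths" "norm (v - u) < \<epsilon>" "norm (v - u) < e / (2 * k)"
      by (auto simp: dist_norm)
    have "norm (jet_path m v - jet_path m u) \<le> k * norm (v - u)"
    proof (rule norm_path_le)
      fix \<beta> \<sigma>
      have "norm (nth_deriv m (X \<beta>) (pval v \<beta> \<sigma>) - nth_deriv m (X \<beta>) (pval u \<beta> \<sigma>))
          \<le> k * norm (pval v \<beta> \<sigma> - pval u \<beta> \<sigma>)"
        by (rule nth_deriv_lipschitz[OF convex_ball \<epsilon>(2)[of \<beta> \<sigma>] m \<epsilon>(3)[OF v(2)]]) (use \<epsilon>(1) in simp)
      also have "\<dots> \<le> k * norm (v - u)"
        using k_pos norm_pval_diff by (intro mult_left_mono) auto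
      finally show "norm (pval (jet_path m v - jet_path m u) \<beta> \<sigma>) \<le> k * norm (v - u)"
        using m by (simp add: jet_path_apply u v)
    qed
    also have "\<dots> < e"
      using v(3) k_pos e by (simp add: field_simps)
    finally show "dist (jet_path m v) (jet_path m u) < e" by (simp add: dist_norm)
  qed (use \<epsilon> e k_pos in simp)
qed

text \<open>The remainder in \<open>nth_deriv_taylor\<close> depends neither on the index nor on the
  time, so the pointwise expansion is an expansion in the sup norm.\<close>

lemma jet_path_has_derivative:
  assumes m: "m \<le> s" and u: "u \<in> inner_paths"
  shows "(jet_path m has_derivative pcontract (jet_path (Suc m) u)) (at u)"
  unfolding has_derivative_at
proof
  show "bounded_linear (pcontract (jet_path (Suc m) u))"
    by (rule bounded_bilinear.bounded_linear_right[OF bounded_bilinear_pcontract])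
  obtain \<epsilon> where \<epsilon>: "0 < \<epsilon>" "\<And>\<beta> \<sigma>. ball (pval u \<beta> \<sigma>) \<epsilon> \<subseteq> V"
    "\<And>v \<beta> \<sigma>. norm (v - u) < \<epsilon> \<Longrightarrow> pval v \<beta> \<sigma> \<in> ball (pval u \<beta> \<sigma>) \<epsilon>"
    "\<And>v. norm (v - u) < \<epsilon> \<Longrightarrow> v \<in> inner_paths"
    using inner_pathsE[OF u] by metis
  have le: "norm (jet_path m (u + h) - jet_path m u - pcontract (jet_path (Suc m) u) h) / norm h \<le> k * norm h"
    if h: "norm h < \<epsilon>" "h \<noteq> 0" for h
  proof -
    have uh: "u + h \<in> inner_paths" using \<epsilon>(4)[of "u + h"] h by simp
    have "norm (jet_path m (u + h) - jet_path m u - pcontract (jet_path (Suc m) u) h) \<le> norm h * (k * norm h)"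
    proof (rule norm_path_le)
      fix \<beta> \<sigma>
      let ?a = "pval u \<beta> \<sigma>" and ?b = "pval (u + h) \<beta> \<sigma>"
      have "norm (nth_deriv m (X \<beta>) ?b - nth_deriv m (X \<beta>) ?a - mcurry (nth_deriv (Suc m) (X \<beta>) ?a) (?b - ?a))
          \<le> norm (?b - ?a) * (k * norm (?b - ?a))"
        by (rule nth_deriv_taylor[OF convex_ball \<epsilon>(2)[of \<beta> \<sigma>] m _ \<epsilon>(3)]) (use \<epsilon>(1) h in simp_all)
      also have "\<dots> \<le> norm h * (k * norm h)"
        using k_pos norm_bounded[of h] by (intro mult_mono mult_left_mono) auto
      finally show "norm (pval (jet_path m (u + h) - jet_path m u - pcontract (jet_path (Suc m) u) h) \<beta> \<sigma>)
          \<le> norm h * (k * norm h)"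
        using jet_path_apply[OF uh, of m \<beta> \<sigma>] jet_path_apply[OF u, of m \<beta> \<sigma>]
          jet_path_apply[OF u, of "Suc m" \<beta> \<sigma>] m
        by (simp add: pcontract_apply)
    qed
    then show ?thesis using h by (simp add: field_simps)
  qed
  show "(\<lambda>h. norm (jet_path m (u + h) - jet_path m u - pcontract (jet_path (Suc m) u) h) / norm h) \<midarrow>0\<rightarrow> 0"
  proof (rule tendsto_sandwich[OF _ _ tendsto_const])
    show "((\<lambda>h. k * norm h) \<longlongrightarrow> 0) (at (0 :: ('i, 'e) path))"
      by (intro tendsto_eq_intros tendsto_norm_zero) auto
    show "\<forall>\<^sub>F h in at 0. norm (jet_path m (u + h) - jet_path m u - pcontract (jet_path (Suc m) u) h) / norm h \<le> k * norm h"
      unfolding eventually_at using \<epsilon>(1) le by (intro exI[of _ \<epsilon>]) (auto simp: dist_norm)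
  qed (auto intro!: always_eventually)
qed

text \<open>The derivative of \<open>jet_path m\<close> is a linear image of
  \<open>jet_path (Suc m)\<close>: each differentiation trades one order of smoothness for one order
  of the jet, and the jets are continuous in \<open>u\<close> up to order
  \<open>s + 1\<close>.\<close>

lemma Ck_on_jet_path: "m + j \<le> s + 1 \<Longrightarrow> Ck_on j (jet_path m) inner_paths"
proof (induction j arbitrary: m)
  case 0
  then show ?case using jet_path_continuous open_inner_paths by (simp add: Ck_on_0)
next
  case (Suc j)
  interpret bounded_bilinear "pcontract :: ('i, ('e, 'e) multilin) path \<Rightarrow> _"
    by (rule bounded_bilinear_pcontract)
  show ?case
  proof (rule Ck_on_derivative[OF open_inner_paths])
    show "(jet_path m has_derivative blinfun_apply (prod_right (jet_path (Suc m) u))) (at u)"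
      if "u \<in> inner_paths" for u
      using jet_path_has_derivative[of m u] that Suc.prems by (simp add: prod_right.rep_eq)
    show "Ck_on j (\<lambda>u. prod_right (jet_path (Suc m) u)) inner_paths"
      by (intro Ck_on_linear[OF bounded_linear_prod_right] Suc.IH) (use Suc.prems in simp)
  qed
qed

definition velocity :: "('i, 'e) path \<Rightarrow> ('i, 'e) path" where
  "velocity u = pmap (\<lambda>T. multilin_apply T []) (jet_path 0 u)"

lemma velocity_apply: "u \<in> inner_paths \<Longrightarrow> pval (velocity u) \<beta> \<sigma> = X \<beta> (pval u \<beta> \<sigma>)"
  by (simp add: velocity_def pmap_apply[OF bounded_linear_multilin_apply] jet_path_apply
      nth_deriv_0 mconst_apply)

lemma norm_velocity: "u \<in> inner_paths \<Longrightarrow> norm (velocity u) \<le> k"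
  by (rule norm_path_le) (simp add: velocity_apply vector_field_bound inner_pathsD)

lemma Ck_on_velocity: "Ck_on (Suc s) velocity inner_paths"
  unfolding velocity_def[abs_def]
  by (intro Ck_on_linear[OF bounded_linear_pmap[OF bounded_linear_multilin_apply]] Ck_on_jet_path) simp

text \<open>A bound on the operator norm of \<open>A\<close> would be too weak here; the weighted
  estimates behind \<open>volterra_invertible\<close> need the bound at every index and
  time.\<close>

lemma velocity_has_derivative:
  assumes u: "u \<in> inner_paths"
  obtains A where "(velocity has_derivative blinfun_apply A) (at u)"
    "\<And>h \<beta> \<sigma>. norm (pval (A h) \<beta> \<sigma>) \<le> k * norm (pval h \<beta> \<sigma>)"
proof
  let ?A = "\<lambda>h. pmap (\<lambda>T. multilin_apply T []) (pcontract (jet_path (Suc 0) u) h)"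
  have bl: "bounded_linear ?A"
    by (intro bounded_linear_compose[OF bounded_linear_pmap[OF bounded_linear_multilin_apply]]
        bounded_bilinear.bounded_linear_right[OF bounded_bilinear_pcontract])
  show "(velocity has_derivative blinfun_apply (Blinfun ?A)) (at u)"
    unfolding velocity_def[abs_def] bounded_linear_Blinfun_apply[OF bl]
    by (rule bounded_linear.has_derivative[OF bounded_linear_pmap[OF bounded_linear_multilin_apply]
          jet_path_has_derivative[OF _ u]]) simp
  show "norm (pval (Blinfun ?A h) \<beta> \<sigma>) \<le> k * norm (pval h \<beta> \<sigma>)" for h \<beta> \<sigma>
  proof -
    have "norm (mcurry (nth_deriv (Suc 0) (X \<beta>) (pval u \<beta> \<sigma>)) (pval h \<beta> \<sigma>)) \<le> k * norm (pval h \<beta> \<sigma>)"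
      by (rule order_trans[OF norm_mcurry_apply])
        (intro mult_right_mono bound inner_pathsD u, auto)
    then show ?thesis
      unfolding bounded_linear_Blinfun_apply[OF bl] pmap_apply[OF bounded_linear_multilin_apply] pcontract_apply
      using jet_path_apply[OF u, of "Suc 0" \<beta> \<sigma>]
      by (simp add: order_trans[OF norm_multilin_apply_Nil])
  qed
qed

lemma velocity_lipschitz:
  assumes "u \<in> inner_paths" "v \<in> inner_paths" "convex S" "S \<subseteq> V" "pval u \<beta> \<sigma> \<in> S" "pval v \<beta> \<sigma> \<in> S"
  shows "norm (pval (velocity u) \<beta> \<sigma> - pval (velocity v) \<beta> \<sigma>) \<le> k * norm (pval u \<beta> \<sigma> - pval v \<beta> \<sigma>)"
  using vector_field_lipschitz[OF assms(3-6)] by (simp add: velocity_apply assms(1,2))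

end


subsection \<open>The integral equation\<close>

locale flow_family = strict_total_order lt + bounded_family X V k s
  for lt :: "'i \<Rightarrow> 'i \<Rightarrow> bool" and X :: "'i \<Rightarrow> 'e::banach \<Rightarrow> 'e" and V k s
begin

text \<open>The inhomogeneity \<open>f\<close> is an arbitrary path and not only a constant starting
  point, so that the equation can be inverted in the space of paths.\<close>

definition solves :: "'i ell1 \<Rightarrow> ('i, 'e) path \<Rightarrow> ('i, 'e) path \<Rightarrow> bool" where
  "solves \<tau> f u \<longleftrightarrow> u \<in> inner_paths \<and> u = f + volterra \<tau> (velocity u)"

lemma closed_path_set:
  fixes c :: "'i \<Rightarrow> real \<Rightarrow> 'e"
  shows "closed {u :: ('i, 'e) path. \<forall>\<beta> \<sigma>. norm (pval u \<beta> \<sigma> - c \<beta> \<sigma>) \<le> d \<beta> \<sigma>}"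
  by (intro closed_Collect_all closed_Collect_le continuous_intros
      bounded_linear.continuous_on[OF bounded_linear_apply_path])

text \<open>With speed at most \<open>k\<close>, a path leaves \<open>x\<close> by no more than
  \<open>k * norm \<tau>\<close>. Paths obeying this bound form a closed set that is mapped into
  itself; \<open>\<epsilon>\<close> is the margin that keeps them uniformly inside \<open>V\<close>,
  and the ball supplies the convexity.\<close>

lemma solution_exists:
  assumes "0 < \<epsilon>" "ball x (k * norm \<tau> + \<epsilon>) \<subseteq> V"
  obtains u where "solves \<tau> (const_bcontfun x) u"
proof -
  define Z where "Z = {u :: ('i, 'e) path. \<forall>\<beta> \<sigma>. norm (pval u \<beta> \<sigma> - x) \<le> k * norm \<tau>}"
  have inB: "pval u \<beta> \<sigma> \<in> ball x (k * norm \<tau> + \<epsilon>)" if "u \<in> Z" for u \<beta> \<sigma>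
  proof -
    have "norm (pval u \<beta> \<sigma> - x) \<le> k * norm \<tau>" using that by (simp add: Z_def)
    then show ?thesis using \<open>0 < \<epsilon>\<close> by (simp add: dist_norm norm_minus_commute)
  qed
  have Zin: "u \<in> inner_paths" if "u \<in> Z" for u
    unfolding inner_paths_def
  proof (intro CollectI exI[of _ \<epsilon>] conjI allI)
    fix \<beta> \<sigma>
    have "norm (pval u \<beta> \<sigma> - x) \<le> k * norm \<tau>" using that by (simp add: Z_def)
    then have "ball (pval u \<beta> \<sigma>) \<epsilon> \<subseteq> ball x (k * norm \<tau> + \<epsilon>)"
      by (intro ball_subset_ball_triangle) (simp add: dist_norm)
    then show "ball (pval u \<beta> \<sigma>) \<epsilon> \<subseteq> V" using assms(2) by blast
  qed (use \<open>0 < \<epsilon>\<close> in simp)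
  have "\<exists>u\<in>Z. u = const_bcontfun x + volterra \<tau> (velocity u)"
  proof (rule volterra_fixed_point[OF _ _ k_pos])
    show "closed Z" unfolding Z_def by (rule closed_path_set)
    have "const_bcontfun x \<in> Z" using k_pos by (simp add: Z_def const_bcontfun.rep_eq)
    then show "Z \<noteq> {}" by blast
    show "norm (pval (velocity u) \<beta> \<sigma> - pval (velocity v) \<beta> \<sigma>) \<le> k * norm (pval u \<beta> \<sigma> - pval v \<beta> \<sigma>)"
      if "u \<in> Z" "v \<in> Z" for u v \<beta> \<sigma>
      by (rule velocity_lipschitz[OF Zin[OF that(1)] Zin[OF that(2)] convex_ball assms(2)])
        (intro inB that)+
    show "const_bcontfun x + volterra \<tau> (velocity u) \<in> Z" if "u \<in> Z" for u
      unfolding Z_def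
    proof (intro CollectI allI)
      fix \<beta> \<sigma>
      have "norm (pval (volterra \<tau> (velocity u)) \<beta> \<sigma>) \<le> norm \<tau> * norm (velocity u)"
        by (rule order_trans[OF norm_bounded norm_volterra])
      also have "\<dots> \<le> norm \<tau> * k"
        by (intro mult_left_mono norm_velocity Zin that) simp
      finally show "norm (pval (const_bcontfun x + volterra \<tau> (velocity u)) \<beta> \<sigma> - x) \<le> k * norm \<tau>"
        by (simp add: const_bcontfun.rep_eq mult.commute)
    qed
  qed
  then show thesis using that Zin unfolding solves_def by blast
qed

text \<open>The fixed point theorem is applied in a tube around \<open>u0\<close> whose width grows
  like the weight, because the halving estimate holds for weighted distances only.\<close>

lemma solution_exists_nearby:
  assumes "solves \<tau>0 f0 u0"
  obtains \<eta> G where "0 < \<eta>" "continuous_on (ball (\<tau>0, f0) \<eta>) G" "G (\<tau>0, f0) = u0"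
    "\<And>\<tau> f. (\<tau>, f) \<in> ball (\<tau>0, f0) \<eta> \<Longrightarrow> solves \<tau> f (G (\<tau>, f))"
proof -
  interpret W: bounded_bilinear "volterra :: 'i ell1 \<Rightarrow> ('i, 'e) path \<Rightarrow> ('i, 'e) path"
    by (rule bounded_bilinear_volterra)
  have u0: "u0 \<in> inner_paths" "u0 = f0 + volterra \<tau>0 (velocity u0)"
    using assms by (auto simp: solves_def)
  have f0: "f0 = u0 - volterra \<tau>0 (velocity u0)"
    by (metis add_diff_cancel_right' u0(2))
  obtain \<epsilon> where \<epsilon>: "0 < \<epsilon>" "\<And>\<beta> \<sigma>. ball (pval u0 \<beta> \<sigma>) \<epsilon> \<subseteq> V"
    "\<And>v \<beta> \<sigma>. norm (v - u0) < \<epsilon> \<Longrightarrow> pval v \<beta> \<sigma> \<in> ball (pval u0 \<beta> \<sigma>) \<epsilon>"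
    "\<And>v. norm (v - u0) < \<epsilon> \<Longrightarrow> v \<in> inner_paths"
    using inner_pathsE[OF u0(1)] by metis
  \<comment> \<open>\<open>C\<close> bounds the weight for all \<open>\<tau>\<close> within distance
    1 of \<open>\<tau>0\<close>; \<open>\<delta>\<close> makes the tube no wider than
    \<open>\<epsilon> / 2\<close>; \<open>\<eta>\<close> lets the change of \<open>f\<close> and
    \<open>\<tau>\<close> use up at most \<open>\<delta> / 2\<close>, as the other half is taken by
    the contraction.\<close>
  define C where "C = exp (2 * k * (norm \<tau>0 + 1))"
  define \<delta> where "\<delta> = \<epsilon> / (2 * C)"
  define \<eta> where "\<eta> = min 1 (\<delta> / 2 / (1 + k))"
  have C: "0 < C" by (simp add: C_def)
  have \<delta>: "0 < \<delta>" using C \<epsilon>(1) by (simp add: \<delta>_def)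
  have \<eta>: "0 < \<eta>" "\<eta> \<le> 1" "\<eta> * (1 + k) \<le> \<delta> / 2"
  proof -
    show "0 < \<eta>" "\<eta> \<le> 1" using \<delta> k_pos by (auto simp: \<eta>_def)
    have "\<eta> * (1 + k) \<le> \<delta> / 2 / (1 + k) * (1 + k)"
      by (rule mult_right_mono) (use k_pos in \<open>auto simp: \<eta>_def\<close>)
    also have "\<dots> = \<delta> / 2" using k_pos by (intro nonzero_eq_divide_eq[THEN iffD1] refl) simp
    finally show "\<eta> * (1 + k) \<le> \<delta> / 2" .
  qed
  have lip: "norm (pval (velocity u) \<beta> \<sigma> - pval (velocity v) \<beta> \<sigma>) \<le> k * norm (pval u \<beta> \<sigma> - pval v \<beta> \<sigma>)"
    if "norm (u - u0) < \<epsilon>" "norm (v - u0) < \<epsilon>" for u v \<beta> \<sigma>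
    by (rule velocity_lipschitz[OF \<epsilon>(4) \<epsilon>(4) convex_ball \<epsilon>(2) \<epsilon>(3) \<epsilon>(3)]) (use that in auto)
  have near: "norm (\<tau> - \<tau>0) < \<eta>" "norm (f - f0) < \<eta>" "exp (2 * k * elapsed \<tau> \<beta> \<sigma>) \<le> C"
    "exp (2 * k * norm \<tau>) \<le> C"
    if "(\<tau>, f) \<in> ball (\<tau>0, f0) \<eta>" for \<tau> f \<beta> \<sigma>
  proof -
    have "dist (\<tau>0, f0) (\<tau>, f) < \<eta>" using that by simp
    then show *: "norm (\<tau> - \<tau>0) < \<eta>" "norm (f - f0) < \<eta>"
      using dist_fst_le[of "(\<tau>0, f0)" "(\<tau>, f)"] dist_snd_le[of "(\<tau>0, f0)" "(\<tau>, f)"]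
      by (auto simp: dist_norm norm_minus_commute)
    have "norm \<tau> \<le> norm \<tau>0 + 1"
      using *(1) \<eta>(2) norm_triangle_ineq2[of \<tau> \<tau>0] by linarith
    moreover from this have "elapsed \<tau> \<beta> \<sigma> \<le> norm \<tau>0 + 1"
      using elapsed_le_norm[of \<tau> \<beta> \<sigma>] by linarith
    ultimately show "exp (2 * k * elapsed \<tau> \<beta> \<sigma>) \<le> C" "exp (2 * k * norm \<tau>) \<le> C"
      using k_pos by (auto simp: C_def)
  qed
  have ex: "\<exists>u. norm (u - u0) < \<epsilon> \<and> u = f + volterra \<tau> (velocity u)"
    if T: "(\<tau>, f) \<in> ball (\<tau>0, f0) \<eta>" for \<tau> f
  proof -
    define Z where "Z = {u :: ('i, 'e) path. \<forall>\<beta> \<sigma>.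
      norm (pval u \<beta> \<sigma> - pval u0 \<beta> \<sigma>) \<le> \<delta> * exp (2 * k * elapsed \<tau> \<beta> \<sigma>)}"
    have Z: "norm (u - u0) < \<epsilon>" if "u \<in> Z" for u
    proof -
      have "norm (u - u0) \<le> \<delta> * C"
      proof (rule norm_path_le)
        fix \<beta> \<sigma>
        have "norm (pval u \<beta> \<sigma> - pval u0 \<beta> \<sigma>) \<le> \<delta> * exp (2 * k * elapsed \<tau> \<beta> \<sigma>)"
          using that by (simp add: Z_def)
        also have "\<dots> \<le> \<delta> * C" using near(3)[OF T] \<delta> by simp
        finally show "norm (pval (u - u0) \<beta> \<sigma>) \<le> \<delta> * C" by simp
      qed
      also have "\<delta> * C = \<epsilon> / 2" using C by (simp add: \<delta>_def)
      also have "\<dots> < \<epsilon>" using \<epsilon>(1) by simp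
      finally show ?thesis .
    qed
    have u0Z: "u0 \<in> Z" using \<delta> by (simp add: Z_def)
    have "\<exists>u\<in>Z. u = f + volterra \<tau> (velocity u)"
    proof (rule volterra_fixed_point[OF _ _ k_pos])
      show "closed Z" unfolding Z_def by (rule closed_path_set)
      show "Z \<noteq> {}" using u0Z by blast
      show "norm (pval (velocity u) \<beta> \<sigma> - pval (velocity v) \<beta> \<sigma>) \<le> k * norm (pval u \<beta> \<sigma> - pval v \<beta> \<sigma>)"
        if "u \<in> Z" "v \<in> Z" for u v \<beta> \<sigma>
        by (rule lip[OF Z[OF that(1)] Z[OF that(2)]])
      show "f + volterra \<tau> (velocity u) \<in> Z" if u: "u \<in> Z" for u
        unfolding Z_def
      proof (intro CollectI allI)
        fix \<beta> \<sigma>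
        let ?E = "exp (2 * k * elapsed \<tau> \<beta> \<sigma>)"
        \<comment> \<open>The first bracket is the error caused by changing the data at the fixed
          path \<open>u0\<close>, the second one the effect of moving from \<open>u0\<close> to
          \<open>u\<close> for the same \<open>\<tau>\<close>.\<close>
        have "(f + volterra \<tau> (velocity u)) - u0 =
            ((f - f0) + volterra (\<tau> - \<tau>0) (velocity u0)) + (volterra \<tau> (velocity u) - volterra \<tau> (velocity u0))"
          unfolding f0 W.diff_left by simp
        then have eq: "pval (f + volterra \<tau> (velocity u)) \<beta> \<sigma> - pval u0 \<beta> \<sigma> =
            pval ((f - f0) + volterra (\<tau> - \<tau>0) (velocity u0)) \<beta> \<sigma> +
            (pval (volterra \<tau> (velocity u)) \<beta> \<sigma> - pval (volterra \<tau> (velocity u0)) \<beta> \<sigma>)"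
          by (metis minus_bcontfun.rep_eq plus_bcontfun.rep_eq)
        have "norm ((f - f0) + volterra (\<tau> - \<tau>0) (velocity u0)) \<le> \<eta> + \<eta> * k"
          using near(1,2)[OF T] norm_velocity[OF u0(1)] k_pos \<eta>(1)
          by (intro norm_triangle_le add_mono order_trans[OF norm_volterra] mult_mono) auto
        also have "\<dots> \<le> \<delta> / 2" using \<eta>(3) by (simp add: algebra_simps)
        also have "\<dots> \<le> \<delta> / 2 * ?E"
          using \<delta> k_pos elapsed_nonneg by simp
        finally have 1: "norm (pval ((f - f0) + volterra (\<tau> - \<tau>0) (velocity u0)) \<beta> \<sigma>) \<le> \<delta> / 2 * ?E"
          using norm_bounded order_trans by blast
        have 2: "norm (pval (volterra \<tau> (velocity u)) \<beta> \<sigma> - pval (volterra \<tau> (velocity u0)) \<beta> \<sigma>) \<le> \<delta> / 2 * ?E"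
          by (rule volterra_lipschitz_weighted[OF lip[OF Z[OF u] Z[OF u0Z]] _ k_pos])
            (use u \<delta> in \<open>auto simp: Z_def\<close>)
        have "norm (pval (f + volterra \<tau> (velocity u)) \<beta> \<sigma> - pval u0 \<beta> \<sigma>) \<le> \<delta> / 2 * ?E + \<delta> / 2 * ?E"
          unfolding eq by (intro norm_triangle_le add_mono 1 2)
        then show "norm (pval (f + volterra \<tau> (velocity u)) \<beta> \<sigma> - pval u0 \<beta> \<sigma>) \<le> \<delta> * ?E" by simp
      qed
    qed
    then show ?thesis using Z by blast
  qed
  have "\<forall>z\<in>ball (\<tau>0, f0) \<eta>. \<exists>u. norm (u - u0) < \<epsilon> \<and> u = snd z + volterra (fst z) (velocity u)"
    using ex by (intro ballI) (metis prod.collapse)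
  from bchoice[OF this] obtain G where
    "\<forall>z\<in>ball (\<tau>0, f0) \<eta>. norm (G z - u0) < \<epsilon> \<and> G z = snd z + volterra (fst z) (velocity (G z))"
    by blast
  then have G: "norm (G (\<tau>, f) - u0) < \<epsilon> \<and> G (\<tau>, f) = f + volterra \<tau> (velocity (G (\<tau>, f)))"
    if "(\<tau>, f) \<in> ball (\<tau>0, f0) \<eta>" for \<tau> f
    using that by (metis fst_conv snd_conv)
  have Glip: "norm (G (\<tau>, f) - G (\<tau>', f')) \<le> 2 * C * (norm (f - f') + norm (\<tau> - \<tau>') * k)"
    if a: "(\<tau>, f) \<in> ball (\<tau>0, f0) \<eta>" and b: "(\<tau>', f') \<in> ball (\<tau>0, f0) \<eta>" for \<tau> f \<tau>' f'
  proof -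
    let ?u = "G (\<tau>, f)" and ?v = "G (\<tau>', f')"
    \<comment> \<open>The change of \<open>\<tau>\<close> is moved into the inhomogeneity, so that
      both paths solve equations with the same \<open>\<tau>\<close> and
      \<open>volterra_stability\<close> compares them.\<close>
    have "?v = (f' - volterra (\<tau> - \<tau>') (velocity ?v)) + volterra \<tau> (velocity ?v)"
      using G[OF b] by (simp add: W.diff_left)
    then have "norm (?u - ?v) \<le> 2 * exp (2 * k * norm \<tau>) * norm (f - (f' - volterra (\<tau> - \<tau>') (velocity ?v)))"
      using G[OF a] by (intro volterra_stability[where N = velocity] k_pos lip) (use G[OF b] in auto)
    also have "\<dots> \<le> 2 * C * (norm (f - f') + norm (\<tau> - \<tau>') * k)"
    proof (intro mult_mono)
      have "norm (velocity ?v) \<le> k" by (intro norm_velocity \<epsilon>(4)) (use G[OF b] in simp)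
      then have "norm (volterra (\<tau> - \<tau>') (velocity ?v)) \<le> norm (\<tau> - \<tau>') * k"
        by (intro order_trans[OF norm_volterra] mult_left_mono) auto
      moreover have "f - (f' - volterra (\<tau> - \<tau>') (velocity ?v)) = (f - f') + volterra (\<tau> - \<tau>') (velocity ?v)"
        by simp
      ultimately show "norm (f - (f' - volterra (\<tau> - \<tau>') (velocity ?v))) \<le> norm (f - f') + norm (\<tau> - \<tau>') * k"
        by (metis add_left_mono norm_triangle_le)
    qed (use near(4)[OF a] C in auto)
    finally show ?thesis .
  qed
  have base: "(\<tau>0, f0) \<in> ball (\<tau>0, f0) \<eta>" using \<eta>(1) by simp
  show thesis
  proof
    show "0 < \<eta>" by fact
    show "solves \<tau> f (G (\<tau>, f))" if "(\<tau>, f) \<in> ball (\<tau>0, f0) \<eta>" for \<tau> f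
      using G[OF that] \<epsilon>(4) by (simp add: solves_def)
    have "norm (G (\<tau>0, f0) - u0) \<le> 2 * exp (2 * k * norm \<tau>0) * norm (f0 - f0)"
      by (rule volterra_stability[where N = velocity, OF conjunct2[OF G[OF base]] u0(2) k_pos lip])
        (use G[OF base] \<epsilon>(1) in auto)
    then show "G (\<tau>0, f0) = u0" by simp
    show "continuous_on (ball (\<tau>0, f0) \<eta>) G"
    proof (rule lipschitz_on_continuous_on[of "2 * C * (1 + k)"], rule lipschitz_onI)
      fix a b assume ab: "a \<in> ball (\<tau>0, f0) \<eta>" "b \<in> ball (\<tau>0, f0) \<eta>"
      have "dist (G a) (G b) \<le> 2 * C * (dist (snd a) (snd b) + dist (fst a) (fst b) * k)"
        using Glip[of "fst a" "snd a" "fst b" "snd b"] ab by (simp add: dist_norm)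
      also have "\<dots> \<le> 2 * C * (dist a b + dist a b * k)"
        using C k_pos dist_fst_le[of a b] dist_snd_le[of a b]
        by (intro mult_left_mono add_mono mult_right_mono) auto
      finally show "dist (G a) (G b) \<le> 2 * C * (1 + k) * dist a b" by (simp add: algebra_simps)
    qed (use C k_pos in simp)
  qed
qed

text \<open>The solution is obtained by inverting \<open>(\<tau>, u) \<mapsto> (\<tau>, u - volterra \<tau> (velocity u))\<close>.\<close>

lemma solution_smooth_nearby:
  assumes "solves \<tau>0 f0 u0"
  obtains T G where "open T" "(\<tau>0, f0) \<in> T" "Ck_on (Suc s) G T" "G (\<tau>0, f0) = u0"
    "\<And>\<tau> f. (\<tau>, f) \<in> T \<Longrightarrow> solves \<tau> f (G (\<tau>, f))"
proof -
  interpret W: bounded_bilinear "volterra :: 'i ell1 \<Rightarrow> ('i, 'e) path \<Rightarrow> ('i, 'e) path"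
    by (rule bounded_bilinear_volterra)
  obtain \<eta> G where G: "0 < \<eta>" "continuous_on (ball (\<tau>0, f0) \<eta>) G" "G (\<tau>0, f0) = u0"
    "\<And>\<tau> f. (\<tau>, f) \<in> ball (\<tau>0, f0) \<eta> \<Longrightarrow> solves \<tau> f (G (\<tau>, f))"
    using solution_exists_nearby[OF assms] by metis
  let ?T = "ball (\<tau>0, f0) \<eta>"
  let ?S = "(UNIV :: 'i ell1 set) \<times> inner_paths"
  define \<Phi> where "\<Phi> = (\<lambda>z :: 'i ell1 \<times> ('i, 'e) path. (fst z, snd z - volterra (fst z) (velocity (snd z))))"
  have openS: "open ?S" by (intro open_Times open_UNIV open_inner_paths)
  have fstsnd: "Ck_on (Suc s) fst ?S" "Ck_on (Suc s) snd ?S"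
    by (intro Ck_on_bounded_linear bounded_linear_fst bounded_linear_snd openS)+
  have \<Phi>: "Ck_on (Suc s) \<Phi> ?S"
    unfolding \<Phi>_def
    by (intro Ck_on_Pair Ck_on_minus fstsnd Ck_on_bilinear[OF bounded_bilinear_volterra]
        Ck_on_compose[OF fstsnd(2) Ck_on_velocity]) auto
  have "Ck_on (Suc s) (\<lambda>z. (fst z, G z)) ?T"
  proof (rule Ck_on_inverse_function[OF \<Phi> open_ball])
    show "continuous_on ?T (\<lambda>z. (fst z, G z))"
      by (intro continuous_intros G(2))
    show "(\<lambda>z. (fst z, G z)) ` ?T \<subseteq> ?S"
      using G(4) by (auto simp: solves_def)
    show "\<Phi> (fst z, G z) = z" if "z \<in> ?T" for z
    proof -
      have "G z = snd z + volterra (fst z) (velocity (G z))"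
        using G(4)[of "fst z" "snd z"] that by (simp add: solves_def)
      then have "G z - volterra (fst z) (velocity (G z)) = snd z"
        by (simp add: algebra_simps)
      then show ?thesis by (simp add: \<Phi>_def)
    qed
    fix z f' assume z: "z \<in> ?T" and f': "(\<Phi> has_derivative blinfun_apply f') (at (fst z, G z))"
    define \<tau> u where "\<tau> = fst z" "u = G z"
    have u: "u \<in> inner_paths" using G(4)[of "fst z" "snd z"] z by (simp add: solves_def \<tau>_u_def)
    obtain A where A: "(velocity has_derivative blinfun_apply A) (at u)"
      "\<And>h \<beta> \<sigma>. norm (pval (A h) \<beta> \<sigma>) \<le> k * norm (pval h \<beta> \<sigma>)"
      using velocity_has_derivative[OF u] by metis
    have "(\<Phi> has_derivative (\<lambda>h. (fst h, snd h - (volterra \<tau> (A (snd h)) + volterra (fst h) (velocity u))))) (at (\<tau>, u))"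
      unfolding \<Phi>_def
    proof (intro has_derivative_Pair has_derivative_diff has_derivative_fst has_derivative_snd has_derivative_ident)
      have "((\<lambda>z. velocity (snd z)) has_derivative (\<lambda>h. A (snd h))) (at (\<tau>, u))"
        using has_derivative_compose[OF has_derivative_snd[OF has_derivative_ident], of velocity "blinfun_apply A" "(\<tau>, u)" UNIV] A(1)
        by (simp add: o_def)
      from W.FDERIV[OF has_derivative_fst[OF has_derivative_ident] this]
      show "((\<lambda>z. volterra (fst z) (velocity (snd z))) has_derivative
          (\<lambda>h. volterra \<tau> (A (snd h)) + volterra (fst h) (velocity u))) (at (\<tau>, u))"
        by simp
    qed
    with f' have f'_eq: "blinfun_apply f' =
        (\<lambda>h. (fst h, snd h - (volterra \<tau> (A (snd h)) + volterra (fst h) (velocity u))))"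
      unfolding \<tau>_u_def by (rule has_derivative_unique)
    \<comment> \<open>The derivative of \<open>\<Phi>\<close> is block triangular with the identity
      in the first component. Inverting it reduces to inverting the diagonal block
      \<open>w \<mapsto> w - volterra \<tau> (A w)\<close>.\<close>
    obtain B :: "('i, 'e) path \<Rightarrow>\<^sub>L ('i, 'e) path"
      where B: "\<And>f. B f - volterra \<tau> (A (B f)) = f" "\<And>w. B (w - volterra \<tau> (A w)) = w"
      using volterra_invertible[OF k_pos A(2), of \<tau>] by metis
    let ?B = "\<lambda>h :: 'i ell1 \<times> ('i, 'e) path. (fst h, B (snd h + volterra (fst h) (velocity u)))"
    have "bounded_linear ?B"
      by (intro bounded_linear_Pair bounded_linear_fst
          bounded_linear_compose[OF bounded_linear_blinfun_apply[OF bounded_linear_ident]]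
          bounded_linear_compose[OF blinfun.bounded_linear_right]
          bounded_linear_add bounded_linear_snd bounded_linear_compose[OF W.bounded_linear_left])
    note Bapp = bounded_linear_Blinfun_apply[OF this]
    have "B (w - (volterra \<tau> (A w) + c) + c) = w" for w c
      using B(2)[of w] by (simp add: algebra_simps)
    then have "Blinfun ?B o\<^sub>L f' = id_blinfun"
      by (intro blinfun_eqI) (simp add: Bapp f'_eq)
    moreover have "B (w + c) - (volterra \<tau> (A (B (w + c))) + c) = w" for w c
      using B(1)[of "w + c"] by (simp add: algebra_simps)
    then have "f' o\<^sub>L Blinfun ?B = id_blinfun"
      by (intro blinfun_eqI) (simp add: Bapp f'_eq)
    ultimately show "\<exists>B. B o\<^sub>L f' = id_blinfun \<and> f' o\<^sub>L B = id_blinfun" by blast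
  qed
  from Ck_on_linear[OF bounded_linear_snd this] have "Ck_on (Suc s) G ?T" by simp
  then show thesis using G by (intro that[of ?T G]) auto
qed

section \<open>Endpoints of solutions\<close>

text \<open>There may be no last index, so the endpoint is the sum of all completed steps and not a
  value of \<open>u\<close>. It is a relation because uniqueness of \<open>u\<close> is not at hand;
  uniqueness of \<open>y\<close> is gained later through the flows.\<close>

definition reaches :: "'i ell1 \<Rightarrow> 'e \<Rightarrow> 'e \<Rightarrow> bool" where
  "reaches \<tau> x y \<longleftrightarrow>
     (\<exists>u. solves \<tau> (const_bcontfun x) u \<and> y = x + weighted_sum (\<lambda>_. 1) \<tau> (velocity u))"

lemma reaches_exists:
  assumes "0 < \<epsilon>" "ball x (k * norm \<tau> + \<epsilon>) \<subseteq> V"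
  obtains y where "reaches \<tau> x y"
  using solution_exists[OF assms] unfolding reaches_def by blast

lemma reaches_dist:
  assumes "reaches \<tau> x y"
  shows "norm (y - x) \<le> k * norm \<tau>"
proof -
  obtain u where u: "solves \<tau> (const_bcontfun x) u" "y = x + weighted_sum (\<lambda>_. 1) \<tau> (velocity u)"
    using assms by (auto simp: reaches_def)
  have "norm (weighted_sum (\<lambda>_. 1) \<tau> (velocity u)) \<le> norm \<tau> * k"
    using u(1) by (intro order_trans[OF norm_weighted_sum] mult_left_mono norm_velocity) (auto simp: solves_def)
  then show ?thesis by (simp add: u(2) mult.commute)
qed

lemma reaches_smooth:
  assumes "reaches \<tau>0 x0 y0"
  obtains T P where "open T" "(\<tau>0, x0) \<in> T" "Ck_on (Suc s) P T" "P (\<tau>0, x0) = y0"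
    "\<And>\<tau> x. (\<tau>, x) \<in> T \<Longrightarrow> reaches \<tau> x (P (\<tau>, x))"
proof -
  obtain u0 where u0: "solves \<tau>0 (const_bcontfun x0) u0" "y0 = x0 + weighted_sum (\<lambda>_. 1) \<tau>0 (velocity u0)"
    using assms by (auto simp: reaches_def)
  obtain T G where G: "open T" "(\<tau>0, const_bcontfun x0) \<in> T" "Ck_on (Suc s) G T" "G (\<tau>0, const_bcontfun x0) = u0"
    "\<And>\<tau> f. (\<tau>, f) \<in> T \<Longrightarrow> solves \<tau> f (G (\<tau>, f))"
    using solution_smooth_nearby[OF u0(1)] by metis
  define \<iota> where "\<iota> = (\<lambda>z :: 'i ell1 \<times> 'e. (fst z, const_bcontfun (snd z) :: ('i, 'e) path))"
  have "bounded_linear (const_bcontfun :: 'e \<Rightarrow> ('i, 'e) path)"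
    by (rule bounded_linear_intro[of _ 1])
      (auto intro!: bcontfun_eqI norm_bound simp: const_bcontfun.rep_eq)
  then have \<iota>: "bounded_linear \<iota>"
    unfolding \<iota>_def
    by (intro bounded_linear_Pair bounded_linear_fst bounded_linear_compose[OF _ bounded_linear_snd])
  define T' where "T' = \<iota> -` T"
  have openT': "open T'"
    unfolding T'_def using G(1) by (rule open_vimage) (rule bounded_linear.continuous_on[OF \<iota> continuous_on_id])
  have \<iota>T: "Ck_on (Suc s) \<iota> T'" by (rule Ck_on_bounded_linear[OF \<iota> openT'])
  have fstsnd: "Ck_on (Suc s) fst T'" "Ck_on (Suc s) snd T'"
    by (intro Ck_on_bounded_linear bounded_linear_fst bounded_linear_snd openT')+
  have G\<iota>: "Ck_on (Suc s) (\<lambda>z. G (\<iota> z)) T'"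
    by (rule Ck_on_compose[OF \<iota>T G(3)]) (auto simp: T'_def)
  have sol: "solves \<tau> (const_bcontfun x) (G (\<iota> (\<tau>, x)))" if "(\<tau>, x) \<in> T'" for \<tau> x
    using G(5) that by (simp add: T'_def \<iota>_def)
  show thesis
  proof
    show "open T'" by fact
    show "(\<tau>0, x0) \<in> T'" using G(2) by (simp add: T'_def \<iota>_def)
    let ?P = "\<lambda>z. snd z + weighted_sum (\<lambda>_. 1) (fst z) (velocity (G (\<iota> z)))"
    have "Ck_on (Suc s) (\<lambda>z. velocity (G (\<iota> z))) T'"
      by (rule Ck_on_compose[OF G\<iota> Ck_on_velocity]) (use sol in \<open>auto simp: solves_def\<close>)
    then show "Ck_on (Suc s) ?P T'"
      by (intro Ck_on_add fstsnd Ck_on_bilinear[OF bounded_bilinear_weighted_sum])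
    show "?P (\<tau>0, x0) = y0" by (simp add: u0(2) \<iota>_def G(4))
    show "reaches \<tau> x (?P (\<tau>, x))" if "(\<tau>, x) \<in> T'" for \<tau> x
      unfolding reaches_def using sol[OF that] by auto
  qed
qed

end


subsection \<open>Integral curves and flows\<close>

text \<open>\<open>flow\<close> refers to integral curves in the whole domain of the field, which
  may leave \<open>V\<close> and with it the uniform bounds. Uniqueness of such curves therefore
  rests on local Lipschitz constants.\<close>

lemma C1_locally_lipschitz:
  assumes X: "Ck_on 1 X D" and "z \<in> D"
  obtains \<rho> L where "0 < \<rho>" "0 < L" "ball z \<rho> \<subseteq> D"
    "\<And>a b. a \<in> ball z \<rho> \<Longrightarrow> b \<in> ball z \<rho> \<Longrightarrow> norm (X a - X b) \<le> L * norm (a - b)"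
proof -
  obtain X' where X': "\<And>x. x \<in> D \<Longrightarrow> (X has_derivative blinfun_apply (X' x)) (at x)" "Ck_on 0 X' D"
    using Ck_on_SucE[of 0 X D] X by auto
  have D: "open D" and cont: "continuous_on D X'" using X'(2) by (auto simp: Ck_on_0)
  let ?L = "norm (X' z) + 1"
  have "open (D \<inter> (\<lambda>x. norm (X' x)) -` {..<?L})"
    by (intro continuous_open_preimage D continuous_intros cont open_lessThan)
  moreover have "z \<in> D \<inter> (\<lambda>x. norm (X' x)) -` {..<?L}" using \<open>z \<in> D\<close> by simp
  ultimately obtain \<rho> where \<rho>: "0 < \<rho>" "ball z \<rho> \<subseteq> D \<inter> (\<lambda>x. norm (X' x)) -` {..<?L}"
    using open_contains_ball by blast
  show thesis
  proof
    show "0 < \<rho>" "ball z \<rho> \<subseteq> D" using \<rho> by auto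
    show "0 < ?L" using norm_ge_zero[of "X' z"] by linarith
    show "norm (X a - X b) \<le> ?L * norm (a - b)" if "a \<in> ball z \<rho>" "b \<in> ball z \<rho>" for a b
    proof (rule differentiable_bound[OF convex_ball[of z \<rho>] _ _ that])
      fix x assume "x \<in> ball z \<rho>"
      then have x: "x \<in> D" "norm (X' x) < ?L" using \<rho>(2) by auto
      show "(X has_derivative blinfun_apply (X' x)) (at x within ball z \<rho>)"
        using X'(1)[OF x(1)] by (rule has_derivative_at_withinI)
      show "onorm (blinfun_apply (X' x)) \<le> ?L"
        using x(2) by (simp add: norm_blinfun.rep_eq)
    qed
  qed
qed

lemma integral_curve_continuous: "integral_curve D X I c \<Longrightarrow> continuous_on I c"
  unfolding integral_curve_def
  by (auto intro: has_vector_derivative_continuous simp: continuous_on_eq_continuous_within)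

text \<open>Over times shorter than \<open>1 / (2 * L)\<close>, the mean value inequality bounds the
  maximal distance of the two curves by half of itself. The maximum exists on the compact
  segment.\<close>

lemma integral_curves_agree_locally:
  assumes curves: "integral_curve D X S c" "integral_curve D X S c'" and "convex S"
    and lip: "\<And>a b. a \<in> B \<Longrightarrow> b \<in> B \<Longrightarrow> norm (X a - X b) \<le> L * norm (a - b)" and "0 < L"
    and e: "e * L \<le> 1 / 2"
    and B: "\<And>v. v \<in> S \<Longrightarrow> dist v u0 < e \<Longrightarrow> c v \<in> B" "\<And>v. v \<in> S \<Longrightarrow> dist v u0 < e \<Longrightarrow> c' v \<in> B"
    and "u0 \<in> S" "u \<in> S" "dist u u0 < e" "c u0 = c' u0"
  shows "c u = c' u"
proof -
  let ?J = "closed_segment u0 u"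
  let ?d = "\<lambda>v. c v - c' v"
  have JS: "?J \<subseteq> S" using assms by (simp add: closed_segment_subset)
  have Je: "dist v u0 < e" if "v \<in> ?J" for v
    using segment_bound(1)[OF that] \<open>dist u u0 < e\<close> by (simp add: dist_norm)
  have "continuous_on ?J (\<lambda>v. norm (?d v))"
    by (intro continuous_intros continuous_on_subset[OF integral_curve_continuous[OF curves(1)] JS]
        continuous_on_subset[OF integral_curve_continuous[OF curves(2)] JS])
  then obtain w where w: "w \<in> ?J" "\<And>v. v \<in> ?J \<Longrightarrow> norm (?d v) \<le> norm (?d w)"
    using continuous_attains_sup[OF compact_segment, of u0 u] by fastforce
  have "norm (?d w - ?d u0) \<le> (L * norm (?d w)) * norm (w - u0)"
  proof (rule differentiable_bound[OF convex_closed_segment _ _ w(1) ends_in_segment(1)])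
    fix v assume v: "v \<in> ?J"
    have "(?d has_vector_derivative X (c v) - X (c' v)) (at v within ?J)"
      using curves v JS unfolding integral_curve_def
      by (intro has_vector_derivative_diff) (auto intro: has_vector_derivative_within_subset)
    then show "(?d has_derivative (\<lambda>h. h *\<^sub>R (X (c v) - X (c' v)))) (at v within ?J)"
      by (simp add: has_vector_derivative_def)
    have "norm (X (c v) - X (c' v)) \<le> L * norm (?d v)"
      using lip B Je[OF v] v JS by auto
    also have "\<dots> \<le> L * norm (?d w)" using w(2)[OF v] \<open>0 < L\<close> by simp
    finally have "norm (X (c v) - X (c' v)) \<le> L * norm (?d w)" .
    then show "onorm (\<lambda>h :: real. h *\<^sub>R (X (c v) - X (c' v))) \<le> L * norm (?d w)"
      using \<open>0 < L\<close> by (intro onorm_bound) (auto simp: mult.commute[of _ "\<bar>_\<bar>"] intro: mult_left_mono)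
  qed
  also have "\<dots> \<le> (L * norm (?d w)) * e"
    using Je[OF w(1)] \<open>0 < L\<close> by (intro mult_left_mono) (auto simp: dist_norm)
  also have "\<dots> = (e * L) * norm (?d w)" by simp
  also have "\<dots> \<le> 1 / 2 * norm (?d w)" by (rule mult_right_mono[OF e]) simp
  finally have "norm (?d w) \<le> 0" using \<open>c u0 = c' u0\<close> by simp
  then show ?thesis using w(2)[of u] by simp
qed

text \<open>The set of times at which the curves agree is closed by continuity and open by the local
  statement, and the convex set \<open>S\<close> is connected.\<close>

lemma integral_curve_unique:
  assumes X: "Ck_on 1 X D" and c: "integral_curve D X S c" and c': "integral_curve D X S c'"
    and "convex S" "t0 \<in> S" "c t0 = c' t0" "t \<in> S"
  shows "c t = c' t"
proof -
  let ?A = "{u \<in> S. c u - c' u = 0}"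
  note cont = integral_curve_continuous[OF c] integral_curve_continuous[OF c']
  have "closedin (top_of_set S) ?A"
    by (intro continuous_closedin_preimage_constant continuous_intros cont)
  moreover have "openin (top_of_set S) ?A"
    unfolding openin_euclidean_subtopology_iff
  proof (intro conjI ballI)
    fix u0 assume "u0 \<in> ?A"
    then have u0: "u0 \<in> S" "c u0 = c' u0" by auto
    obtain \<rho> L where \<rho>: "0 < \<rho>" "0 < L"
      "\<And>a b. a \<in> ball (c u0) \<rho> \<Longrightarrow> b \<in> ball (c u0) \<rho> \<Longrightarrow> norm (X a - X b) \<le> L * norm (a - b)"
      using C1_locally_lipschitz[OF X, of "c u0"] c u0(1) unfolding integral_curve_def by metis
    obtain e1 where e1: "0 < e1" "\<And>v. v \<in> S \<Longrightarrow> dist v u0 < e1 \<Longrightarrow> dist (c v) (c u0) < \<rho>"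
      using cont(1) u0(1) \<rho>(1) unfolding continuous_on_iff by meson
    obtain e2 where e2: "0 < e2" "\<And>v. v \<in> S \<Longrightarrow> dist v u0 < e2 \<Longrightarrow> dist (c' v) (c' u0) < \<rho>"
      using cont(2) u0(1) \<rho>(1) unfolding continuous_on_iff by meson
    define e where "e = min (min e1 e2) (1 / (2 * L))"
    have "e * L \<le> 1 / (2 * L) * L" using \<rho>(2) by (intro mult_right_mono) (auto simp: e_def)
    then have e: "0 < e" "e * L \<le> 1 / 2" using e1(1) e2(1) \<rho>(2) by (auto simp: e_def)
    have B: "c v \<in> ball (c u0) \<rho>" "c' v \<in> ball (c u0) \<rho>" if "v \<in> S" "dist v u0 < e" for v
      using e1(2)[OF that(1)] e2(2)[OF that(1)] that(2) u0(2)
      by (auto simp: e_def dist_commute)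
    have "c u = c' u" if "u \<in> S" "dist u u0 < e" for u
      by (rule integral_curves_agree_locally[OF c c' \<open>convex S\<close> \<rho>(3,2) e(2) B u0(1) that u0(2)])
    then show "\<exists>e>0. \<forall>u\<in>S. dist u u0 < e \<longrightarrow> u \<in> ?A" using e(1) by auto
  qed auto
  moreover have "connected S" using \<open>convex S\<close> by (rule convex_connected)
  ultimately have "?A = {} \<or> ?A = S" by (auto simp: connected_clopen)
  then show ?thesis using assms(5-7) by auto
qed

lemma flow_eq:
  assumes "Ck_on 1 X D" and c: "integral_curve D X (closed_segment 0 t) c"
  shows "flow D X t (c 0) = Some (c t)"
proof -
  have "(THE y. \<exists>c'. integral_curve D X (closed_segment 0 t) c' \<and> c' 0 = c 0 \<and> c' t = y) = c t"
  proof (rule the_equality)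
    fix y assume "\<exists>c'. integral_curve D X (closed_segment 0 t) c' \<and> c' 0 = c 0 \<and> c' t = y"
    then obtain c' where c': "integral_curve D X (closed_segment 0 t) c'" "c' 0 = c 0" "c' t = y" by blast
    show "y = c t"
      using integral_curve_unique[OF assms(1) c'(1) c, of 0 t] c' by simp
  qed (use c in blast)
  then show ?thesis using c unfolding flow_def by auto
qed

context flow_family
begin

lemma solves_pval:
  assumes "solves \<tau> (const_bcontfun x) u"
  shows "pval u \<beta> \<sigma> = x + weighted_sum (reach \<beta> 0) \<tau> (velocity u) + \<tau> \<beta> *\<^sub>R segment_integral (velocity u) \<beta> \<sigma>"
proof -
  have "pval u \<beta> \<sigma> = pval (const_bcontfun x + volterra \<tau> (velocity u)) \<beta> \<sigma>"
    using assms by (metis solves_def)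
  then show ?thesis
    by (simp add: volterra_apply weighted_sum_reach[of \<beta> \<sigma>] const_bcontfun.rep_eq)
qed

lemma solves_flow:
  assumes u: "solves \<tau> (const_bcontfun x) u" and D: "Ck_on 1 (X \<beta>) D" "V \<subseteq> D"
  shows "flow D (X \<beta>) (\<tau> \<beta>) (pval u \<beta> 0) = Some (pval u \<beta> 1)"
proof -
  have inner: "u \<in> inner_paths" using u by (simp add: solves_def)
  \<comment> \<open>The step with index \<open>\<beta>\<close> runs in flow time
    \<open>v = \<sigma> * \<tau> \<beta>\<close>, for either sign of \<open>\<tau> \<beta>\<close>.
    If \<open>\<tau> \<beta> = 0\<close>, division by zero makes \<open>c\<close> constant, and the
    segment is a single point, where every derivative condition holds.\<close>
  define c where "c v = pval u \<beta> (v / \<tau> \<beta>)" for v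
  have "integral_curve D (X \<beta>) (closed_segment 0 (\<tau> \<beta>)) c"
    unfolding integral_curve_def
  proof
    fix v assume v: "v \<in> closed_segment 0 (\<tau> \<beta>)"
    show "c v \<in> D \<and> (c has_vector_derivative X \<beta> (c v)) (at v within closed_segment 0 (\<tau> \<beta>))"
    proof
      show "c v \<in> D" using inner_pathsD[OF inner] D(2) by (auto simp: c_def)
      show "(c has_vector_derivative X \<beta> (c v)) (at v within closed_segment 0 (\<tau> \<beta>))"
      proof (cases "\<tau> \<beta> = 0")
        case True
        then have "at v within closed_segment 0 (\<tau> \<beta>) = bot" using v by (simp add: at_within_def inf_principal flip: principal_eq_bot_iff)
        then show ?thesis by (simp add: has_vector_derivative_def has_derivative_bot bounded_linear_scaleR_left)
      next
        case False
        have im: "(\<lambda>v. v / \<tau> \<beta>) ` closed_segment 0 (\<tau> \<beta>) \<subseteq> {0..1}"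
          using False by (auto simp: closed_segment_def)
        then have v01: "v / \<tau> \<beta> \<in> {0..1}" using v by blast
        let ?w = "velocity u"
        have "((\<lambda>\<sigma>. integral {0..\<sigma>} (\<lambda>\<rho>. pval ?w \<beta> \<rho>)) has_vector_derivative pval ?w \<beta> (v / \<tau> \<beta>))
            (at (v / \<tau> \<beta>) within {0..1})"
          by (rule integral_has_vector_derivative[OF continuous_on_pval v01])
        then have "((\<lambda>\<sigma>. x + weighted_sum (reach \<beta> 0) \<tau> ?w + \<tau> \<beta> *\<^sub>R integral {0..\<sigma>} (\<lambda>\<rho>. pval ?w \<beta> \<rho>))
            has_vector_derivative \<tau> \<beta> *\<^sub>R pval ?w \<beta> (v / \<tau> \<beta>)) (at (v / \<tau> \<beta>) within {0..1})"
          by (auto intro!: derivative_eq_intros)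
        then have "(pval u \<beta> has_vector_derivative \<tau> \<beta> *\<^sub>R X \<beta> (c v)) (at (v / \<tau> \<beta>) within {0..1})"
          unfolding velocity_apply[OF inner] c_def
        proof (rule has_vector_derivative_transform[OF v01, rotated])
          fix \<sigma> :: real assume "\<sigma> \<in> {0..1}"
          then have "clamp01 \<sigma> = \<sigma>" by auto
          then show "pval u \<beta> \<sigma> = x + weighted_sum (reach \<beta> 0) \<tau> ?w +
              \<tau> \<beta> *\<^sub>R integral {0..\<sigma>} (\<lambda>\<rho>. X \<beta> (pval u \<beta> \<rho>))"
            by (subst solves_pval[OF u]) (simp add: segment_integral_def velocity_apply[OF inner])
        qed
        then have D1: "(pval u \<beta> has_vector_derivative \<tau> \<beta> *\<^sub>R X \<beta> (c v))
            (at (v / \<tau> \<beta>) within (\<lambda>v. v / \<tau> \<beta>) ` closed_segment 0 (\<tau> \<beta>))"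
          using im by (rule has_vector_derivative_within_subset)
        have D2: "((\<lambda>v. v / \<tau> \<beta>) has_vector_derivative 1 / \<tau> \<beta>) (at v within closed_segment 0 (\<tau> \<beta>))"
          using False by (auto intro!: derivative_eq_intros simp: divide_inverse)
        show ?thesis
          using vector_diff_chain_within[OF D2 D1] False by (simp add: o_def c_def[abs_def])
      qed
    qed
  qed
  from flow_eq[OF D(1) this] have "flow D (X \<beta>) (\<tau> \<beta>) (c 0) = Some (c (\<tau> \<beta>))" .
  moreover have "c 0 = pval u \<beta> 0" by (simp add: c_def)
  moreover have "c (\<tau> \<beta>) = pval u \<beta> 1"
    by (cases "\<tau> \<beta> = 0") (simp_all add: c_def solves_pval[OF u])
  ultimately show ?thesis by simp
qed

lemma weighted_sum_finite:
  fixes \<tau> :: "'i ell1" and w :: "('i, 'e) path"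
  assumes "finite F" "\<And>\<gamma>. \<tau> \<gamma> \<noteq> 0 \<Longrightarrow> \<theta> \<gamma> \<noteq> 0 \<Longrightarrow> \<gamma> \<in> F" "\<And>\<gamma>. \<gamma> \<in> F \<Longrightarrow> \<theta> \<gamma> = 1"
  shows "weighted_sum \<theta> \<tau> w = (\<Sum>\<gamma>\<in>F. \<tau> \<gamma> *\<^sub>R segment_integral w \<gamma> 1)"
proof -
  have "weighted_sum \<theta> \<tau> w = (\<Sum>\<^sub>\<infinity>\<gamma>\<in>F. \<tau> \<gamma> *\<^sub>R segment_integral w \<gamma> 1)"
    unfolding weighted_sum_def
  proof (rule infsum_cong_neutral)
    show "\<tau> \<gamma> *\<^sub>R segment_integral w \<gamma> (\<theta> \<gamma>) = 0" if "\<gamma> \<in> UNIV - F" for \<gamma>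
      using assms(2)[of \<gamma>] that by (cases "\<tau> \<gamma> = 0"; cases "\<theta> \<gamma> = 0") auto
  qed (auto simp: assms(3))
  then show ?thesis using assms(1) by simp
qed

text \<open>Indices outside the list carry no time. Hence before the step \<open>a\<close> exactly
  the indices preceding it in the list have contributed, and \<open>pval u a 0\<close> is the point
  reached by the composition so far; \<open>solves_flow\<close> performs the next step.\<close>

lemma forward_comp_reaches:
  assumes D: "\<And>\<alpha>. Ck_on 1 (X \<alpha>) (D \<alpha>)" "\<And>\<alpha>. V \<subseteq> D \<alpha>"
    and "sorted_wrt lt is" "support \<tau> \<subseteq> set is" "reaches \<tau> x y"
  shows "forward_comp D X \<tau> is x = Some y"
proof -
  obtain u where u: "solves \<tau> (const_bcontfun x) u" "y = x + weighted_sum (\<lambda>_. 1) \<tau> (velocity u)"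
    using assms(5) by (auto simp: reaches_def)
  let ?a = "\<lambda>\<gamma>. \<tau> \<gamma> *\<^sub>R segment_integral (velocity u) \<gamma> 1"
  have "forward_comp D X \<tau> js x = Some (x + sum ?a (set js))" if "is = js @ ks" for js ks
    using that
  proof (induction js arbitrary: ks rule: rev_induct)
    case Nil
    then show ?case by (simp add: forward_comp_def)
  next
    case (snoc a js)
    have sorted: "sorted_wrt lt (js @ a # ks)" using assms(3) snoc.prems by simp
    then have lts: "\<And>\<gamma>. \<gamma> \<in> set js \<Longrightarrow> lt \<gamma> a" "\<And>\<gamma>. \<gamma> \<in> set ks \<Longrightarrow> lt a \<gamma>"
      by (auto simp: sorted_wrt_append)
    have "weighted_sum (reach a 0) \<tau> (velocity u) = sum ?a (set js)"
    proof (rule weighted_sum_finite)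
      fix \<gamma> assume "\<tau> \<gamma> \<noteq> 0" "reach a 0 \<gamma> \<noteq> 0"
      then have "\<gamma> \<in> set is" "lt \<gamma> a"
        using assms(4) by (auto simp: support_def reach_def split: if_splits)
      then show "\<gamma> \<in> set js"
        using snoc.prems lts(2)[of \<gamma>] lt_irrefl lt_trans[of \<gamma> a \<gamma>] by auto
    qed (use lts in \<open>auto simp: reach_def\<close>)
    then have "pval u a 0 = x + sum ?a (set js)" "pval u a 1 = x + sum ?a (set js) + ?a a"
      by (simp_all add: solves_pval[OF u(1)])
    moreover have "a \<notin> set js" using lts(1) lt_irrefl by blast
    moreover have "forward_comp D X \<tau> js x = Some (x + sum ?a (set js))"
      by (rule snoc.IH[of "a # ks"]) (use snoc.prems in simp)
    moreover have "forward_comp D X \<tau> (js @ [a]) = flow (D a) (X a) (\<tau> a) \<circ>\<^sub>m forward_comp D X \<tau> js"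
      by (simp add: forward_comp_def)
    ultimately show ?case
      using solves_flow[OF u(1) D, of a] by (simp add: map_comp_def add_ac)
  qed
  from this[of "is" "[]"] have "forward_comp D X \<tau> is x = Some (x + sum ?a (set is))" by simp
  moreover have "weighted_sum (\<lambda>_. 1) \<tau> (velocity u) = sum ?a (set is)"
    by (rule weighted_sum_finite) (use assms(4) in \<open>auto simp: support_def\<close>)
  ultimately show ?thesis by (simp add: u(2))
qed

end


subsection \<open>Limits of ordered compositions\<close>

definition ell1_restrict :: "'i ell1 \<Rightarrow> 'i set \<Rightarrow> 'i ell1" where
  "ell1_restrict \<tau> F = Ell1 (\<lambda>i. if i \<in> F then \<tau> i else 0)"

lemma ell1_restrict_apply: "ell1_apply (ell1_restrict \<tau> F) i = (if i \<in> F then \<tau> i else 0)"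
proof -
  have "(\<lambda>i. \<bar>if i \<in> F then \<tau> i else 0\<bar>) summable_on UNIV"
    by (rule summable_on_comparison_test[OF ell1_summable[of \<tau>]]) auto
  then have "ell1_apply (Ell1 (\<lambda>i. if i \<in> F then \<tau> i else 0)) = (\<lambda>i. if i \<in> F then \<tau> i else 0)"
    by (intro Ell1_inverse) simp
  then show ?thesis by (simp add: ell1_restrict_def)
qed

text \<open>The distance to \<open>\<tau>\<close> is the tail \<open>norm \<tau>\<close> minus the
  partial sum over \<open>F\<close>, and these partial sums converge to \<open>norm \<tau>\<close>
  since \<open>\<tau>\<close> is concentrated on \<open>B\<close>.\<close>

lemma tendsto_ell1_restrict:
  assumes "support \<tau> \<subseteq> B"
  shows "((\<lambda>F. ell1_restrict \<tau> F) \<longlongrightarrow> \<tau>) (finite_subsets_at_top B)"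
proof -
  have "norm \<tau> = (\<Sum>\<^sub>\<infinity>i\<in>B. \<bar>\<tau> i\<bar>)"
    unfolding norm_ell1.rep_eq
    by (rule infsum_cong_neutral) (use assms in \<open>auto simp: support_def\<close>)
  moreover have "(\<lambda>i. \<bar>\<tau> i\<bar>) summable_on B"
    by (rule summable_on_subset_banach[OF ell1_summable]) simp
  ultimately have "((\<lambda>i. \<bar>\<tau> i\<bar>) has_sum norm \<tau>) B" by (simp add: has_sum_infsum)
  then have lim: "((\<lambda>F. norm \<tau> - (\<Sum>i\<in>F. \<bar>\<tau> i\<bar>)) \<longlongrightarrow> norm \<tau> - norm \<tau>) (finite_subsets_at_top B)"
    unfolding has_sum_def by (intro tendsto_intros)
  have eq: "norm (ell1_restrict \<tau> F - \<tau>) = norm \<tau> - (\<Sum>i\<in>F. \<bar>\<tau> i\<bar>)" if "finite F" for F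
  proof -
    have S: "((\<lambda>i. if i \<in> F then \<bar>\<tau> i\<bar> else 0) has_sum (\<Sum>i\<in>F. \<bar>\<tau> i\<bar>)) UNIV"
      by (rule has_sum_finite_neutralI[OF that]) auto
    have "((\<lambda>i. \<bar>ell1_apply (ell1_restrict \<tau> F - \<tau>) i\<bar>) has_sum norm (ell1_restrict \<tau> F - \<tau>)) UNIV"
      unfolding norm_ell1.rep_eq by (rule has_sum_infsum[OF ell1_summable])
    from has_sum_add[OF this S]
    have "((\<lambda>i. \<bar>\<tau> i\<bar>) has_sum norm (ell1_restrict \<tau> F - \<tau>) + (\<Sum>i\<in>F. \<bar>\<tau> i\<bar>)) UNIV"
      by (rule has_sum_cong[THEN iffD1, rotated]) (simp add: ell1_restrict_apply)
    then have "norm \<tau> = norm (ell1_restrict \<tau> F - \<tau>) + (\<Sum>i\<in>F. \<bar>\<tau> i\<bar>)"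
      unfolding norm_ell1.rep_eq[of \<tau>] by (rule infsumI)
    then show ?thesis by simp
  qed
  have "((\<lambda>F. norm (ell1_restrict \<tau> F - \<tau>)) \<longlongrightarrow> 0) (finite_subsets_at_top B)"
  proof (rule Lim_transform_eventually)
    show "((\<lambda>F. norm \<tau> - (\<Sum>i\<in>F. \<bar>\<tau> i\<bar>)) \<longlongrightarrow> 0) (finite_subsets_at_top B)"
      using lim by simp
    show "\<forall>\<^sub>F F in finite_subsets_at_top B. norm \<tau> - (\<Sum>i\<in>F. \<bar>\<tau> i\<bar>) = norm (ell1_restrict \<tau> F - \<tau>)"
      by (rule eventually_finite_subsets_at_top_weakI) (simp add: eq)
  qed
  then show ?thesis by (simp add: tendsto_norm_zero_iff LIM_zero_iff)
qed

lemma index_lists_nontrivial: "index_lists B \<noteq> bot"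
  by (simp add: index_lists_def filtermap_bot_iff)

lemma index_lists_sorted: "\<forall>\<^sub>F is in index_lists B. sorted_wrt (<) is"
proof (cases "\<exists>e::nat \<Rightarrow> 'a. strict_mono e \<and> range e = B")
  case True
  then obtain e :: "nat \<Rightarrow> 'a" where e: "strict_mono e" "B = range e" by blast
  have "sorted_wrt (<) (map e [0..<m])" for m
    unfolding sorted_wrt_map
    by (rule sorted_wrt_mono_rel[OF _ sorted_wrt_upt]) (use e in \<open>auto simp: strict_mono_def\<close>)
  then show ?thesis
    by (simp add: e index_lists_nat eventually_filtermap)
next
  case False
  then show ?thesis
    unfolding index_lists_def if_not_P[OF False] eventually_filtermap
    by (intro eventually_finite_subsets_at_top_weakI) simp
qed

text \<open>This, sortedness and nontriviality of the filter are all that the convergence proof uses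
  of \<open>index_lists\<close>; the two cases of its definition need no separate treatment
  afterwards.\<close>

lemma index_lists_filterlim: "filterlim set (finite_subsets_at_top B) (index_lists B)"
proof (cases "\<exists>e::nat \<Rightarrow> 'a. strict_mono e \<and> range e = B")
  case True
  then obtain e :: "nat \<Rightarrow> 'a" where e: "strict_mono e" "B = range e" by blast
  have "filterlim (\<lambda>m. set (map e [0..<m])) (finite_subsets_at_top B) sequentially"
    unfolding filterlim_finite_subsets_at_top
  proof (intro allI impI)
    fix F assume F: "finite F \<and> F \<subseteq> B"
    then obtain N where N: "finite N" "F = e ` N"
      unfolding e(2) by (meson finite_subset_image subset_UNIV)
    obtain m where m: "\<forall>n\<in>N. n < m" using N(1) finite_nat_set_iff_bounded by blast
    show "\<forall>\<^sub>F m in sequentially. finite (set (map e [0..<m])) \<and> F \<subseteq> set (map e [0..<m]) \<and> set (map e [0..<m]) \<subseteq> B"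
      by (rule eventually_sequentiallyI[of m]) (use m N(2) e(2) in \<open>force intro!: imageI\<close>)
  qed
  then show ?thesis
    by (simp add: e index_lists_nat filterlim_filtermap o_def)
next
  case False
  have "filterlim (\<lambda>F. set (sorted_list_of_set F)) (finite_subsets_at_top B) (finite_subsets_at_top B)"
    by (rule filterlim_cong[THEN iffD1, OF refl refl _ filterlim_ident])
      (auto intro!: eventually_finite_subsets_at_top_weakI)
  then show ?thesis
    unfolding index_lists_def if_not_P[OF False] by (simp add: filterlim_filtermap o_def)
qed

lemma partial_lim_eqI:
  fixes f :: "'l \<Rightarrow> 'e::t2_space option"
  assumes "F \<noteq> bot" "partial_tendsto f y F"
  shows "partial_lim F f = Some y"
proof -
  have "(THE y. partial_tendsto f y F) = y"
  proof (rule the_equality)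
    show "partial_tendsto f y F" by fact
    show "z = y" if "partial_tendsto f z F" for z
      using that assms(2) unfolding partial_tendsto_def by (blast intro: tendsto_unique[OF assms(1)])
  qed
  then show ?thesis using assms(2) by (auto simp: partial_lim_def)
qed

lemma forward_comp_cong:
  assumes "\<And>\<alpha>. \<alpha> \<in> set is \<Longrightarrow> ell1_apply \<tau> \<alpha> = ell1_apply \<tau>' \<alpha>"
  shows "forward_comp D X \<tau> is = forward_comp D X \<tau>' is"
  unfolding forward_comp_def by (rule fold_cong) (use assms in auto)

context flow_family
begin

text \<open>A partial composition is the endpoint for a restriction of \<open>\<tau>\<close> to a
  finite set, given by the continuous local selection \<open>P\<close>. Since the limit is
  determined by \<open>\<tau>\<close> and \<open>x\<close>, so is every endpoint \<open>y\<close>.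
  The function \<open>g\<close> is the identity for forward compositions and \<open>rev\<close> for
  backward ones.\<close>

lemma partial_lim_forward_comp:
  assumes D: "\<And>\<alpha>. Ck_on 1 (X \<alpha>) (D \<alpha>)" "\<And>\<alpha>. V \<subseteq> D \<alpha>"
    and Fl: "Fl \<noteq> bot" "\<forall>\<^sub>F is in Fl. sorted_wrt lt (g is)"
      "filterlim (\<lambda>is. set (g is)) (finite_subsets_at_top B) Fl"
    and "support \<tau> \<subseteq> B" "reaches \<tau> x y"
  shows "partial_lim Fl (\<lambda>is. forward_comp D X \<tau> (g is) x) = Some y"
proof (rule partial_lim_eqI[OF Fl(1)])
  obtain T P where P: "open T" "(\<tau>, x) \<in> T" "Ck_on (Suc s) P T" "P (\<tau>, x) = y"
    "\<And>\<tau> x. (\<tau>, x) \<in> T \<Longrightarrow> reaches \<tau> x (P (\<tau>, x))"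
    using reaches_smooth[OF assms(7)] by metis
  let ?\<tau> = "\<lambda>is. ell1_restrict \<tau> (set (g is))"
  have lim: "((\<lambda>is. (?\<tau> is, x)) \<longlongrightarrow> (\<tau>, x)) Fl"
    by (intro tendsto_Pair tendsto_const filterlim_compose[OF tendsto_ell1_restrict[OF assms(6)] Fl(3)])
  then have "\<forall>\<^sub>F is in Fl. (?\<tau> is, x) \<in> T"
    using P(1,2) by (rule topological_tendstoD)
  then have ev: "\<forall>\<^sub>F is in Fl. forward_comp D X \<tau> (g is) x = Some (P (?\<tau> is, x))"
    using Fl(2)
  proof eventually_elim
    case (elim "is")
    have "forward_comp D X (?\<tau> is) (g is) x = Some (P (?\<tau> is, x))"
      by (rule forward_comp_reaches[OF D elim(2) _ P(5)[OF elim(1)]])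
        (auto simp: support_def ell1_restrict_apply split: if_splits)
    also have "forward_comp D X (?\<tau> is) (g is) = forward_comp D X \<tau> (g is)"
      by (rule forward_comp_cong) (simp add: ell1_restrict_apply)
    finally show ?case .
  qed
  have "isCont P (\<tau>, x)"
    using Ck_on_continuous[OF P(3)] P(1,2) by (simp add: continuous_on_eq_continuous_at)
  from isCont_tendsto_compose[OF this lim]
  have "((\<lambda>is. P (?\<tau> is, x)) \<longlongrightarrow> P (\<tau>, x)) Fl" .
  then have "((\<lambda>is. the (forward_comp D X \<tau> (g is) x)) \<longlongrightarrow> y) Fl"
    unfolding P(4)
    by (rule Lim_transform_eventually) (use ev in \<open>auto elim!: eventually_mono\<close>)
  then show "partial_tendsto (\<lambda>is. forward_comp D X \<tau> (g is) x) y Fl"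
    unfolding partial_tendsto_def using ev by (auto elim!: eventually_mono)
qed

end

lemma backward_comp_eq: "backward_comp D X \<tau> is = forward_comp D X (- \<tau>) (rev is)"
  by (simp add: backward_comp_def forward_comp_def foldr_conv_fold)


subsection \<open>Time reversal\<close>

lemma strict_total_order_reverse:
  assumes "strict_total_order lt"
  shows "strict_total_order (\<lambda>a b. lt b a)"
proof -
  interpret strict_total_order lt by fact
  show ?thesis
  proof
    show "lt c a" if "lt b a" "lt c b" for a b c by (rule lt_trans[OF that(2,1)])
    show "lt b a \<or> a = b \<or> lt a b" for a b using lt_total[of a b] by auto
  qed (rule lt_irrefl)
qed

context flow_family
begin

lemma flow_family_reverse: "flow_family (\<lambda>a b. lt b a) X V k s"
  by (rule flow_family.intro[OF strict_total_order_reverse[OF strict_total_order_axioms] bounded_family_axioms])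

lemma segment_integral_reverse:
  fixes v w :: "('i, 'e) path"
  assumes vw: "\<And>\<beta> \<sigma>. pval v \<beta> \<sigma> = pval w \<beta> (1 - \<sigma>)" and "0 \<le> \<theta>" "\<theta> \<le> 1"
  shows "segment_integral v \<beta> \<theta> = segment_integral w \<beta> 1 - segment_integral w \<beta> (1 - \<theta>)"
proof -
  have "integral {0..\<theta>} (\<lambda>\<rho>. pval v \<beta> \<rho>) = integral {-0..- (- \<theta>)} (\<lambda>\<rho>. pval w \<beta> (- \<rho> + 1))"
    by (simp add: vw)
  also have "\<dots> = integral {- \<theta>..0} (\<lambda>\<rho>. pval w \<beta> (\<rho> + 1))"
    by (rule Henstock_Kurzweil_Integration.integral_reflect_real)
  also have "\<dots> = integral {(1 - \<theta>) - 1..1 - 1} (\<lambda>\<rho>. pval w \<beta> (\<rho> + 1))" by simp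
  also have "\<dots> = integral {1 - \<theta>..1} (\<lambda>\<rho>. pval w \<beta> \<rho>)"
    by (rule integral_shift_real_ivl)
  also have "\<dots> = integral {0..1} (\<lambda>\<rho>. pval w \<beta> \<rho>) - integral {0..1 - \<theta>} (\<lambda>\<rho>. pval w \<beta> \<rho>)"
  proof -
    have "integral {0..1 - \<theta>} (\<lambda>\<rho>. pval w \<beta> \<rho>) + integral {1 - \<theta>..1} (\<lambda>\<rho>. pval w \<beta> \<rho>) =
        integral {0..1} (\<lambda>\<rho>. pval w \<beta> \<rho>)"
      by (rule Henstock_Kurzweil_Integration.integral_combine[OF _ _ pval_integrable]) (use assms in auto)
    then show ?thesis by (simp add: algebra_simps)
  qed
  finally show ?thesis
    using assms(2,3) by (simp add: segment_integral_def min_def max_def)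
qed

lemma weighted_sum_reverse:
  fixes v w :: "('i, 'e) path"
  assumes vw: "\<And>\<beta> \<sigma>. pval v \<beta> \<sigma> = pval w \<beta> (1 - \<sigma>)" and \<theta>: "\<And>\<gamma>. 0 \<le> \<theta> \<gamma>" "\<And>\<gamma>. \<theta> \<gamma> \<le> 1"
  shows "weighted_sum \<theta> \<tau> v = weighted_sum (\<lambda>_. 1) \<tau> w - weighted_sum (\<lambda>\<gamma>. 1 - \<theta> \<gamma>) \<tau> w"
proof -
  have "weighted_sum \<theta> \<tau> v + weighted_sum (\<lambda>\<gamma>. 1 - \<theta> \<gamma>) \<tau> w =
      (\<Sum>\<^sub>\<infinity>\<gamma>. \<tau> \<gamma> *\<^sub>R segment_integral v \<gamma> (\<theta> \<gamma>) + \<tau> \<gamma> *\<^sub>R segment_integral w \<gamma> (1 - \<theta> \<gamma>))"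
    unfolding weighted_sum_def by (rule infsum_add[OF weighted_sum_summable weighted_sum_summable, symmetric])
  also have "\<dots> = weighted_sum (\<lambda>_. 1) \<tau> w"
    unfolding weighted_sum_def
    by (rule infsum_cong) (simp add: segment_integral_reverse[OF vw \<theta>] scaleR_diff_right)
  finally show ?thesis by (simp add: algebra_simps)
qed

text \<open>Each step of \<open>u\<close> is read backwards. What the reversed order has already
  performed is the complement of what the original order has performed, so its contribution, with
  the sign of \<open>- \<tau>\<close>, is subtracted from the endpoint \<open>y\<close>.\<close>

lemma reaches_reverse:
  assumes "reaches \<tau> x y"
  shows "flow_family.reaches (\<lambda>a b. lt b a) X V (- \<tau>) y x"
proof -
  interpret reverse: flow_family "\<lambda>a b. lt b a" X V k s by (rule flow_family_reverse)
  obtain u where u: "solves \<tau> (const_bcontfun x) u" "y = x + weighted_sum (\<lambda>_. 1) \<tau> (velocity u)"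
    using assms by (auto simp: reaches_def)
  have inner: "u \<in> inner_paths" using u(1) by (simp add: solves_def)
  let ?w = "velocity u"
  define v :: "('i, 'e) path" where "v = Bcontfun (\<lambda>p. pval u (of_discrete (fst p)) (1 - snd p))"
  have v: "pval v \<beta> \<sigma> = pval u \<beta> (1 - \<sigma>)" for \<beta> \<sigma>
  proof -
    have "apply_bcontfun v = (\<lambda>p. pval u (of_discrete (fst p)) (1 - snd p))"
      unfolding v_def
    proof (rule bcontfun_discrete_timesI)
      show "continuous_on UNIV (\<lambda>\<sigma>. pval u (of_discrete (fst (discrete \<beta>, \<sigma>))) (1 - snd (discrete \<beta>, \<sigma>)))" for \<beta>
        unfolding fst_conv snd_conv discrete_inverse[OF UNIV_I]
        by (rule continuous_on_compose2[OF continuous_on_pval[of UNIV]]) (auto intro!: continuous_intros)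
    qed (rule norm_bounded)
    then show ?thesis by (simp add: discrete_inverse)
  qed
  have inner_v: "v \<in> inner_paths" using inner by (auto simp: inner_paths_def v)
  have vel: "pval (velocity v) \<beta> \<sigma> = pval ?w \<beta> (1 - \<sigma>)" for \<beta> \<sigma>
    by (simp add: velocity_apply inner inner_v v)
  have r: "weighted_sum (reverse.reach \<beta> \<sigma>) \<tau> (velocity v) =
      weighted_sum (\<lambda>_. 1) \<tau> ?w - weighted_sum (reach \<beta> (1 - \<sigma>)) \<tau> ?w" for \<beta> \<sigma>
  proof -
    \<comment> \<open>This holds for all real \<open>\<sigma>\<close>, because clamping
      \<open>1 - \<sigma>\<close> gives 1 minus the clamped \<open>\<sigma>\<close>.\<close>
    have "1 - reverse.reach \<beta> \<sigma> \<gamma> = reach \<beta> (1 - \<sigma>) \<gamma>" for \<gamma>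
      using lt_total[of \<gamma> \<beta>] lt_irrefl[of \<gamma>] lt_trans[of \<gamma> \<beta> \<gamma>]
      by (auto simp: reach_def reverse.reach_def)
    then show ?thesis
      using weighted_sum_reverse[OF vel, of "reverse.reach \<beta> \<sigma>" \<tau>] reverse.reach_bounds by simp
  qed
  interpret S: bounded_bilinear "weighted_sum \<theta> :: 'i ell1 \<Rightarrow> ('i, 'e) path \<Rightarrow> 'e" for \<theta>
    by (rule bounded_bilinear_weighted_sum)
  have "reverse.solves (- \<tau>) (const_bcontfun y) v"
    unfolding reverse.solves_def
  proof (intro conjI inner_v path_eqI)
    fix \<beta> \<sigma>
    have "pval u \<beta> (1 - \<sigma>) = pval (const_bcontfun x + volterra \<tau> ?w) \<beta> (1 - \<sigma>)"
      using u(1) by (metis solves_def)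
    then show "pval v \<beta> \<sigma> = pval (const_bcontfun y + reverse.volterra (- \<tau>) (velocity v)) \<beta> \<sigma>"
      by (simp add: v volterra_apply reverse.volterra_apply const_bcontfun.rep_eq S.minus_left r u(2))
  qed
  moreover have "weighted_sum (\<lambda>_. 1) \<tau> (velocity v) = weighted_sum (\<lambda>_. 1) \<tau> ?w - weighted_sum (\<lambda>_. 0) \<tau> ?w"
    using weighted_sum_reverse[OF vel, of "\<lambda>_. 1" \<tau>] by simp
  then have "x = y + weighted_sum (\<lambda>_. 1) (- \<tau>) (velocity v)"
    by (simp add: S.minus_left u(2)) (simp add: weighted_sum_def)
  ultimately show ?thesis unfolding reverse.reaches_def by blast
qed

end


subsection \<open>Smoothness and openness of ordered compositions\<close>

lemma norm_mconst_le: "norm (mconst c :: ('a::real_normed_vector, 'b::real_normed_vector) multilin) \<le> norm c"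
  by (rule norm_multilin_bound) (auto simp: mconst_apply)

lemma norm_nth_deriv_le_jet_norm:
  assumes "m \<le> n"
  shows "norm (nth_deriv m f y) \<le> jet_norm n f y"
proof (cases m)
  case 0
  have "norm (nth_deriv 0 f y) \<le> norm (f y)" by (simp add: nth_deriv_0 norm_mconst_le)
  also have "\<dots> \<le> jet_norm n f y" by (simp add: jet_norm_def sum_nonneg)
  finally show ?thesis by (simp add: 0)
next
  case (Suc l)
  then have "norm (nth_deriv m f y) \<le> (\<Sum>j=1..n. norm (nth_deriv j f y))"
    using assms by (intro member_le_sum) auto
  also have "\<dots> \<le> jet_norm n f y" by (simp add: jet_norm_def)
  finally show ?thesis .
qed

context flow_family
begin

text \<open>The local smooth selections of \<open>reaches_smooth\<close> all coincide with
  \<open>f\<close> by uniqueness, so they glue. The parametrization \<open>j\<close> allows varying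
  the point for fixed \<open>\<tau>\<close>, or \<open>\<tau>\<close> for a fixed point.\<close>

lemma Ck_on_reaches:
  fixes j :: "'z::real_normed_vector \<Rightarrow> 'i ell1 \<times> 'e"
  assumes j: "Ck_on s j U"
    and reach: "\<And>z. z \<in> U \<Longrightarrow> reaches (fst (j z)) (snd (j z)) (f z)"
    and uniq: "\<And>z y. z \<in> U \<Longrightarrow> reaches (fst (j z)) (snd (j z)) y \<Longrightarrow> y = f z"
  shows "Ck_on s f U"
proof (rule Ck_on_local)
  fix z0 assume z0: "z0 \<in> U"
  obtain T P where P: "open T" "(fst (j z0), snd (j z0)) \<in> T" "Ck_on (Suc s) P T"
    "\<And>\<tau> x. (\<tau>, x) \<in> T \<Longrightarrow> reaches \<tau> x (P (\<tau>, x))"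
    using reaches_smooth[OF reach[OF z0]] by metis
  let ?Q = "U \<inter> j -` T"
  have Q: "open ?Q"
    by (rule continuous_open_preimage[OF Ck_on_continuous[OF j] Ck_onD(1)[OF j] P(1)])
  have "Ck_on s (\<lambda>z. P (j z)) ?Q"
    by (rule Ck_on_compose[OF Ck_on_subset[OF j Q] Ck_on_mono[OF P(3)]]) auto
  then have "Ck_on s f ?Q"
  proof (rule Ck_on_cong[rotated])
    fix z assume z: "z \<in> ?Q"
    then have "reaches (fst (j z)) (snd (j z)) (P (j z))"
      using P(4)[of "fst (j z)" "snd (j z)"] by simp
    then show "P (j z) = f z" using uniq z by blast
  qed
  then show "\<exists>Q. z0 \<in> Q \<and> Q \<subseteq> U \<and> Ck_on s f Q"
    using z0 P(2) by (intro exI[of _ ?Q]) auto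
qed

text \<open>Applied to the reversed family, this shows that the image of an open set is open, as
  \<open>Ck_on\<close> demands of the domain of the inverse map.\<close>

lemma reaches_neighborhood:
  assumes "reaches \<tau> x y" "open U" "y \<in> U"
  obtains W where "open W" "x \<in> W" "\<And>x'. x' \<in> W \<Longrightarrow> \<exists>y'\<in>U. reaches \<tau> x' y'"
proof -
  obtain T P where P: "open T" "(\<tau>, x) \<in> T" "Ck_on (Suc s) P T" "P (\<tau>, x) = y"
    "\<And>\<tau> x. (\<tau>, x) \<in> T \<Longrightarrow> reaches \<tau> x (P (\<tau>, x))"
    using reaches_smooth[OF assms(1)] by metis
  have "open (T \<inter> P -` U)"
    by (rule continuous_open_preimage[OF Ck_on_continuous[OF P(3)] P(1) assms(2)])
  then have "open ((\<lambda>x'. (\<tau>, x')) -` (T \<inter> P -` U))"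
    by (rule open_vimage) (intro continuous_intros)
  then show thesis
    by (rule that) (use P assms(3) in auto)
qed

end

theorem theorem2:
  fixes V :: "'e::banach set"
    and s :: nat
    and D :: "'i::linorder \<Rightarrow> 'e set"
    and X :: "'i \<Rightarrow> 'e \<Rightarrow> 'e"
    and x0 :: 'e
    and r k :: real
  assumes "open V"
    and "\<And>\<alpha>. local_vector_field (D \<alpha>) (X \<alpha>)"
    and "\<And>\<alpha>. V \<subseteq> D \<alpha>"
    and "x0 \<in> V"
    and "r > 0"
    and "cball x0 (2 * r) \<subseteq> V"
    and "k > 0"
    and "\<And>\<alpha> y. y \<in> V \<Longrightarrow> jet_norm (s + 2) (X \<alpha>) y \<le> k"
  shows "\<exists>U0. open U0 \<and> connected U0 \<and> x0 \<in> U0 \<and>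
    (\<forall>\<tau> :: 'i ell1. norm \<tau> \<le> r / k \<longrightarrow>
      (\<forall>B. countable B \<and> support \<tau> \<subseteq> B \<longrightarrow>
        (\<forall>x\<in>U0. \<exists>y. phi D X B \<tau> x = Some y \<and> phi D X (support \<tau>) \<tau> x = Some y) \<and>
        (\<forall>x\<in>U0. \<exists>y. phi_hat D X B \<tau> x = Some y \<and> phi_hat D X (support \<tau>) \<tau> x = Some y) \<and>
        Ck_diffeo_on s (phi D X B \<tau>) (phi_hat D X B \<tau>) U0)) \<and>
    (\<forall>x\<in>U0.
      (\<forall>\<tau>\<in>ball (0 :: 'i ell1) (r / k). \<exists>y\<in>V. phi D X (support \<tau>) \<tau> x = Some y) \<and>
      Ck_on s (\<lambda>\<tau> :: 'i ell1. the (phi D X (support \<tau>) \<tau> x)) (ball 0 (r / k)))"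
proof -
  interpret bounded_family X V k s
  proof
    show "Ck_on (s + 2) (X \<alpha>) V" for \<alpha>
      using assms(2) unfolding local_vector_field_def by (intro Ck_on_subset[OF _ assms(1,3)]) auto
    show "norm (nth_deriv m (X \<alpha>) y) \<le> k" if "y \<in> V" "m \<le> s + 2" for \<alpha> m y
      using order_trans[OF norm_nth_deriv_le_jet_norm[OF that(2)] assms(8)[OF that(1)]] .
  qed (fact assms)+
  interpret forward: flow_family "(<)" X V k s
    by unfold_locales auto
  interpret backward: flow_family "\<lambda>a b. b < a" X V k s
    by (rule forward.flow_family_reverse)
  have D: "Ck_on 1 (X \<alpha>) (D \<alpha>)" "V \<subseteq> D \<alpha>" for \<alpha>
    using assms(2,3) by (auto simp: local_vector_field_def)
  have support_minus: "support (- \<tau>) = support \<tau>" for \<tau> :: "'i ell1"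
    by (simp add: support_def)
  \<comment> \<open>Besides the existence of the limit, this gives two further facts: the value does
    not depend on \<open>B\<close>, and two endpoints for the same \<open>\<tau>\<close> and
    \<open>x\<close> coincide.\<close>
  have phi: "phi D X B \<tau> x = Some y"
    if "forward.reaches \<tau> x y" "support \<tau> \<subseteq> B" for \<tau> x y and B :: "'i set"
    unfolding phi_def
    by (rule forward.partial_lim_forward_comp[where g = "\<lambda>is. is", OF D index_lists_nontrivial
          index_lists_sorted index_lists_filterlim that(2,1)])
  have phi_hat: "phi_hat D X B \<tau> x = Some y"
    if "backward.reaches (- \<tau>) x y" "support \<tau> \<subseteq> B" for \<tau> x y and B :: "'i set"
    unfolding phi_hat_def backward_comp_eq
  proof (rule backward.partial_lim_forward_comp[where g = rev, OF D index_lists_nontrivial])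
    show "\<forall>\<^sub>F is in index_lists B. sorted_wrt (\<lambda>a b. b < a) (rev is)"
      using index_lists_sorted by (simp add: sorted_wrt_rev)
    show "filterlim (\<lambda>is. set (rev is)) (finite_subsets_at_top B) (index_lists B)"
      using index_lists_filterlim by simp
  qed (use that support_minus in auto)
  \<comment> \<open>One half of the radius \<open>2 * r\<close> is spent on the starting point, the
    other on the travel, which is no longer than \<open>k * norm \<tau> \<le> r\<close>. Openness of
    the ball leaves the positive margin \<open>r - dist x x0\<close> used next.\<close>
  define U0 where "U0 = ball x0 r"
  have room: "\<exists>\<epsilon>>0. ball x (k * norm \<tau> + \<epsilon>) \<subseteq> V" if "x \<in> U0" "norm \<tau> \<le> r / k" for x and \<tau> :: "'i ell1"
  proof (intro exI[of _ "r - dist x x0"] conjI)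
    show "0 < r - dist x x0" using that(1) by (simp add: U0_def dist_commute)
    have "k * norm \<tau> \<le> r" using that(2) \<open>k > 0\<close> by (simp add: field_simps)
    then have "ball x (k * norm \<tau> + (r - dist x x0)) \<subseteq> ball x0 (2 * r)"
      by (intro ball_subset_ball_triangle) simp
    also have "\<dots> \<subseteq> V" using assms(6) by auto
    finally show "ball x (k * norm \<tau> + (r - dist x x0)) \<subseteq> V" .
  qed
  have ex: "\<exists>y. forward.reaches \<tau> x y" if "x \<in> U0" "norm \<tau> \<le> r / k" for x \<tau>
    using room[OF that] forward.reaches_exists by metis
  have ex_hat: "\<exists>y. backward.reaches (- \<tau>) x y" if "x \<in> U0" "norm \<tau> \<le> r / k" for x \<tau>
    using room[of x "- \<tau>"] that backward.reaches_exists by (metis norm_minus_cancel)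
  have rev: "backward.reaches (- \<tau>) y x \<longleftrightarrow> forward.reaches \<tau> x y" for \<tau> x y
    using forward.reaches_reverse[of \<tau> x y] backward.reaches_reverse[of "- \<tau>" y x] by auto
  have diffeo: "Ck_diffeo_on s (phi D X B \<tau>) (phi_hat D X B \<tau>) U0"
    if \<tau>: "norm \<tau> \<le> r / k" and B: "support \<tau> \<subseteq> B" for \<tau> and B :: "'i set"
  proof -
    define f where "f x = the (phi D X B \<tau> x)" for x
    define g where "g y = the (phi_hat D X B \<tau> y)" for y
    have f: "f x = y" if "forward.reaches \<tau> x y" for x y
      using phi[OF that B] by (simp add: f_def)
    have g: "g y = x" if "backward.reaches (- \<tau>) y x" for x y
      using phi_hat[OF that B] by (simp add: g_def)
    have fr: "forward.reaches \<tau> x (f x)" if "x \<in> U0" for x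
      using ex[OF that \<tau>] f by blast
    have gr: "backward.reaches (- \<tau>) y (g y)" if y: "y \<in> f ` U0" for y
    proof -
      obtain x where "x \<in> U0" "y = f x" using y by blast
      then have "backward.reaches (- \<tau>) y x" using fr by (simp add: rev)
      with g[OF this] show ?thesis by simp
    qed
    have openU0: "open U0" by (simp add: U0_def)
    have "open (f ` U0)"
      unfolding open_subopen[of "f ` U0"]
    proof
      fix y assume "y \<in> f ` U0"
      then obtain x where x: "x \<in> U0" "y = f x" by blast
      have "backward.reaches (- \<tau>) y x" using fr[OF x(1)] by (simp add: rev x(2))
      from backward.reaches_neighborhood[OF this openU0 x(1)]
      obtain W where W: "open W" "y \<in> W"
        "\<And>y'. y' \<in> W \<Longrightarrow> \<exists>x'\<in>U0. backward.reaches (- \<tau>) y' x'"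
        by blast
      have "W \<subseteq> f ` U0"
      proof
        fix y' assume "y' \<in> W"
        then obtain x' where "x' \<in> U0" "forward.reaches \<tau> x' y'" using W(3) by (auto simp: rev)
        then show "y' \<in> f ` U0" using f by (intro image_eqI[of _ _ x']) auto
      qed
      then show "\<exists>T. open T \<and> y \<in> T \<and> T \<subseteq> f ` U0" using W by blast
    qed
    then have "Ck_on s (\<lambda>y. (- \<tau>, y)) (f ` U0)"
      by (intro Ck_on_Pair Ck_on_const Ck_on_bounded_linear[OF bounded_linear_ident])
    then have "Ck_on s g (f ` U0)"
      by (rule backward.Ck_on_reaches) (simp_all add: gr g)
    moreover have "Ck_on s (\<lambda>x. (\<tau>, x)) U0"
      by (intro Ck_on_Pair Ck_on_const Ck_on_bounded_linear[OF bounded_linear_ident] openU0)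
    then have "Ck_on s f U0"
      by (rule forward.Ck_on_reaches) (simp_all add: fr f)
    moreover have "\<exists>y. phi D X B \<tau> x = Some y \<and> phi_hat D X B \<tau> y = Some x" if "x \<in> U0" for x
      using phi[OF fr[OF that] B] phi_hat[OF _ B] fr[OF that] by (auto simp: rev)
    ultimately show ?thesis
      unfolding Ck_diffeo_on_def f_def[abs_def] g_def[abs_def] by blast
  qed
  have in_V: "y \<in> V" if x: "x \<in> U0" and \<tau>: "norm \<tau> \<le> r / k" and y: "forward.reaches \<tau> x y" for x y \<tau>
  proof -
    obtain \<epsilon> where \<epsilon>: "\<epsilon> > 0" "ball x (k * norm \<tau> + \<epsilon>) \<subseteq> V" using room[OF x \<tau>] by blast
    have "y \<in> ball x (k * norm \<tau> + \<epsilon>)"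
      using forward.reaches_dist[OF y] \<epsilon>(1) by (simp add: dist_norm norm_minus_commute)
    then show ?thesis using \<epsilon>(2) by blast
  qed
  have smooth_time: "Ck_on s (\<lambda>\<tau> :: 'i ell1. the (phi D X (support \<tau>) \<tau> x)) (ball 0 (r / k))"
    if x: "x \<in> U0" for x
  proof -
    have r: "forward.reaches \<tau> x (the (phi D X (support \<tau>) \<tau> x))" if "\<tau> \<in> ball 0 (r / k)" for \<tau>
    proof -
      have "norm \<tau> \<le> r / k" using that by simp
      then obtain y where y: "forward.reaches \<tau> x y" using ex[OF x] by blast
      then show ?thesis using phi[OF y order_refl] by simp
    qed
    \<comment> \<open>Here \<open>x\<close> is frozen and \<open>\<tau>\<close> varies. The set
      \<open>support \<tau>\<close> varies along with it, which is harmless because the endpoint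
      relation does not mention it.\<close>
    have "Ck_on s (\<lambda>\<tau>. (\<tau>, x)) (ball 0 (r / k))"
      by (intro Ck_on_Pair Ck_on_const Ck_on_bounded_linear[OF bounded_linear_ident] open_ball)
    then show ?thesis
    proof (rule forward.Ck_on_reaches)
      fix \<tau> y assume "forward.reaches (fst (\<tau>, x)) (snd (\<tau>, x)) y"
      then show "y = the (phi D X (support \<tau>) \<tau> x)"
        using phi[of \<tau> x y "support \<tau>"] by simp
    qed (simp add: r)
  qed
  show ?thesis
  proof (intro exI[of _ U0] conjI allI impI ballI)
    show "open U0" "connected U0" "x0 \<in> U0" using \<open>r > 0\<close> by (auto simp: U0_def)
  next
    fix \<tau> :: "'i ell1" and B x
    assume \<tau>: "norm \<tau> \<le> r / k" and B: "countable B \<and> support \<tau> \<subseteq> B" and x: "x \<in> U0"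
    show "\<exists>y. phi D X B \<tau> x = Some y \<and> phi D X (support \<tau>) \<tau> x = Some y"
      using ex[OF x \<tau>] phi B by blast
    show "\<exists>y. phi_hat D X B \<tau> x = Some y \<and> phi_hat D X (support \<tau>) \<tau> x = Some y"
      using ex_hat[OF x \<tau>] phi_hat B by blast
  next
    fix \<tau> :: "'i ell1" and B
    assume "norm \<tau> \<le> r / k" "countable B \<and> support \<tau> \<subseteq> B"
    then show "Ck_diffeo_on s (phi D X B \<tau>) (phi_hat D X B \<tau>) U0" using diffeo by blast
  next
    fix x and \<tau> :: "'i ell1" assume x: "x \<in> U0" and "\<tau> \<in> ball 0 (r / k)"
    then have "norm \<tau> \<le> r / k" by simp
    then show "\<exists>y\<in>V. phi D X (support \<tau>) \<tau> x = Some y"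
      using ex[OF x] in_V[OF x] phi by blast
  next
    fix x assume "x \<in> U0"
    then show "Ck_on s (\<lambda>\<tau> :: 'i ell1. the (phi D X (support \<tau>) \<tau> x)) (ball 0 (r / k))"
      by (rule smooth_time)
  qed
qed

end
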